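(* Let $k$ be an integer with $k \ge 2$, and let $G$ be a graph with at least one component isomorphic to $P_3$. Then $G$ is a cograph minimal $(\infty,k)$-polar obstruction if and only if $G \cong P_3 + H$ where one of the following holds: (1) $H \cong P_3 + (k-1)K_2$; (2) $H \cong (k-2)K_2 + (K_1 \oplus 2K_2)$; (3) for some integer $j \in \{1,\dots,k-1\}$, $H \cong (k-j-1)K_2 + H_j$, where $H_j$ is a connected cograph minimal $(1,j)$-polar obstruction that is not a cograph minimal $(1,\infty)$-polar obstruction; (4) $k \ge 3$ and $H$ is any cograph minimal $(1,\infty)$-polar obstruction.
   Context: All graphs are finite and simple. A cograph is a graph with no induced subgraph isomorphic to $P_4$. $G+H$ denotes disjoint union, $G \oplus H$ the join (disjoint union plus all edges between $G$ and $H$), $nG$ the disjoint union of $n$ copies of $G$ ($0G$ is the empty graph); $K_n$, $P_n$ denote the complete graph and path on $n$ vertices. A cluster is a disjoint union of complete graphs. For $s,k \in \mathbb{Z}_{\ge 0}\cup\{\infty\}$, an $(s,k)$-polar partition of $G$ is a partition $(A,B)$ of $V(G)$ (parts may be empty) such that $G[A]$ is a complete multipartite graph with at most $s$ parts and $G[B]$ is a cluster with at most $k$ components; $\infty$ means unbounded. $G$ is $(s,k)$-polar if it has such a partition. A cograph minimal $(s,k)$-polar obstruction is a cograph that is not $(s,k)$-polar but all of whose proper induced subgraphs are $(s,k)$-polar. *)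

theory Defs
  imports "Graph_Theory.Graph_Theory" "HOL-Library.Extended_Nat" "HOL-Library.Disjoint_Sets"
begin

text \<open>
  A finite simple graph is a digraph satisfying \<^locale>\<open>graph\<close> (finite, loop-free, without parallel
  arcs, symmetric); the edge \<open>uv\<close> is the pair of arcs \<open>(u, v)\<close> and \<open>(v, u)\<close>. As the arcs are
  symmetric, the components of such a graph are its strongly connected components, given by
  \<^const>\<open>pre_digraph.sccs\<close> as induced subgraphs.
\<close>

definition path_graph :: "nat \<Rightarrow> nat pair_pre_digraph" where
  "path_graph n = \<lparr> pverts = {..<n}, parcs = {(i, j). i < n \<and> j < n \<and> (j = Suc i \<or> i = Suc j)} \<rparr>"

definition complete_graph :: "nat \<Rightarrow> nat pair_pre_digraph" where
  "complete_graph n = \<lparr> pverts = {..<n}, parcs = {(i, j). i < n \<and> j < n \<and> i \<noteq> j} \<rparr>"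

definition disjoint_union ::
    "'a pair_pre_digraph \<Rightarrow> 'b pair_pre_digraph \<Rightarrow> ('a + 'b) pair_pre_digraph" where
  "disjoint_union G H =
    \<lparr> pverts = pverts G <+> pverts H,
      parcs = {(Inl u, Inl v) | u v. (u, v) \<in> parcs G} \<union> {(Inr u, Inr v) | u v. (u, v) \<in> parcs H} \<rparr>"

definition graph_join ::
    "'a pair_pre_digraph \<Rightarrow> 'b pair_pre_digraph \<Rightarrow> ('a + 'b) pair_pre_digraph" where
  "graph_join G H =
    \<lparr> pverts = pverts G <+> pverts H,
      parcs = parcs (disjoint_union G H)
        \<union> {(Inl u, Inr v) | u v. u \<in> pverts G \<and> v \<in> pverts H}
        \<union> {(Inr v, Inl u) | u v. u \<in> pverts G \<and> v \<in> pverts H} \<rparr>"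

definition copies :: "nat \<Rightarrow> 'a pair_pre_digraph \<Rightarrow> (nat \<times> 'a) pair_pre_digraph" where
  "copies n G =
    \<lparr> pverts = {..<n} \<times> pverts G,
      parcs = {((i, u), (i, v)) | i u v. i < n \<and> (u, v) \<in> parcs G} \<rparr>"

definition cograph :: "('a, 'b) pre_digraph \<Rightarrow> bool" where
  "cograph G \<longleftrightarrow> graph G \<and>
    \<not> (\<exists>H. induced_subgraph H G \<and> digraph_iso H (with_proj (path_graph 4)))"

definition complete_multipartite_at_most :: "enat \<Rightarrow> ('a, 'b) pre_digraph \<Rightarrow> bool" where
  "complete_multipartite_at_most s G \<longleftrightarrow> graph G \<and>
    (\<exists>P. partition_on (verts G) P \<and> enat (card P) \<le> s \<and>
      (\<forall>u\<in>verts G. \<forall>v\<in>verts G. u \<rightarrow>\<^bsub>G\<^esub> v \<longleftrightarrow> \<not> (\<exists>X\<in>P. u \<in> X \<and> v \<in> X)))"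

definition cluster :: "('a, 'b) pre_digraph \<Rightarrow> bool" where
  "cluster G \<longleftrightarrow> graph G \<and> (\<forall>C\<in>pre_digraph.sccs G. \<exists>n. complete_digraph n C)"

definition polar_partition ::
    "enat \<Rightarrow> enat \<Rightarrow> ('a, 'b) pre_digraph \<Rightarrow> 'a set \<Rightarrow> 'a set \<Rightarrow> bool" where
  "polar_partition s k G A B \<longleftrightarrow>
    A \<union> B = verts G \<and> A \<inter> B = {} \<and>
    complete_multipartite_at_most s (G \<restriction> A) \<and>
    cluster (G \<restriction> B) \<and> enat (card (pre_digraph.sccs (G \<restriction> B))) \<le> k"

definition polar :: "enat \<Rightarrow> enat \<Rightarrow> ('a, 'b) pre_digraph \<Rightarrow> bool" where
  "polar s k G \<longleftrightarrow> (\<exists>A B. polar_partition s k G A B)"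

definition cograph_min_polar_obstruction :: "enat \<Rightarrow> enat \<Rightarrow> ('a, 'b) pre_digraph \<Rightarrow> bool" where
  "cograph_min_polar_obstruction s k G \<longleftrightarrow>
    cograph G \<and> \<not> polar s k G \<and>
    (\<forall>H. induced_subgraph H G \<and> H \<noteq> G \<longrightarrow> polar s k H)"

end

theory Submission
  imports Defs
begin

text \<open>
  Let \<open>P\<close> be the component \<open>P\<^sub>3\<close> and \<open>H\<close> the rest of the graph. The multipartite part of an
  \<open>(\<infinity>, k)\<close>-polar partition is independent or lies in one component, and in the second case this
  component is \<open>P\<close>. Hence \<open>P + H\<close> is \<open>(\<infinity>, k)\<close>-polar iff \<open>H\<close> is \<open>(1, k - 1)\<close>-polar or a cluster with
  at most \<open>k\<close> components; in the same way the minimality of \<open>P + H\<close> becomes a condition on \<open>H\<close> alone.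
  The least \<open>i\<close> for which a graph is \<open>(1, i)\<close>-polar is additive over disjoint unions.

  If some \<open>H - v\<close> is a cluster that is not \<open>(1, k - 1)\<close>-polar, it contains \<open>k\<close> independent edges, and
  the absence of an induced \<open>P\<^sub>4\<close> leaves only (1) and (2). Otherwise \<open>H\<close> is a minimal
  \<open>(1, k - 1)\<close>-polar obstruction, and since \<open>H\<close> is \<open>(\<infinity>, k - 1)\<close>-polar, all its components but one are
  edges, which gives (3) and (4).

  For the converse, the condition for \<open>D + tK\<^sub>2\<close> and \<open>t + m\<close> follows from the one for \<open>D\<close> and \<open>m\<close> when
  \<open>D\<close> is \<open>(1, m)\<close>-polar, which reduces (1), (2) and (3) to \<open>P\<^sub>3\<close>, \<open>K\<^sub>1 \<oplus> 2K\<^sub>2\<close> and \<open>H\<^sub>j\<close>. A connected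
  cograph such as \<open>H\<^sub>j\<close> is a join, and in a \<open>(1, i)\<close>-polar partition of a join that is not a split graph,
  the two parts are the two factors. For (4), a cograph that is not \<open>(1, \<infinity>)\<close>-polar has an
  induced subgraph of one of four kinds, each of which satisfies the condition for \<open>k \<ge> 3\<close>.
\<close>

section \<open>Induced subgraphs of a simple graph\<close>

locale simple_graph =
  fixes E :: "'a \<Rightarrow> 'a \<Rightarrow> bool"
  assumes adj_sym: "E x y \<Longrightarrow> E y x" and adj_irrefl: "\<not> E x x"

definition complement :: "('a \<Rightarrow> 'a \<Rightarrow> bool) \<Rightarrow> 'a \<Rightarrow> 'a \<Rightarrow> bool" where
  "complement E x y \<longleftrightarrow> x \<noteq> y \<and> \<not> E x y"

definition anticomplete :: "('a \<Rightarrow> 'a \<Rightarrow> bool) \<Rightarrow> 'a set \<Rightarrow> 'a set \<Rightarrow> bool" where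
  "anticomplete E X Y \<longleftrightarrow> X \<inter> Y = {} \<and> (\<forall>x\<in>X. \<forall>y\<in>Y. \<not> E x y)"

definition complete_to :: "('a \<Rightarrow> 'a \<Rightarrow> bool) \<Rightarrow> 'a set \<Rightarrow> 'a set \<Rightarrow> bool" where
  "complete_to E X Y \<longleftrightarrow> X \<inter> Y = {} \<and> (\<forall>x\<in>X. \<forall>y\<in>Y. E x y)"

definition indep_set :: "('a \<Rightarrow> 'a \<Rightarrow> bool) \<Rightarrow> 'a set \<Rightarrow> bool" where
  "indep_set E S \<longleftrightarrow> (\<forall>x\<in>S. \<forall>y\<in>S. \<not> E x y)"

definition clique_set :: "('a \<Rightarrow> 'a \<Rightarrow> bool) \<Rightarrow> 'a set \<Rightarrow> bool" where
  "clique_set E S \<longleftrightarrow> (\<forall>x\<in>S. \<forall>y\<in>S. x \<noteq> y \<longrightarrow> E x y)"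

definition induced_P3 :: "('a \<Rightarrow> 'a \<Rightarrow> bool) \<Rightarrow> 'a \<Rightarrow> 'a \<Rightarrow> 'a \<Rightarrow> bool" where
  "induced_P3 E a b c \<longleftrightarrow> E a b \<and> E b c \<and> \<not> E a c \<and> a \<noteq> c"

definition P3_free :: "('a \<Rightarrow> 'a \<Rightarrow> bool) \<Rightarrow> 'a set \<Rightarrow> bool" where
  "P3_free E V \<longleftrightarrow> (\<forall>a\<in>V. \<forall>b\<in>V. \<forall>c\<in>V. \<not> induced_P3 E a b c)"

definition P4_free :: "('a \<Rightarrow> 'a \<Rightarrow> bool) \<Rightarrow> 'a set \<Rightarrow> bool" where
  "P4_free E V \<longleftrightarrow> (\<forall>a\<in>V. \<forall>b\<in>V. \<forall>c\<in>V. \<forall>d\<in>V.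
     \<not> (E a b \<and> E b c \<and> E c d \<and> \<not> E a c \<and> \<not> E a d \<and> \<not> E b d))"

text \<open>Clusters are the \<open>P\<^sub>3\<close>-free graphs, and the number of components of a cluster is the size of its
  largest independent set.\<close>
definition cluster_on :: "('a \<Rightarrow> 'a \<Rightarrow> bool) \<Rightarrow> enat \<Rightarrow> 'a set \<Rightarrow> bool" where
  "cluster_on E k V \<longleftrightarrow> P3_free E V \<and> (\<forall>S\<subseteq>V. indep_set E S \<longrightarrow> enat (card S) \<le> k)"

text \<open>A graph is complete multipartite with at most \<open>s\<close> parts iff its complement is a cluster with at
  most \<open>s\<close> components.\<close>
definition polar_on :: "('a \<Rightarrow> 'a \<Rightarrow> bool) \<Rightarrow> enat \<Rightarrow> enat \<Rightarrow> 'a set \<Rightarrow> bool" where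
  "polar_on E s k V \<longleftrightarrow> (\<exists>A\<subseteq>V. cluster_on (complement E) s A \<and> cluster_on E k (V - A))"

abbreviation complete_multipartite :: "('a \<Rightarrow> 'a \<Rightarrow> bool) \<Rightarrow> 'a set \<Rightarrow> bool" where
  "complete_multipartite E \<equiv> P3_free (complement E)"

lemma indep_set_subset: "indep_set E T \<Longrightarrow> S \<subseteq> T \<Longrightarrow> indep_set E S"
  unfolding indep_set_def by blast

lemma clique_set_subset: "clique_set E T \<Longrightarrow> S \<subseteq> T \<Longrightarrow> clique_set E S"
  unfolding clique_set_def by blast

lemma P3_free_subset: "P3_free E T \<Longrightarrow> S \<subseteq> T \<Longrightarrow> P3_free E S"
  unfolding P3_free_def by blast

lemma P4_free_subset: "P4_free E T \<Longrightarrow> S \<subseteq> T \<Longrightarrow> P4_free E S"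
  unfolding P4_free_def by blast

lemma anticomplete_subset: "anticomplete E X Y \<Longrightarrow> X' \<subseteq> X \<Longrightarrow> Y' \<subseteq> Y \<Longrightarrow> anticomplete E X' Y'"
  unfolding anticomplete_def by blast

lemma complete_to_subset: "complete_to E X Y \<Longrightarrow> X' \<subseteq> X \<Longrightarrow> Y' \<subseteq> Y \<Longrightarrow> complete_to E X' Y'"
  unfolding complete_to_def by blast

lemma anticomplete_complement: "anticomplete (complement E) X Y \<longleftrightarrow> complete_to E X Y"
  unfolding anticomplete_def complete_to_def complement_def disjoint_iff by metis

lemma P3_freeD:
  "P3_free E V \<Longrightarrow> x \<in> V \<Longrightarrow> y \<in> V \<Longrightarrow> z \<in> V \<Longrightarrow> E x y \<Longrightarrow> E y z \<Longrightarrow> x \<noteq> z \<Longrightarrow> E x z"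
  unfolding P3_free_def induced_P3_def by blast

lemma cluster_on_infty: "cluster_on E \<infinity> V \<longleftrightarrow> P3_free E V"
  unfolding cluster_on_def by simp

lemma cluster_on_P3_free: "cluster_on E k V \<Longrightarrow> P3_free E V"
  unfolding cluster_on_def by blast

lemma cluster_on_card_le: "cluster_on E (enat k) V \<Longrightarrow> S \<subseteq> V \<Longrightarrow> indep_set E S \<Longrightarrow> card S \<le> k"
  unfolding cluster_on_def by simp

lemma cluster_onI:
  "P3_free E V \<Longrightarrow> (\<And>S. S \<subseteq> V \<Longrightarrow> indep_set E S \<Longrightarrow> card S \<le> k) \<Longrightarrow> cluster_on E (enat k) V"
  unfolding cluster_on_def by simp

lemma cluster_on_mono: "cluster_on E i T \<Longrightarrow> S \<subseteq> T \<Longrightarrow> i \<le> j \<Longrightarrow> cluster_on E j S"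
  unfolding cluster_on_def using P3_free_subset by (meson order.trans)

lemma polar_on_mono:
  assumes "polar_on E s k T" "S \<subseteq> T" "s \<le> s'" "k \<le> k'"
  shows "polar_on E s' k' S"
proof -
  obtain A where A: "cluster_on (complement E) s A" "cluster_on E k (T - A)"
    using assms(1) unfolding polar_on_def by blast
  have "cluster_on (complement E) s' (A \<inter> S)" using cluster_on_mono[OF A(1) _ assms(3)] by blast
  moreover have "cluster_on E k' (S - A \<inter> S)"
    using cluster_on_mono[OF A(2) _ assms(4)] assms(2) by blast
  ultimately show ?thesis unfolding polar_on_def by blast
qed

lemma polar_on_infty_iff:
  "polar_on E \<infinity> k V \<longleftrightarrow> (\<exists>A\<subseteq>V. complete_multipartite E A \<and> cluster_on E k (V - A))"
  unfolding polar_on_def cluster_on_infty ..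

lemma polar_on_inftyI:
  assumes "complete_multipartite E A" "cluster_on E k B" "V \<subseteq> A \<union> B"
  shows "polar_on E \<infinity> k V"
proof -
  have "complete_multipartite E (A \<inter> V)" using P3_free_subset[OF assms(1)] by blast
  moreover have "cluster_on E k (V - A \<inter> V)"
    using assms(3) by (intro cluster_on_mono[OF assms(2) _ order_refl]) auto
  ultimately show ?thesis unfolding polar_on_infty_iff by blast
qed

lemma cluster_on_empty: "cluster_on E k {}"
  unfolding cluster_on_def P3_free_def by (simp flip: zero_enat_def)

lemma polar_on_cluster: "cluster_on E k V \<Longrightarrow> polar_on E s k V"
  unfolding polar_on_def using cluster_on_empty by (intro exI[of _ "{}"]) simp

lemma polar_on_infty_complete_multipartite: "complete_multipartite E V \<Longrightarrow> polar_on E \<infinity> k V"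
  using polar_on_inftyI[OF _ cluster_on_empty] by blast

context simple_graph begin

lemma simple_graph_complement: "simple_graph (complement E)"
  by standard (auto simp: complement_def adj_sym)

lemma complement_complement: "complement (complement E) = E"
  using adj_irrefl unfolding complement_def by fastforce

lemma indep_set_complement: "indep_set (complement E) S \<longleftrightarrow> clique_set E S"
  unfolding indep_set_def clique_set_def complement_def by blast

lemma anticomplete_sym: "anticomplete E X Y \<Longrightarrow> anticomplete E Y X"
  unfolding anticomplete_def using adj_sym by blast

lemma complete_to_sym: "complete_to E X Y \<Longrightarrow> complete_to E Y X"
  unfolding complete_to_def using adj_sym by blast

lemma anticompleteD:
  "anticomplete E X Y \<Longrightarrow> x \<in> X \<Longrightarrow> y \<in> Y \<Longrightarrow> \<not> E x y \<and> \<not> E y x \<and> x \<noteq> y"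
  unfolding anticomplete_def using adj_sym by blast

lemma complete_toD: "complete_to E X Y \<Longrightarrow> x \<in> X \<Longrightarrow> y \<in> Y \<Longrightarrow> E x y \<and> E y x \<and> x \<noteq> y"
  unfolding complete_to_def using adj_sym by blast

lemma indep_set_empty: "indep_set E {}" and indep_set_singleton: "indep_set E {x}"
  unfolding indep_set_def using adj_irrefl by auto

lemma indep_set_doubleton_iff: "indep_set E {x, y} \<longleftrightarrow> \<not> E x y"
  unfolding indep_set_def using adj_irrefl adj_sym by blast

lemma clique_set_singleton: "clique_set E {x}"
  unfolding clique_set_def by blast

lemma clique_set_edge: "E x y \<Longrightarrow> clique_set E {x, y}"
  unfolding clique_set_def using adj_sym by auto

lemma P3_free_clique: "clique_set E S \<Longrightarrow> P3_free E S"
  unfolding clique_set_def P3_free_def induced_P3_def by blast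

lemma P3_free_indep: "indep_set E S \<Longrightarrow> P3_free E S"
  unfolding indep_set_def P3_free_def induced_P3_def by blast

lemma indep_set_clique_set_eq: "indep_set E S \<Longrightarrow> clique_set E S \<Longrightarrow> x \<in> S \<Longrightarrow> y \<in> S \<Longrightarrow> x = y"
  unfolding indep_set_def clique_set_def by blast

lemma cluster_on_1_iff: "cluster_on E (enat 1) K \<longleftrightarrow> clique_set E K"
proof
  assume cl: "cluster_on E (enat 1) K"
  show "clique_set E K"
    unfolding clique_set_def
  proof (intro ballI impI, rule ccontr)
    fix x y assume "x \<in> K" "y \<in> K" "x \<noteq> y" "\<not> E x y"
    then show False using cluster_on_card_le[OF cl, of "{x, y}"] indep_set_doubleton_iff by simp
  qed
next
  assume cq: "clique_set E K"
  show "cluster_on E (enat 1) K"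
  proof (rule cluster_onI[OF P3_free_clique[OF cq]])
    fix S assume S: "S \<subseteq> K" "indep_set E S"
    then have "x = y" if "x \<in> S" "y \<in> S" for x y
      using indep_set_clique_set_eq[OF S(2)] clique_set_subset[OF cq] that by blast
    then show "card S \<le> 1" by (metis One_nat_def card.infinite card_le_Suc0_iff_eq zero_le_one)
  qed
qed

lemma cluster_on_0_iff: "cluster_on E (enat 0) V \<longleftrightarrow> V = {}"
proof
  show "V = {}" if "cluster_on E (enat 0) V"
    using cluster_on_card_le[OF that, of "{x}" for x] indep_set_singleton by fastforce
qed (simp add: cluster_on_empty)

lemma cluster_on_pos: "cluster_on E (enat i) V \<Longrightarrow> x \<in> V \<Longrightarrow> 1 \<le> i"
  using cluster_on_0_iff by (cases i) auto

lemma cluster_on_indep_iff: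
  assumes "finite S" "indep_set E S"
  shows "cluster_on E (enat i) S \<longleftrightarrow> card S \<le> i"
proof
  show "card S \<le> i" if "cluster_on E (enat i) S"
    using cluster_on_card_le[OF that subset_refl assms(2)] .
  show "cluster_on E (enat i) S" if "card S \<le> i"
    using assms that by (intro cluster_onI P3_free_indep) (meson card_mono order.trans)+
qed

lemma polar_on_1_iff: "polar_on E 1 k V \<longleftrightarrow> (\<exists>A\<subseteq>V. indep_set E A \<and> cluster_on E k (V - A))"
  unfolding polar_on_def one_enat_def
  using simple_graph.cluster_on_1_iff[OF simple_graph_complement]
    simple_graph.indep_set_complement[OF simple_graph_complement]
  by (simp add: complement_complement)

lemma polar_on_1I:
  assumes "indep_set E A" "cluster_on E k B" "V \<subseteq> A \<union> B"
  shows "polar_on E 1 k V"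
proof -
  have "indep_set E (A \<inter> V)" using indep_set_subset[OF assms(1)] by blast
  moreover have "cluster_on E k (V - A \<inter> V)"
    using assms(3) by (intro cluster_on_mono[OF assms(2) _ order_refl]) auto
  ultimately show ?thesis unfolding polar_on_1_iff by blast
qed

lemma polar_on_1_1I:
  "indep_set E A \<Longrightarrow> clique_set E B \<Longrightarrow> V \<subseteq> A \<union> B \<Longrightarrow> polar_on E 1 (enat 1) V"
  using polar_on_1I cluster_on_1_iff by blast

lemma polar_on_1_imp_infty: "polar_on E 1 k V \<Longrightarrow> polar_on E \<infinity> k V"
  by (rule polar_on_mono) auto

lemma polar_on_1_imp_monopolar: "polar_on E 1 k V \<Longrightarrow> polar_on E 1 \<infinity> V"
  by (rule polar_on_mono) auto

lemma polar_on_1_enat_mono: "polar_on E 1 (enat i) V \<Longrightarrow> i \<le> j \<Longrightarrow> polar_on E 1 (enat j) V"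
  by (rule polar_on_mono) auto

lemma polar_on_1_finite:
  assumes "finite V" "polar_on E 1 \<infinity> V"
  obtains k where "polar_on E 1 (enat k) V"
proof -
  obtain A where A: "A \<subseteq> V" "indep_set E A" "P3_free E (V - A)"
    using assms(2) unfolding polar_on_1_iff cluster_on_infty by blast
  have "cluster_on E (enat (card V)) (V - A)"
    using A(3) assms(1) by (intro cluster_onI card_mono) auto
  then show ?thesis using that A unfolding polar_on_1_iff by blast
qed

lemma polar_on_1_0_iff: "polar_on E 1 (enat 0) V \<longleftrightarrow> indep_set E V"
  unfolding polar_on_1_iff cluster_on_0_iff using indep_set_subset by fastforce

lemma polar_on_1_edge: "polar_on E 1 (enat i) V \<Longrightarrow> x \<in> V \<Longrightarrow> y \<in> V \<Longrightarrow> E x y \<Longrightarrow> 1 \<le> i"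
  using polar_on_1_0_iff unfolding indep_set_def by (cases i) auto

lemma complete_multipartite_iff:
  "complete_multipartite E A \<longleftrightarrow> (\<forall>x\<in>A. \<forall>y\<in>A. \<forall>z\<in>A. \<not> E x y \<longrightarrow> \<not> E y z \<longrightarrow> \<not> E x z)"
  unfolding P3_free_def induced_P3_def complement_def using adj_irrefl by metis

lemma complete_multipartite_indep: "indep_set E A \<Longrightarrow> complete_multipartite E A"
  unfolding complete_multipartite_iff indep_set_def by blast

lemma complete_multipartite_clique: "clique_set E A \<Longrightarrow> complete_multipartite E A"
  unfolding complete_multipartite_iff clique_set_def using adj_irrefl by metis

lemma complete_multipartite_adj_edge:
  "complete_multipartite E A \<Longrightarrow> a \<in> A \<Longrightarrow> b \<in> A \<Longrightarrow> E a b \<Longrightarrow> z \<in> A \<Longrightarrow> E a z \<or> E b z"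
  unfolding complete_multipartite_iff using adj_sym by metis

lemma P3_free_component:
  assumes "P3_free E V" "x \<in> V"
  obtains K where "x \<in> K" "K \<subseteq> V" "clique_set E K" "anticomplete E K (V - K)"
proof
  define K where "K = {z \<in> V. z = x \<or> E x z}"
  note P3 = P3_freeD[OF assms(1)]
  show "x \<in> K" "K \<subseteq> V" using assms(2) unfolding K_def by auto
  show "clique_set E K"
    unfolding clique_set_def K_def using P3[of _ x] adj_sym assms(2) by blast
  show "anticomplete E K (V - K)"
    unfolding anticomplete_def K_def using P3[of x] assms(2) by blast
qed

section \<open>Disjoint unions\<close>

lemma indep_set_Un:
  assumes "anticomplete E X Y" "indep_set E A" "indep_set E B" "A \<subseteq> X" "B \<subseteq> Y"
  shows "indep_set E (A \<union> B)"
  using assms anticompleteD[OF assms(1)] unfolding indep_set_def by blast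

lemma indep_set_insert: "indep_set E S \<Longrightarrow> (\<And>s. s \<in> S \<Longrightarrow> \<not> E x s) \<Longrightarrow> indep_set E (insert x S)"
  unfolding indep_set_def using adj_sym adj_irrefl by blast

lemma P3_free_Un:
  assumes "anticomplete E X Y" "P3_free E X" "P3_free E Y"
  shows "P3_free E (X \<union> Y)"
  using assms anticomplete_sym[OF assms(1)]
  unfolding anticomplete_def P3_free_def induced_P3_def by blast

lemma P4_free_Un:
  assumes "anticomplete E X Y" "P4_free E X" "P4_free E Y"
  shows "P4_free E (X \<union> Y)"
  unfolding P4_free_def
proof (intro ballI notI)
  fix a b c d assume V: "a \<in> X \<union> Y" "b \<in> X \<union> Y" "c \<in> X \<union> Y" "d \<in> X \<union> Y"
    and path: "E a b \<and> E b c \<and> E c d \<and> \<not> E a c \<and> \<not> E a d \<and> \<not> E b d"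
  have "x \<in> X \<longleftrightarrow> y \<in> X" if "E x y" "x \<in> X \<union> Y" "y \<in> X \<union> Y" for x y
    using anticompleteD[OF assms(1)] that by blast
  from this[of a b] this[of b c] this[of c d] V path
  have "{a, b, c, d} \<subseteq> X \<or> {a, b, c, d} \<subseteq> Y" by blast
  then have "P4_free E {a, b, c, d}" using P4_free_subset assms(2,3) by blast
  then show False using path unfolding P4_free_def by simp
qed

lemma cluster_on_Un:
  assumes "anticomplete E X Y" "cluster_on E (enat i) X" "cluster_on E (enat j) Y"
  shows "cluster_on E (enat (i + j)) (X \<union> Y)"
proof (rule cluster_onI)
  show "P3_free E (X \<union> Y)" using P3_free_Un assms cluster_on_P3_free by blast
  fix S assume S: "S \<subseteq> X \<union> Y" "indep_set E S"
  have "card S \<le> card (S \<inter> X) + card (S \<inter> Y)"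
    using S(1) card_Un_le[of "S \<inter> X" "S \<inter> Y"] by (simp add: Int_absorb2 flip: Int_Un_distrib)
  also have "\<dots> \<le> i + j"
    using indep_set_subset[OF S(2)]
    by (intro add_mono cluster_on_card_le[OF assms(2)] cluster_on_card_le[OF assms(3)]) auto
  finally show "card S \<le> i + j" .
qed

lemma cluster_on_UnE:
  assumes "finite X" "finite Y" "anticomplete E X Y" "cluster_on E (enat n) (X \<union> Y)"
  obtains i j where "i + j = n" "cluster_on E (enat i) X" "cluster_on E (enat j) Y"
proof -
  have "\<exists>S. (S \<subseteq> X \<and> indep_set E S) \<and> (\<forall>T. T \<subseteq> X \<and> indep_set E T \<longrightarrow> card T \<le> card S)"
    using card_mono[OF assms(1)] indep_set_empty
    by (intro ex_has_greatest_nat[of _ "{}" card "Suc (card X)"]) (auto simp: less_Suc_eq_le)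
  then obtain S where S: "S \<subseteq> X" "indep_set E S"
    and max: "\<And>T. T \<subseteq> X \<Longrightarrow> indep_set E T \<Longrightarrow> card T \<le> card S" by blast
  have P3: "P3_free E (X \<union> Y)" using cluster_on_P3_free[OF assms(4)] .
  have add: "card S + card T \<le> n" if T: "T \<subseteq> Y" "indep_set E T" for T
  proof -
    have "card (S \<union> T) \<le> n"
      using S T indep_set_Un[OF assms(3)] by (intro cluster_on_card_le[OF assms(4)]) auto
    moreover have "card (S \<union> T) = card S + card T"
      using S T assms(1,2,3) unfolding anticomplete_def
      by (intro card_Un_disjoint) (auto intro: finite_subset)
    ultimately show ?thesis by simp
  qed
  have "cluster_on E (enat (card S)) X" using P3_free_subset[OF P3] max by (intro cluster_onI) auto
  moreover have "cluster_on E (enat (n - card S)) Y"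
  proof (rule cluster_onI)
    show "P3_free E Y" using P3_free_subset[OF P3] by blast
    show "card T \<le> n - card S" if "T \<subseteq> Y" "indep_set E T" for T using add[OF that] by simp
  qed
  moreover have "card S \<le> n" using add[of "{}"] indep_set_empty by simp
  ultimately show ?thesis using that[of "card S" "n - card S"] by simp
qed

lemma polar_on_1_Un:
  assumes "anticomplete E X Y" "polar_on E 1 (enat i) X" "polar_on E 1 (enat j) Y"
  shows "polar_on E 1 (enat (i + j)) (X \<union> Y)"
proof -
  obtain A where A: "A \<subseteq> X" "indep_set E A" "cluster_on E (enat i) (X - A)"
    using assms(2) unfolding polar_on_1_iff by blast
  obtain B where B: "B \<subseteq> Y" "indep_set E B" "cluster_on E (enat j) (Y - B)"
    using assms(3) unfolding polar_on_1_iff by blast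
  have "cluster_on E (enat (i + j)) ((X - A) \<union> (Y - B))"
    using cluster_on_Un[OF anticomplete_subset[OF assms(1)]] A(3) B(3) by blast
  moreover have "indep_set E (A \<union> B)" using indep_set_Un[OF assms(1)] A B by blast
  ultimately show ?thesis by (intro polar_on_1I[of "A \<union> B" _ "(X - A) \<union> (Y - B)"]) auto
qed

lemma polar_on_1_UnE:
  assumes "finite X" "finite Y" "anticomplete E X Y" "polar_on E 1 (enat n) (X \<union> Y)"
  obtains i j where "i + j = n" "polar_on E 1 (enat i) X" "polar_on E 1 (enat j) Y"
proof -
  obtain A where A: "indep_set E A" "cluster_on E (enat n) ((X - A) \<union> (Y - A))"
    using assms(4) unfolding polar_on_1_iff Un_Diff by blast
  obtain i j where ij: "i + j = n" "cluster_on E (enat i) (X - A)" "cluster_on E (enat j) (Y - A)"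
    using cluster_on_UnE[OF _ _ anticomplete_subset[OF assms(3)] A(2)] assms(1,2) by blast
  have "polar_on E 1 (enat i) X" "polar_on E 1 (enat j) Y"
    using polar_on_1I[OF A(1) ij(2)] polar_on_1I[OF A(1) ij(3)] by blast+
  then show ?thesis using that ij(1) by blast
qed

lemma cluster_on_Un_iff:
  assumes "finite X" "finite Y" "anticomplete E X Y"
    and "\<And>i. cluster_on E (enat i) X \<longleftrightarrow> c \<le> i"
  shows "cluster_on E (enat n) (X \<union> Y) \<longleftrightarrow> c \<le> n \<and> cluster_on E (enat (n - c)) Y"
proof
  assume "cluster_on E (enat n) (X \<union> Y)"
  then obtain i j where ij: "i + j = n" "c \<le> i" "cluster_on E (enat j) Y"
    using cluster_on_UnE[OF assms(1-3)] assms(4) by metis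
  then show "c \<le> n \<and> cluster_on E (enat (n - c)) Y"
    using cluster_on_mono[OF ij(3) subset_refl, of "enat (n - c)"] by simp
next
  assume "c \<le> n \<and> cluster_on E (enat (n - c)) Y"
  then show "cluster_on E (enat n) (X \<union> Y)"
    using cluster_on_Un[OF assms(3), of c "n - c"] assms(4) by simp
qed

lemma polar_on_1_Un_iff:
  assumes "finite X" "finite Y" "anticomplete E X Y"
    and "\<And>i. polar_on E 1 (enat i) X \<longleftrightarrow> c \<le> i"
  shows "polar_on E 1 (enat n) (X \<union> Y) \<longleftrightarrow> c \<le> n \<and> polar_on E 1 (enat (n - c)) Y"
proof
  assume "polar_on E 1 (enat n) (X \<union> Y)"
  then obtain i j where ij: "i + j = n" "c \<le> i" "polar_on E 1 (enat j) Y"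
    using polar_on_1_UnE[OF assms(1-3)] assms(4) by metis
  then show "c \<le> n \<and> polar_on E 1 (enat (n - c)) Y"
    using polar_on_1_enat_mono[OF ij(3), of "n - c"] by simp
next
  assume "c \<le> n \<and> polar_on E 1 (enat (n - c)) Y"
  then show "polar_on E 1 (enat n) (X \<union> Y)"
    using polar_on_1_Un[OF assms(3), of c "n - c"] assms(4) by simp
qed

end

section \<open>Induced matchings\<close>

definition induced_matching :: "('a \<Rightarrow> 'a \<Rightarrow> bool) \<Rightarrow> nat \<Rightarrow> 'a set \<Rightarrow> bool" where
  "induced_matching E n W \<longleftrightarrow> finite W \<and> card W = 2 * n \<and>
     (\<forall>x\<in>W. \<exists>y\<in>W. E x y \<and> (\<forall>z\<in>W. E x z \<longrightarrow> z = y))"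

lemma induced_matching_finite: "induced_matching E n W \<Longrightarrow> finite W"
  unfolding induced_matching_def by blast

lemma induced_matching_0_iff: "induced_matching E 0 W \<longleftrightarrow> W = {}"
  unfolding induced_matching_def by (cases "W = {}") (simp_all add: card_gt_0_iff)

context simple_graph begin

lemma induced_matching_remove_edge:
  assumes "induced_matching E n W" "x \<in> W"
  obtains y m where "y \<in> W" "E x y" "n = Suc m" "induced_matching E m (W - {x, y})"
    "anticomplete E {x, y} (W - {x, y})"
proof -
  obtain y where y: "y \<in> W" "E x y" and nx: "\<And>z. z \<in> W \<Longrightarrow> E x z \<Longrightarrow> z = y"
    using assms unfolding induced_matching_def by metis
  have ny: "z = x" if "z \<in> W" "E y z" for z
    using assms y adj_sym[OF y(2)] that unfolding induced_matching_def by metis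
  have xy: "x \<noteq> y" using y(2) adj_irrefl by blast
  have fin: "finite W" using induced_matching_finite[OF assms(1)] .
  have "card {x, y} \<le> card W" using assms(2) y(1) fin by (intro card_mono) auto
  then obtain m where m: "n = Suc m" using assms(1) xy unfolding induced_matching_def by (cases n) auto
  have "card (W - {x, y}) = 2 * m"
    using assms m y(1) xy fin unfolding induced_matching_def by (subst card_Diff_subset) auto
  moreover have "\<exists>w\<in>W - {x, y}. E z w \<and> (\<forall>u\<in>W - {x, y}. E z u \<longrightarrow> u = w)" if z: "z \<in> W - {x, y}" for z
  proof -
    obtain w where w: "w \<in> W" "E z w" "\<forall>u\<in>W. E z u \<longrightarrow> u = w"
      using assms(1) z unfolding induced_matching_def by blast
    then have "w \<in> W - {x, y}" using nx ny z adj_sym by blast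
    then show ?thesis using w by blast
  qed
  ultimately have "induced_matching E m (W - {x, y})" unfolding induced_matching_def using fin by blast
  moreover have "anticomplete E {x, y} (W - {x, y})" unfolding anticomplete_def using nx ny by auto
  ultimately show ?thesis using that y m by blast
qed

lemma induced_matching_insert_edge:
  assumes "induced_matching E n W" "anticomplete E {x, y} W" "E x y"
  shows "induced_matching E (Suc n) ({x, y} \<union> W)"
proof -
  have xy: "x \<noteq> y" "E y x" using assms(3) adj_irrefl adj_sym by blast+
  note fin = induced_matching_finite[OF assms(1)]
  have "card ({x, y} \<union> W) = card {x, y} + card W"
    using assms(2) fin unfolding anticomplete_def by (intro card_Un_disjoint) auto
  then have "card ({x, y} \<union> W) = 2 * Suc n" using assms(1) xy unfolding induced_matching_def by simp
  moreover have "\<exists>v\<in>{x, y} \<union> W. E u v \<and> (\<forall>z\<in>{x, y} \<union> W. E u z \<longrightarrow> z = v)" if u: "u \<in> {x, y} \<union> W" for u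
  proof (cases "u \<in> W")
    case True
    then obtain w where "w \<in> W" "E u w" "\<forall>z\<in>W. E u z \<longrightarrow> z = w"
      using assms(1) unfolding induced_matching_def by blast
    then show ?thesis using anticompleteD[OF assms(2) _ True] by blast
  next
    case False
    then have "u = x \<or> u = y" using u by blast
    then show ?thesis
      using assms(2,3) xy(2) adj_irrefl[of x] adj_irrefl[of y] unfolding anticomplete_def by fastforce
  qed
  ultimately show ?thesis using fin unfolding induced_matching_def by blast
qed

lemma induced_matching_1: "E x y \<Longrightarrow> induced_matching E 1 {x, y}"
  using induced_matching_insert_edge[of 0 "{}" x y]
  by (auto simp: induced_matching_0_iff anticomplete_def)

lemma induced_matching_2:
  "E a b \<Longrightarrow> E c d \<Longrightarrow> anticomplete E {a, b} {c, d} \<Longrightarrow> induced_matching E 2 {a, b, c, d}"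
  using induced_matching_insert_edge[OF induced_matching_1[of c d], of a b]
  by (simp add: numeral_2_eq_2 insert_commute)

lemma induced_matching_induct [consumes 1, case_names empty edge]:
  assumes "induced_matching E n W" "P 0 {}"
    and "\<And>n x y W. induced_matching E n W \<Longrightarrow> P n W \<Longrightarrow> anticomplete E {x, y} W \<Longrightarrow> E x y \<Longrightarrow>
      P (Suc n) ({x, y} \<union> W)"
  shows "P n W"
  using assms(1)
proof (induction n arbitrary: W)
  case 0
  then show ?case using assms(2) by (simp add: induced_matching_0_iff)
next
  case (Suc n)
  then obtain x where x: "x \<in> W" unfolding induced_matching_def by fastforce
  obtain y where y: "y \<in> W" "E x y" "induced_matching E n (W - {x, y})"
    "anticomplete E {x, y} (W - {x, y})"
    using induced_matching_remove_edge[OF Suc.prems x] by (metis Suc_inject)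
  have "P (Suc n) ({x, y} \<union> (W - {x, y}))" using assms(3) Suc.IH y by blast
  moreover have "{x, y} \<union> (W - {x, y}) = W" using x y(1) by blast
  ultimately show ?case by simp
qed

lemma cluster_on_edge_iff:
  assumes "E x y" shows "cluster_on E (enat i) {x, y} \<longleftrightarrow> 1 \<le> i"
proof
  show "cluster_on E (enat i) {x, y}" if "1 \<le> i"
    using cluster_on_mono[OF _ subset_refl, of E "enat 1"] cluster_on_1_iff clique_set_edge[OF assms]
      that by simp
qed (rule cluster_on_pos[of _ "{x, y}" x], simp_all)

lemma polar_on_1_edge_iff: "E x y \<Longrightarrow> polar_on E 1 (enat i) {x, y} \<longleftrightarrow> 1 \<le> i"
  using polar_on_1_edge[of i "{x, y}" x y] polar_on_cluster cluster_on_edge_iff by blast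

lemma cluster_on_matching_iff: "induced_matching E n W \<Longrightarrow> cluster_on E (enat i) W \<longleftrightarrow> n \<le> i"
proof (induction arbitrary: i rule: induced_matching_induct)
  case empty
  show ?case by (simp add: cluster_on_empty)
next
  case (edge n x y W)
  have "cluster_on E (enat i) ({x, y} \<union> W) \<longleftrightarrow> 1 \<le> i \<and> n \<le> i - 1"
    using cluster_on_Un_iff[OF _ induced_matching_finite[OF edge.hyps(1)] edge.hyps(2)
        cluster_on_edge_iff[OF edge.hyps(3)], of i] edge.IH[of "i - 1"] by simp
  then show ?case by linarith
qed

lemma polar_on_1_matching_iff: "induced_matching E n W \<Longrightarrow> polar_on E 1 (enat i) W \<longleftrightarrow> n \<le> i"
proof (induction arbitrary: i rule: induced_matching_induct)
  case empty
  show ?case using polar_on_1_enat_mono polar_on_1_0_iff indep_set_empty by blast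
next
  case (edge n x y W)
  have "polar_on E 1 (enat i) ({x, y} \<union> W) \<longleftrightarrow> 1 \<le> i \<and> n \<le> i - 1"
    using polar_on_1_Un_iff[OF _ induced_matching_finite[OF edge.hyps(1)] edge.hyps(2)
        polar_on_1_edge_iff[OF edge.hyps(3)], of i] edge.IH[of "i - 1"] by simp
  then show ?case by linarith
qed

lemma polar_on_1_matching_Un_iff:
  assumes "induced_matching E t W" "anticomplete E W D" "finite D"
  shows "polar_on E 1 (enat (t + n)) (W \<union> D) \<longleftrightarrow> polar_on E 1 (enat n) D"
  using polar_on_1_Un_iff[OF induced_matching_finite[OF assms(1)] assms(3,2)
      polar_on_1_matching_iff[OF assms(1)]] by simp

lemma P4_free_matching: "induced_matching E n W \<Longrightarrow> P4_free E W"
  unfolding induced_matching_def P4_free_def using adj_sym by metis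

lemma matching_indep_avoiding:
  assumes "induced_matching E n W" "indep_set E A"
  obtains S where "S \<subseteq> W - A" "indep_set E S" "card S = n"
proof -
  have "\<exists>S\<subseteq>W - A. indep_set E S \<and> card S = n"
    using assms(1)
  proof (induction rule: induced_matching_induct)
    case empty
    show ?case using indep_set_empty by simp
  next
    case (edge n x y W)
    then obtain S where S: "S \<subseteq> W - A" "indep_set E S" "card S = n" by blast
    obtain z where z: "z \<in> {x, y}" "z \<notin> A" using assms(2) edge.hyps(3) unfolding indep_set_def by blast
    have zS: "\<not> E z s \<and> z \<noteq> s" if "s \<in> S" for s
      using anticompleteD[OF edge.hyps(2) z(1), of s] S(1) that by blast
    then have "indep_set E (insert z S)" using indep_set_insert[OF S(2)] by blast
    moreover have "z \<notin> S" using zS by blast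
    moreover have "finite S"
      using S(1) induced_matching_finite[OF edge.hyps(1)] by (auto intro: finite_subset)
    ultimately show ?case using S z by (intro exI[of _ "insert z S"]) auto
  qed
  then show ?thesis using that by blast
qed

lemma matching_indep:
  assumes "induced_matching E n W"
  obtains S where "S \<subseteq> W" "indep_set E S" "card S = n"
  using matching_indep_avoiding[OF assms indep_set_empty] by auto

lemma cluster_contains_matching:
  assumes "finite V" "P3_free E V" "\<not> polar_on E 1 (enat i) V"
  obtains W where "W \<subseteq> V" "induced_matching E (Suc i) W"
proof -
  have "\<exists>W\<subseteq>V. induced_matching E (Suc i) W"
    using assms
  proof (induction i arbitrary: V)
    case 0
    then obtain x y where "x \<in> V" "y \<in> V" "E x y" unfolding polar_on_1_0_iff indep_set_def by blast
    then show ?case using induced_matching_1 by (intro exI[of _ "{x, y}"]) auto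
  next
    case (Suc i)
    have "\<not> indep_set E V" using Suc.prems(3) polar_on_1_0_iff polar_on_1_enat_mono by blast
    then obtain x y where xy: "x \<in> V" "y \<in> V" "E x y" unfolding indep_set_def by blast
    obtain K where K: "x \<in> K" "K \<subseteq> V" "clique_set E K" "anticomplete E K (V - K)"
      using P3_free_component[OF Suc.prems(2) xy(1)] .
    have y: "y \<in> K" using K xy anticompleteD[OF K(4), of x y] by blast
    have "polar_on E 1 (enat 1) K" using K(3) cluster_on_1_iff by (blast intro: polar_on_cluster)
    then have "\<not> polar_on E 1 (enat i) (V - K)"
      using polar_on_1_Un[OF K(4), of 1 i] K(2) Suc.prems(3) by (auto simp: Un_absorb1)
    then have "\<exists>W\<subseteq>V - K. induced_matching E (Suc i) W"
      by (rule Suc.IH[OF finite_Diff[OF Suc.prems(1)] P3_free_subset[OF Suc.prems(2) Diff_subset]])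
    then obtain W where W: "W \<subseteq> V - K" "induced_matching E (Suc i) W" by blast
    have "anticomplete E {x, y} W" using K(1) y W(1) by (intro anticomplete_subset[OF K(4)]) auto
    then have "induced_matching E (Suc (Suc i)) ({x, y} \<union> W)"
      using induced_matching_insert_edge W(2) xy(3) by blast
    then show ?case using W(1) xy by (intro exI[of _ "{x, y} \<union> W"]) auto
  qed
  then show ?thesis using that by blast
qed

lemma cluster_on_matching_adj:
  assumes "cluster_on E (enat k) V" "induced_matching E k W" "W \<subseteq> V" "v \<in> V"
  shows "\<exists>w\<in>W. E v w"
proof (rule ccontr)
  assume none: "\<not> (\<exists>w\<in>W. E v w)"
  obtain S where S: "S \<subseteq> W" "indep_set E S" "card S = k" using matching_indep[OF assms(2)] .
  have "v \<notin> W" using none assms(2) unfolding induced_matching_def by blast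
  then have "card (insert v S) = Suc k"
    using S finite_subset[OF S(1) induced_matching_finite[OF assms(2)]]
    by (metis card_insert_disjoint subsetD)
  moreover have "card (insert v S) \<le> k"
    using S none assms(3,4) by (intro cluster_on_card_le[OF assms(1)] indep_set_insert) auto
  ultimately show False by simp
qed

end

section \<open>Joins, connectivity and the decomposition of cographs\<close>

definition connected_on :: "('a \<Rightarrow> 'a \<Rightarrow> bool) \<Rightarrow> 'a set \<Rightarrow> bool" where
  "connected_on E V \<longleftrightarrow> V \<noteq> {} \<and> (\<forall>X Y. X \<union> Y = V \<longrightarrow> anticomplete E X Y \<longrightarrow> X = {} \<or> Y = {})"

definition decomposable :: "('a \<Rightarrow> 'a \<Rightarrow> bool) \<Rightarrow> 'a set \<Rightarrow> bool" where
  "decomposable E V \<longleftrightarrow>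
    (\<exists>X Y. X \<union> Y = V \<and> X \<noteq> {} \<and> Y \<noteq> {} \<and> (anticomplete E X Y \<or> complete_to E X Y))"

lemma decomposableI:
  "X \<union> Y = V \<Longrightarrow> X \<noteq> {} \<Longrightarrow> Y \<noteq> {} \<Longrightarrow> anticomplete E X Y \<or> complete_to E X Y \<Longrightarrow> decomposable E V"
  unfolding decomposable_def by blast

context simple_graph begin

lemma complete_to_complement: "complete_to (complement E) X Y \<longleftrightarrow> anticomplete E X Y"
  using anticomplete_complement[of "complement E"] by (simp add: complement_complement)

lemma decomposable_complement: "decomposable (complement E) V \<longleftrightarrow> decomposable E V"
  unfolding decomposable_def complete_to_complement anticomplete_complement by blast

lemma P4_free_complement:
  assumes "P4_free E V" shows "P4_free (complement E) V"
  unfolding P4_free_def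
proof (intro ballI notI)
  fix a b c d assume V: "a \<in> V" "b \<in> V" "c \<in> V" "d \<in> V"
    and "complement E a b \<and> complement E b c \<and> complement E c d \<and>
      \<not> complement E a c \<and> \<not> complement E a d \<and> \<not> complement E b d"
  then have "E b d" "E d a" "E a c" "\<not> E b a" "\<not> E b c" "\<not> E d c"
    unfolding complement_def using adj_sym by metis+
  then show False using assms V unfolding P4_free_def by blast
qed

lemma P4_free_join:
  assumes "complete_to E X Y" "P4_free E X" "P4_free E Y"
  shows "P4_free E (X \<union> Y)"
proof -
  interpret co: simple_graph "complement E" by (rule simple_graph_complement)
  have "P4_free (complement E) (X \<union> Y)"
    using assms by (intro co.P4_free_Un P4_free_complement) (simp_all add: anticomplete_complement)
  then show ?thesis using co.P4_free_complement by (simp add: complement_complement)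
qed

lemma anticomplete_insert_mixed_edge:
  assumes "P4_free E (insert v (X \<union> Y))" "v \<notin> X \<union> Y" "anticomplete E X Y"
    and "a \<in> X" "b \<in> X" "E v a" "\<not> E v b" "E a b"
  shows "anticomplete E (insert v X) Y"
proof -
  have "\<not> E v y" if y: "y \<in> Y" for y
  proof
    assume "E v y"
    then have "E y v" "E v a" "E a b" "\<not> E y a" "\<not> E y b" "\<not> E v b"
      using assms(4-8) anticompleteD[OF assms(3) _ y] adj_sym by blast+
    then show False using assms(1,4,5) y unfolding P4_free_def by blast
  qed
  then show ?thesis using assms(2,3) unfolding anticomplete_def by blast
qed

lemma decomposable_insert_anticomplete:
  assumes P4: "P4_free E (insert v V)" and v: "v \<notin> V"
    and XY: "X \<union> Y = V" "X \<noteq> {}" "Y \<noteq> {}" "anticomplete E X Y"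
  shows "decomposable E (insert v V)"
proof -
  consider a b where "a \<in> V" "b \<in> V" "E v a" "\<not> E v b" "E a b"
    | "\<And>a b. a \<in> V \<Longrightarrow> b \<in> V \<Longrightarrow> E v a \<Longrightarrow> \<not> E v b \<Longrightarrow> \<not> E a b" by blast
  then show ?thesis
  proof cases
    case mixed: 1
    have ?thesis if "X' \<union> Y' = V" "Y' \<noteq> {}" "anticomplete E X' Y'" "a \<in> X'" "b \<in> X'" for X' Y'
    proof (rule decomposableI)
      show "anticomplete E (insert v X') Y' \<or> complete_to E (insert v X') Y'"
        using anticomplete_insert_mixed_edge that mixed P4 v by blast
    qed (use that in auto)
    moreover have "a \<in> X \<and> b \<in> X \<or> a \<in> Y \<and> b \<in> Y"
      using mixed(1,2,5) XY(1) anticompleteD[OF XY(4)] by blast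
    ultimately show ?thesis using XY anticomplete_sym[OF XY(4)] by blast
  next
    case 2
    define U where "U = {x \<in> V. \<not> E v x}"
    show ?thesis
    proof (cases "U = {}")
      case True
      then have "complete_to E {v} V" using v unfolding complete_to_def U_def by blast
      then show ?thesis using XY by (intro decomposableI[of "{v}" V]) auto
    next
      case False
      have "anticomplete E (insert v (V - U)) U" using v 2 unfolding anticomplete_def U_def by blast
      then show ?thesis
        using False by (intro decomposableI[of "insert v (V - U)" U]) (auto simp: U_def)
    qed
  qed
qed

theorem P4_free_decomposable:
  assumes "finite V" "P4_free E V" "x \<in> V" "y \<in> V" "x \<noteq> y"
  shows "decomposable E V"
  using assms
proof (induction V arbitrary: x y rule: finite_induct)
  case empty
  then show ?case by simp
next
  case (insert v V)
  show ?case
  proof (cases "\<exists>x\<in>V. \<exists>y\<in>V. x \<noteq> y")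
    case True
    then have "decomposable E V"
      using insert.IH P4_free_subset[OF insert.prems(1)] by (metis subset_insertI)
    then obtain X Y where XY: "X \<union> Y = V" "X \<noteq> {}" "Y \<noteq> {}" "anticomplete E X Y \<or> complete_to E X Y"
      unfolding decomposable_def by blast
    from XY(4) show ?thesis
    proof
      assume "anticomplete E X Y"
      then show ?thesis
        using decomposable_insert_anticomplete[OF insert.prems(1) insert.hyps(2) XY(1-3)] by blast
    next
      assume "complete_to E X Y"
      interpret co: simple_graph "complement E" by (rule simple_graph_complement)
      have "decomposable (complement E) (insert v V)"
        using co.decomposable_insert_anticomplete[OF P4_free_complement[OF insert.prems(1)]
            insert.hyps(2) XY(1-3)] \<open>complete_to E X Y\<close> by (simp add: anticomplete_complement)
      then show ?thesis by (simp add: decomposable_complement)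
    qed
  next
    case False
    then obtain w where w: "V = {w}" using insert.prems by blast
    then have "anticomplete E {v} {w} \<or> complete_to E {v} {w}"
      using insert.hyps unfolding anticomplete_def complete_to_def by blast
    then show ?thesis using w by (intro decomposableI[of "{v}" V]) auto
  qed
qed

lemma connected_P4_free_join:
  assumes "finite V" "P4_free E V" "connected_on E V" "\<not> clique_set E V"
  obtains X Y where "X \<union> Y = V" "X \<noteq> {}" "Y \<noteq> {}" "complete_to E X Y"
proof -
  obtain x y where "x \<in> V" "y \<in> V" "x \<noteq> y" using assms(4) unfolding clique_set_def by blast
  then have "decomposable E V" using P4_free_decomposable assms(1,2) by blast
  then show ?thesis using that assms(3) unfolding decomposable_def connected_on_def by metis
qed

lemma connected_P3_free_clique:
  assumes "connected_on E V" "P3_free E V"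
  shows "clique_set E V"
proof -
  obtain x where "x \<in> V" using assms(1) unfolding connected_on_def by blast
  then obtain K where K: "x \<in> K" "K \<subseteq> V" "clique_set E K" "anticomplete E K (V - K)"
    using P3_free_component[OF assms(2)] by blast
  moreover have "K \<union> (V - K) = V" using K(2) by blast
  ultimately have "V - K = {}" using assms(1) unfolding connected_on_def by blast
  then show ?thesis using clique_set_subset[OF K(3)] by blast
qed

lemma connected_component_containing:
  assumes "finite V" "a \<in> V"
  obtains D where "a \<in> D" "D \<subseteq> V" "connected_on E D" "anticomplete E D (V - D)"
proof -
  define F where "F = {D. D \<subseteq> V \<and> a \<in> D \<and> anticomplete E D (V - D)}"
  have "finite F" "V \<in> F" using assms unfolding F_def anticomplete_def by auto
  then obtain D where D: "D \<in> F" and min: "\<And>D'. D' \<in> F \<Longrightarrow> D' \<subseteq> D \<Longrightarrow> D' = D"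
    using finite_has_minimal2[of F V] by metis
  have other_empty: "Y = {}" if XY: "X \<union> Y = D" "anticomplete E X Y" "a \<in> X" for X Y
  proof -
    have "V - X = Y \<union> (V - D)" using D XY(1,2) unfolding F_def anticomplete_def by blast
    then have "anticomplete E X (V - X)" using D XY(1,2) unfolding F_def anticomplete_def by blast
    then have "X \<in> F" using D XY(1,3) unfolding F_def by blast
    then show "Y = {}" using min[of X] XY(1,2) unfolding anticomplete_def by blast
  qed
  have "connected_on E D"
    unfolding connected_on_def
  proof (intro conjI allI impI)
    show "D \<noteq> {}" using D unfolding F_def by blast
    fix X Y assume XY: "X \<union> Y = D" "anticomplete E X Y"
    then have "a \<in> X \<or> a \<in> Y" using D unfolding F_def by blast
    then show "X = {} \<or> Y = {}"
      using other_empty[of X Y] other_empty[of Y X] XY anticomplete_sym[OF XY(2)] by blast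
  qed
  then show ?thesis using that D unfolding F_def by blast
qed

lemma complete_multipartite_side:
  assumes "anticomplete E X Y" "complete_multipartite E A" "A \<subseteq> X \<union> Y" "\<not> indep_set E A"
  shows "A \<subseteq> X \<or> A \<subseteq> Y"
proof -
  obtain a b where ab: "a \<in> A" "b \<in> A" "E a b" using assms(4) unfolding indep_set_def by blast
  have no_edge: "\<not> E x y" "\<not> E y x" if "x \<in> X" "y \<in> Y" for x y
    using anticompleteD[OF assms(1) that] by blast+
  have same: "x \<in> X \<longleftrightarrow> y \<in> X" if "E x y" "x \<in> A" "y \<in> A" for x y
    using no_edge that assms(1,3) unfolding anticomplete_def by blast
  have "z \<in> X \<longleftrightarrow> a \<in> X" if z: "z \<in> A" for z
  proof -
    have "E a z \<or> E b z" using complete_multipartite_adj_edge[OF assms(2) ab z] .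
    then show ?thesis using same[of a z] same[of b z] same[of a b] ab z by blast
  qed
  then show ?thesis using assms(3) by blast
qed

lemma polar_on_infty_Un_iff:
  assumes "anticomplete E X Y" "complete_multipartite E X"
  shows "polar_on E \<infinity> k (X \<union> Y) \<longleftrightarrow> polar_on E 1 k (X \<union> Y) \<or> cluster_on E k Y
    \<or> (\<exists>A\<subseteq>Y. complete_multipartite E A \<and> cluster_on E k (X \<union> (Y - A)))"
  (is "_ \<longleftrightarrow> ?alternatives")
proof
  have disj: "X \<inter> Y = {}" using assms(1) unfolding anticomplete_def by blast
  assume "polar_on E \<infinity> k (X \<union> Y)"
  then obtain A where A: "A \<subseteq> X \<union> Y" "complete_multipartite E A" "cluster_on E k (X \<union> Y - A)"
    unfolding polar_on_infty_iff by blast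
  consider "indep_set E A" | "A \<subseteq> X" | "A \<subseteq> Y"
    using complete_multipartite_side[OF assms(1) A(2,1)] by blast
  then show ?alternatives
  proof cases
    case 1
    then show ?thesis using A unfolding polar_on_1_iff by blast
  next
    case 2
    then have "Y \<subseteq> X \<union> Y - A" using disj by blast
    then show ?thesis using cluster_on_mono[OF A(3) _ order_refl] by blast
  next
    case 3
    then have "X \<union> Y - A = X \<union> (Y - A)" using disj by blast
    then show ?thesis using A(2,3) 3 by metis
  qed
next
  assume ?alternatives
  then consider "polar_on E 1 k (X \<union> Y)" | "cluster_on E k Y"
    | A where "A \<subseteq> Y" "complete_multipartite E A" "cluster_on E k (X \<union> (Y - A))" by blast
  then show "polar_on E \<infinity> k (X \<union> Y)"
  proof cases
    case 1
    then show ?thesis by (rule polar_on_1_imp_infty)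
  next
    case 2
    then show ?thesis by (rule polar_on_inftyI[OF assms(2)]) simp
  next
    case 3
    then show ?thesis by (intro polar_on_inftyI[of E A k "X \<union> (Y - A)"]) auto
  qed
qed

lemma indep_set_join_side:
  "complete_to E X Y \<Longrightarrow> indep_set E A \<Longrightarrow> A \<subseteq> X \<union> Y \<Longrightarrow> A \<subseteq> X \<or> A \<subseteq> Y"
  unfolding complete_to_def indep_set_def by blast

lemma clique_set_join_iff:
  assumes "complete_to E X Y"
  shows "clique_set E (X \<union> Y) \<longleftrightarrow> clique_set E X \<and> clique_set E Y"
  using assms complete_to_sym[OF assms] unfolding complete_to_def clique_set_def by blast

lemma P3_free_join_clique:
  assumes "complete_to E X Y" "X \<noteq> {}" "Y \<noteq> {}" "P3_free E (X \<union> Y)"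
  shows "clique_set E (X \<union> Y)"
proof -
  obtain x y where xy: "x \<in> X" "y \<in> Y" using assms(2,3) by blast
  have "clique_set E X"
    unfolding clique_set_def
    using P3_freeD[OF assms(4), of _ y] complete_toD[OF assms(1) _ xy(2)] xy(2) by blast
  moreover have "clique_set E Y"
    unfolding clique_set_def
    using P3_freeD[OF assms(4), of _ x] complete_toD[OF assms(1) xy(1)] xy(1) by blast
  ultimately show ?thesis unfolding clique_set_join_iff[OF assms(1)] by blast
qed

lemma polar_on_1_1_join_iff:
  assumes "complete_to E X Y"
  shows "polar_on E 1 (enat 1) (X \<union> Y) \<longleftrightarrow>
    clique_set E X \<and> polar_on E 1 (enat 1) Y \<or> clique_set E Y \<and> polar_on E 1 (enat 1) X"
proof -
  have lift: "polar_on E 1 (enat 1) (X' \<union> Y')"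
    if join: "complete_to E X' Y'" "clique_set E X'" "polar_on E 1 (enat 1) Y'" for X' Y'
  proof -
    obtain A where A: "indep_set E A" "clique_set E (Y' - A)"
      using join(3) unfolding polar_on_1_iff cluster_on_1_iff by blast
    have "complete_to E X' (Y' - A)" using complete_to_subset[OF join(1)] by blast
    then have "clique_set E (X' \<union> (Y' - A))" using join(2) A(2) clique_set_join_iff by blast
    then show ?thesis using polar_on_1_1I[OF A(1)] by blast
  qed
  have split: "clique_set E X' \<and> polar_on E 1 (enat 1) Y'"
    if "complete_to E X' Y'" "A \<subseteq> Y'" "indep_set E A" "clique_set E (X' \<union> Y' - A)" for A X' Y'
  proof -
    have "X' \<union> Y' - A = X' \<union> (Y' - A)" using that(1,2) unfolding complete_to_def by blast
    then have "clique_set E X'" "clique_set E (Y' - A)" using clique_set_subset[OF that(4)] by auto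
    then show ?thesis using that(2,3) unfolding polar_on_1_iff cluster_on_1_iff by blast
  qed
  show ?thesis
  proof
    assume "polar_on E 1 (enat 1) (X \<union> Y)"
    then obtain A where A: "A \<subseteq> X \<union> Y" "indep_set E A" "clique_set E (X \<union> Y - A)"
      unfolding polar_on_1_iff cluster_on_1_iff by blast
    from indep_set_join_side[OF assms A(2,1)]
    show "clique_set E X \<and> polar_on E 1 (enat 1) Y \<or> clique_set E Y \<and> polar_on E 1 (enat 1) X"
      using split[OF assms _ A(2,3)] split[OF complete_to_sym[OF assms] _ A(2)] A(3)
      by (auto simp: Un_commute)
  next
    show "polar_on E 1 (enat 1) (X \<union> Y)"
      if "clique_set E X \<and> polar_on E 1 (enat 1) Y \<or> clique_set E Y \<and> polar_on E 1 (enat 1) X"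
      using that lift[OF assms] lift[OF complete_to_sym[OF assms]] by (auto simp: Un_commute)
  qed
qed

lemma polar_on_1_join_iff:
  assumes "complete_to E X Y" "X \<noteq> {}" "Y \<noteq> {}" "enat 1 \<le> k"
  shows "polar_on E 1 k (X \<union> Y) \<longleftrightarrow> polar_on E 1 (enat 1) (X \<union> Y)
    \<or> indep_set E X \<and> cluster_on E k Y \<or> indep_set E Y \<and> cluster_on E k X"
proof
  have split: "polar_on E 1 (enat 1) (X' \<union> Y') \<or> indep_set E X' \<and> cluster_on E k Y'"
    if "complete_to E X' Y'" "Y' \<noteq> {}" "A \<subseteq> X'" "indep_set E A"
      "cluster_on E k (X' \<union> Y' - A)" for A X' Y'
  proof (cases "X' = A")
    case True
    then have "X' \<union> Y' - A = Y'" using that(1) unfolding complete_to_def by blast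
    then show ?thesis using that(4,5) True by simp
  next
    case False
    have eq: "X' \<union> Y' - A = (X' - A) \<union> Y'" using that(1,3) unfolding complete_to_def by blast
    have "clique_set E ((X' - A) \<union> Y')"
    proof (rule P3_free_join_clique)
      show "complete_to E (X' - A) Y'" using complete_to_subset[OF that(1)] by blast
      show "P3_free E ((X' - A) \<union> Y')" using cluster_on_P3_free[OF that(5)] eq by simp
    qed (use that(2,3) False in auto)
    then show ?thesis using polar_on_1_1I[OF that(4)] by blast
  qed
  assume "polar_on E 1 k (X \<union> Y)"
  then obtain A where A: "A \<subseteq> X \<union> Y" "indep_set E A" "cluster_on E k (X \<union> Y - A)"
    unfolding polar_on_1_iff by blast
  from indep_set_join_side[OF assms(1) A(2,1)]
  show "polar_on E 1 (enat 1) (X \<union> Y)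
    \<or> indep_set E X \<and> cluster_on E k Y \<or> indep_set E Y \<and> cluster_on E k X"
    using split[OF assms(1,3) _ A(2,3)] split[OF complete_to_sym[OF assms(1)] assms(2) _ A(2)] A(3)
    by (auto simp: Un_commute)
next
  assume "polar_on E 1 (enat 1) (X \<union> Y)
    \<or> indep_set E X \<and> cluster_on E k Y \<or> indep_set E Y \<and> cluster_on E k X"
  moreover have "polar_on E 1 k (X \<union> Y)" if "polar_on E 1 (enat 1) (X \<union> Y)"
    using polar_on_mono[OF that _ _ assms(4)] by simp
  ultimately show "polar_on E 1 k (X \<union> Y)"
    using polar_on_1I[of X k Y "X \<union> Y"] polar_on_1I[of Y k X "X \<union> Y"] by blast
qed

end

section \<open>Split cographs\<close>

definition induced_C4 :: "('a \<Rightarrow> 'a \<Rightarrow> bool) \<Rightarrow> 'a \<Rightarrow> 'a \<Rightarrow> 'a \<Rightarrow> 'a \<Rightarrow> bool" where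
  "induced_C4 E a b c d \<longleftrightarrow> a \<noteq> c \<and> b \<noteq> d \<and> \<not> E a c \<and> \<not> E b d \<and> complete_to E {a, c} {b, d}"

definition induced_2K2 :: "('a \<Rightarrow> 'a \<Rightarrow> bool) \<Rightarrow> 'a \<Rightarrow> 'a \<Rightarrow> 'a \<Rightarrow> 'a \<Rightarrow> bool" where
  "induced_2K2 E a b c d \<longleftrightarrow> E a b \<and> E c d \<and> anticomplete E {a, b} {c, d}"

context simple_graph begin

lemma induced_matching_2K2: "induced_2K2 E a b c d \<Longrightarrow> induced_matching E 2 {a, b, c, d}"
  unfolding induced_2K2_def using induced_matching_2 by blast

lemma polar_on_1_1_anticomplete:
  assumes "anticomplete E X Y" "polar_on E 1 (enat 1) X" "polar_on E 1 (enat 1) Y"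
    and "\<And>a b c d. {a, b, c, d} \<subseteq> X \<union> Y \<Longrightarrow> \<not> induced_2K2 E a b c d"
  shows "polar_on E 1 (enat 1) (X \<union> Y)"
proof -
  have "indep_set E X \<or> indep_set E Y"
  proof (rule ccontr)
    assume "\<not> ?thesis"
    then obtain a b c d where ab: "{a, b} \<subseteq> X" "E a b" and cd: "{c, d} \<subseteq> Y" "E c d"
      unfolding indep_set_def by auto
    have "induced_2K2 E a b c d"
      unfolding induced_2K2_def using ab cd anticomplete_subset[OF assms(1)] by blast
    then show False using assms(4)[of a b c d] ab(1) cd(1) by blast
  qed
  then show ?thesis
    using polar_on_1_Un[OF assms(1), of 0 1] polar_on_1_Un[OF assms(1), of 1 0] assms(2,3)
    by (auto simp: polar_on_1_0_iff)
qed

lemma polar_on_1_1_complete_to: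
  assumes "complete_to E X Y" "polar_on E 1 (enat 1) X" "polar_on E 1 (enat 1) Y"
    and "\<And>a b c d. {a, b, c, d} \<subseteq> X \<union> Y \<Longrightarrow> \<not> induced_C4 E a b c d"
  shows "polar_on E 1 (enat 1) (X \<union> Y)"
proof -
  have "clique_set E X \<or> clique_set E Y"
  proof (rule ccontr)
    assume "\<not> ?thesis"
    then obtain a b c d where ac: "{a, c} \<subseteq> X" "a \<noteq> c" "\<not> E a c" and bd: "{b, d} \<subseteq> Y" "b \<noteq> d" "\<not> E b d"
      unfolding clique_set_def by auto
    have "complete_to E {a, c} {b, d}" using complete_to_subset[OF assms(1) ac(1) bd(1)] .
    then show False using assms(4)[of a b c d] ac bd unfolding induced_C4_def by blast
  qed
  then show ?thesis using polar_on_1_1_join_iff[OF assms(1)] assms(2,3) by blast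
qed

text \<open>The P4-free case of the characterization of split graphs: \<open>C\<^sub>5\<close> need not be excluded.\<close>
lemma P4_free_split:
  assumes "finite V" "P4_free E V"
    and "\<And>a b c d. {a, b, c, d} \<subseteq> V \<Longrightarrow> \<not> induced_C4 E a b c d \<and> \<not> induced_2K2 E a b c d"
  shows "polar_on E 1 (enat 1) V"
  using assms
proof (induction V rule: finite_psubset_induct)
  case (psubset V)
  show ?case
  proof (cases "clique_set E V")
    case True
    then show ?thesis using polar_on_1_1I[OF indep_set_empty] by blast
  next
    case False
    then obtain x y where "x \<in> V" "y \<in> V" "x \<noteq> y" unfolding clique_set_def by blast
    then have "decomposable E V" using P4_free_decomposable psubset.hyps psubset.prems(1) by blast
    then obtain X Y where XY: "X \<union> Y = V" "X \<noteq> {}" "Y \<noteq> {}" "anticomplete E X Y \<or> complete_to E X Y"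
      unfolding decomposable_def by blast
    have "polar_on E 1 (enat 1) U" if U: "U \<subset> V" for U
    proof (rule psubset.IH[OF U])
      show "P4_free E U" using P4_free_subset[OF psubset.prems(1)] U by blast
      show "\<not> induced_C4 E a b c d \<and> \<not> induced_2K2 E a b c d" if "{a, b, c, d} \<subseteq> U" for a b c d
        using psubset.prems(2)[of a b c d] that U by blast
    qed
    moreover have "X \<subset> V" "Y \<subset> V" using XY unfolding anticomplete_def complete_to_def by blast+
    ultimately have "polar_on E 1 (enat 1) X" "polar_on E 1 (enat 1) Y" by blast+
    then show ?thesis
      using polar_on_1_1_anticomplete[of X Y] polar_on_1_1_complete_to[of X Y] psubset.prems(2) XY(1,4)
      by blast
  qed
qed

lemma not_polar_on_1_1_C4: "induced_C4 E a b c d \<Longrightarrow> \<not> polar_on E 1 (enat 1) {a, b, c, d}"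
  using polar_on_1_1_join_iff[of "{a, c}" "{b, d}"] unfolding induced_C4_def clique_set_def
  by (auto simp: insert_commute)

lemma monopolar_C4:
  assumes "induced_C4 E a b c d" shows "polar_on E 1 \<infinity> {a, b, c, d}"
proof (rule polar_on_1I)
  show "indep_set E {a, c}" using assms unfolding induced_C4_def indep_set_doubleton_iff by blast
  have "indep_set E {b, d}" using assms unfolding induced_C4_def indep_set_doubleton_iff by blast
  then show "cluster_on E \<infinity> {b, d}" unfolding cluster_on_infty by (rule P3_free_indep)
qed auto

end

section \<open>Removing the component \<open>P\<^sub>3\<close>\<close>

definition min_polar_obstruction_on :: "('a \<Rightarrow> 'a \<Rightarrow> bool) \<Rightarrow> enat \<Rightarrow> enat \<Rightarrow> 'a set \<Rightarrow> bool" where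
  "min_polar_obstruction_on E s k V \<longleftrightarrow> \<not> polar_on E s k V \<and> (\<forall>W\<subset>V. polar_on E s k W)"

lemma min_polar_obstruction_on_iff:
  "min_polar_obstruction_on E s k V \<longleftrightarrow> \<not> polar_on E s k V \<and> (\<forall>v\<in>V. polar_on E s k (V - {v}))"
proof -
  have "polar_on E s k W" if del: "\<forall>v\<in>V. polar_on E s k (V - {v})" and W: "W \<subset> V" for W
  proof -
    obtain v where v: "v \<in> V" "W \<subseteq> V - {v}" using W by blast
    then show ?thesis using polar_on_mono[OF _ v(2) order_refl order_refl] del by blast
  qed
  moreover have "V - {v} \<subset> V" if "v \<in> V" for v using that by blast
  ultimately show ?thesis unfolding min_polar_obstruction_on_def by blast
qed

lemma min_polar_obstruction_on_eq:
  "min_polar_obstruction_on E s k V \<Longrightarrow> S \<subseteq> V \<Longrightarrow> \<not> polar_on E s k S \<Longrightarrow> S = V"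
  unfolding min_polar_obstruction_on_def by blast

text \<open>What remains of the minimality of \<open>P\<^sub>3 + H\<close>: the first two conditions say that it is not polar,
  and the others come from deleting a vertex of \<open>H\<close>, an end of \<open>P\<^sub>3\<close>, and the middle of \<open>P\<^sub>3\<close>.\<close>
definition P3_residual :: "('a \<Rightarrow> 'a \<Rightarrow> bool) \<Rightarrow> nat \<Rightarrow> 'a set \<Rightarrow> bool" where
  "P3_residual E k H \<longleftrightarrow>
    \<not> polar_on E 1 (enat (k - 1)) H \<and> \<not> cluster_on E (enat k) H
    \<and> (\<forall>v\<in>H. polar_on E 1 (enat (k - 1)) (H - {v}) \<or> cluster_on E (enat k) (H - {v}))
    \<and> polar_on E \<infinity> (enat (k - 1)) H
    \<and> (polar_on E 1 (enat k) H \<or> polar_on E \<infinity> (enat (k - 2)) H)"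

context simple_graph begin

lemma complete_multipartite_P3: "induced_P3 E a b c \<Longrightarrow> complete_multipartite E {a, b, c}"
  unfolding complete_multipartite_iff induced_P3_def using adj_sym adj_irrefl by auto

lemma not_cluster_on_P3: "induced_P3 E a b c \<Longrightarrow> {a, b, c} \<subseteq> V \<Longrightarrow> \<not> cluster_on E k V"
  unfolding cluster_on_def P3_free_def by blast

lemma polar_on_1_P3_iff:
  assumes "induced_P3 E a b c"
  shows "polar_on E 1 (enat i) {a, b, c} \<longleftrightarrow> 1 \<le> i"
proof
  show "1 \<le> i" if "polar_on E 1 (enat i) {a, b, c}"
    using polar_on_1_edge[OF that, of a b] assms unfolding induced_P3_def by blast
  have "indep_set E {a, c}" using assms unfolding induced_P3_def indep_set_doubleton_iff by blast
  then have "polar_on E 1 (enat 1) {a, b, c}"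
    using clique_set_singleton[of b] by (rule polar_on_1_1I) blast
  then show "polar_on E 1 (enat i) {a, b, c}" if "1 \<le> i" using polar_on_1_enat_mono that by blast
qed

lemma polar_on_infty_cluster_Un_iff:
  assumes "finite X" "finite Y" "anticomplete E X Y" "complete_multipartite E X"
    and "\<And>i. cluster_on E (enat i) X \<longleftrightarrow> c \<le> i"
  shows "polar_on E \<infinity> (enat n) (X \<union> Y) \<longleftrightarrow>
    polar_on E 1 (enat n) (X \<union> Y) \<or> cluster_on E (enat n) Y \<or> c \<le> n \<and> polar_on E \<infinity> (enat (n - c)) Y"
proof -
  have "cluster_on E (enat n) (X \<union> (Y - A)) \<longleftrightarrow> c \<le> n \<and> cluster_on E (enat (n - c)) (Y - A)" for A
    using assms(1,2) anticomplete_subset[OF assms(3)] by (intro cluster_on_Un_iff assms(5)) auto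
  then show ?thesis unfolding polar_on_infty_Un_iff[OF assms(3,4)] polar_on_infty_iff[of E _ Y] by blast
qed

lemma polar_on_infty_P3_Un_iff:
  assumes "induced_P3 E a b c" "finite H" "anticomplete E {a, b, c} H" "1 \<le> k"
  shows "polar_on E \<infinity> (enat k) ({a, b, c} \<union> H) \<longleftrightarrow>
    polar_on E 1 (enat (k - 1)) H \<or> cluster_on E (enat k) H"
  using polar_on_infty_Un_iff[OF assms(3) complete_multipartite_P3[OF assms(1)], of "enat k"]
    polar_on_1_Un_iff[OF _ assms(2,3) polar_on_1_P3_iff[OF assms(1)], of k]
    not_cluster_on_P3[OF assms(1)] assms(4) by auto

lemma polar_on_infty_edge_Un_iff:
  assumes "E x y" "finite H" "anticomplete E {x, y} H" "1 \<le> k"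
  shows "polar_on E \<infinity> (enat k) ({x, y} \<union> H) \<longleftrightarrow>
    cluster_on E (enat k) H \<or> polar_on E \<infinity> (enat (k - 1)) H"
proof -
  have "polar_on E \<infinity> (enat k) ({x, y} \<union> H) \<longleftrightarrow> polar_on E 1 (enat k) ({x, y} \<union> H) \<or>
      cluster_on E (enat k) H \<or> 1 \<le> k \<and> polar_on E \<infinity> (enat (k - 1)) H"
    using polar_on_infty_cluster_Un_iff[OF _ assms(2,3) complete_multipartite_clique[OF clique_set_edge]
        cluster_on_edge_iff] assms(1) by simp
  moreover have "polar_on E 1 (enat k) ({x, y} \<union> H) \<longleftrightarrow> polar_on E 1 (enat (k - 1)) H"
    using polar_on_1_Un_iff[OF _ assms(2,3) polar_on_1_edge_iff[OF assms(1)], of k] assms(4) by simp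
  ultimately show ?thesis using assms(4) polar_on_1_imp_infty by blast
qed

lemma polar_on_infty_nonedge_Un_iff:
  assumes "\<not> E x y" "x \<noteq> y" "finite H" "anticomplete E {x, y} H" "2 \<le> k"
  shows "polar_on E \<infinity> (enat k) ({x, y} \<union> H) \<longleftrightarrow>
    polar_on E 1 (enat k) H \<or> polar_on E \<infinity> (enat (k - 2)) H"
proof -
  have ind: "indep_set E {x, y}" using assms(1) indep_set_doubleton_iff by blast
  have "polar_on E \<infinity> (enat k) ({x, y} \<union> H) \<longleftrightarrow> polar_on E 1 (enat k) ({x, y} \<union> H) \<or>
      cluster_on E (enat k) H \<or> 2 \<le> k \<and> polar_on E \<infinity> (enat (k - 2)) H"
    using polar_on_infty_cluster_Un_iff[OF _ assms(3,4) complete_multipartite_indep[OF ind]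
        cluster_on_indep_iff[OF _ ind]] assms(2) by (simp add: numeral_2_eq_2)
  moreover have "polar_on E 1 (enat i) {x, y}" for i
    using polar_on_1_0_iff[THEN iffD2, OF ind] by (rule polar_on_1_enat_mono) simp
  then have "polar_on E 1 (enat k) ({x, y} \<union> H) \<longleftrightarrow> polar_on E 1 (enat k) H"
    using polar_on_1_Un_iff[OF _ assms(3,4), of 0 k] by simp
  ultimately show ?thesis using assms(5) polar_on_cluster[of E "enat k" H 1] by blast
qed

theorem min_polar_obstruction_on_P3_Un_iff:
  assumes k: "2 \<le> k" and P3: "induced_P3 E a b c"
    and fin: "finite H" and anti: "anticomplete E {a, b, c} H"
  shows "min_polar_obstruction_on E \<infinity> (enat k) ({a, b, c} \<union> H) \<longleftrightarrow> P3_residual E k H"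
proof -
  have P: "E a b" "E b c" "\<not> E a c" "a \<noteq> c" "a \<noteq> b" "b \<noteq> c"
    using P3 adj_irrefl unfolding induced_P3_def by blast+
  have disj: "a \<notin> H" "b \<notin> H" "c \<notin> H" using anti unfolding anticomplete_def by blast+
  have sub: "anticomplete E {x, y} H" if "{x, y} \<subseteq> {a, b, c}" for x y
    using anticomplete_subset[OF anti that subset_refl] .
  have "{a, b, c} \<union> H - {a} = {b, c} \<union> H" "{a, b, c} \<union> H - {b} = {a, c} \<union> H"
    "{a, b, c} \<union> H - {c} = {a, b} \<union> H"
    using P(4-6) disj by auto
  then have "(\<forall>v\<in>{a, b, c} \<union> H. polar_on E \<infinity> (enat k) ({a, b, c} \<union> H - {v})) \<longleftrightarrow>
      (\<forall>v\<in>H. polar_on E \<infinity> (enat k) ({a, b, c} \<union> H - {v})) \<and> polar_on E \<infinity> (enat k) ({b, c} \<union> H)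
      \<and> polar_on E \<infinity> (enat k) ({a, c} \<union> H) \<and> polar_on E \<infinity> (enat k) ({a, b} \<union> H)"
    by (auto simp: ball_Un)
  moreover have "polar_on E \<infinity> (enat k) ({a, b, c} \<union> H - {v}) \<longleftrightarrow>
      polar_on E 1 (enat (k - 1)) (H - {v}) \<or> cluster_on E (enat k) (H - {v})" if "v \<in> H" for v
  proof -
    have "{a, b, c} \<union> H - {v} = {a, b, c} \<union> (H - {v})" using that disj by blast
    then show ?thesis
      using polar_on_infty_P3_Un_iff[OF P3 finite_Diff[OF fin]
          anticomplete_subset[OF anti subset_refl Diff_subset]]
        k by simp
  qed
  moreover have "polar_on E \<infinity> (enat k) ({a, b, c} \<union> H) \<longleftrightarrow>
      polar_on E 1 (enat (k - 1)) H \<or> cluster_on E (enat k) H"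
    using polar_on_infty_P3_Un_iff[OF P3 fin anti] k by simp
  moreover have "polar_on E \<infinity> (enat k) ({b, c} \<union> H) \<longleftrightarrow>
      cluster_on E (enat k) H \<or> polar_on E \<infinity> (enat (k - 1)) H"
    "polar_on E \<infinity> (enat k) ({a, b} \<union> H) \<longleftrightarrow>
      cluster_on E (enat k) H \<or> polar_on E \<infinity> (enat (k - 1)) H"
    using polar_on_infty_edge_Un_iff[OF P(1) fin sub] polar_on_infty_edge_Un_iff[OF P(2) fin sub] k
    by auto
  moreover have "polar_on E \<infinity> (enat k) ({a, c} \<union> H) \<longleftrightarrow>
      polar_on E 1 (enat k) H \<or> polar_on E \<infinity> (enat (k - 2)) H"
    using polar_on_infty_nonedge_Un_iff[OF P(3,4) fin sub k] by simp
  ultimately show ?thesis unfolding min_polar_obstruction_on_iff P3_residual_def by auto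
qed

lemma P3_residual_eq:
  assumes "P3_residual E k H" "S \<subseteq> H" "\<not> polar_on E 1 (enat (k - 1)) S" "\<not> cluster_on E (enat k) S"
  shows "S = H"
proof (rule ccontr)
  assume "S \<noteq> H"
  then obtain v where v: "v \<in> H" "S \<subseteq> H - {v}" using assms(2) by blast
  then consider "polar_on E 1 (enat (k - 1)) (H - {v})" | "cluster_on E (enat k) (H - {v})"
    using assms(1) unfolding P3_residual_def by blast
  then show False
    using polar_on_mono[OF _ v(2) order_refl order_refl] cluster_on_mono[OF _ v(2) order_refl]
      assms(3,4)
    by cases blast+
qed

end

section \<open>Necessity of the four alternatives\<close>

definition plus_matching :: "('a \<Rightarrow> 'a \<Rightarrow> bool) \<Rightarrow> nat \<Rightarrow> 'a set \<Rightarrow> 'a set \<Rightarrow> bool" where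
  "plus_matching E n D H \<longleftrightarrow> (\<exists>W. anticomplete E W D \<and> induced_matching E n W \<and> H = W \<union> D)"

definition induces_P3 :: "('a \<Rightarrow> 'a \<Rightarrow> bool) \<Rightarrow> 'a set \<Rightarrow> bool" where
  "induces_P3 E D \<longleftrightarrow> (\<exists>a b c. D = {a, b, c} \<and> induced_P3 E a b c)"

text \<open>The graph \<open>K\<^sub>1 \<oplus> 2K\<^sub>2\<close>.\<close>
definition induces_butterfly :: "('a \<Rightarrow> 'a \<Rightarrow> bool) \<Rightarrow> 'a set \<Rightarrow> bool" where
  "induces_butterfly E D \<longleftrightarrow> (\<exists>v M. D = insert v M \<and> complete_to E {v} M \<and> induced_matching E 2 M)"

context simple_graph begin

lemma polar_on_1_plus_matching_iff:
  assumes "plus_matching E t D H" "finite D"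
  shows "polar_on E 1 (enat (t + n)) H \<longleftrightarrow> polar_on E 1 (enat n) D"
  using assms(1) polar_on_1_matching_Un_iff[OF _ _ assms(2)] unfolding plus_matching_def by auto

lemma hub_in_indep_set:
  assumes "complete_to E {v} M" "induced_matching E 2 M" "insert v M \<subseteq> V"
    and "indep_set E A" "P3_free E (V - A)"
  shows "v \<in> A"
proof (rule ccontr)
  assume v: "v \<notin> A"
  obtain S where S: "S \<subseteq> M - A" "indep_set E S" "card S = 2"
    using matching_indep_avoiding[OF assms(2,4)] .
  then obtain x y where xy: "S = {x, y}" "x \<noteq> y" by (auto simp: card_2_iff)
  have "E x v" "E v y" using S(1) xy(1) complete_toD[OF assms(1)] by auto
  moreover have "x \<in> V - A" "v \<in> V - A" "y \<in> V - A" using S(1) xy(1) v assms(3) by auto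
  ultimately have "E x y" using P3_freeD[OF assms(5)] xy(2) by blast
  then show False using S(2) unfolding xy(1) indep_set_doubleton_iff by blast
qed

lemma not_cluster_on_butterfly:
  assumes "induces_butterfly E D" "D \<subseteq> V"
  shows "\<not> cluster_on E k V"
proof -
  obtain v M where vM: "D = insert v M" "complete_to E {v} M" "induced_matching E 2 M"
    using assms(1) unfolding induces_butterfly_def by blast
  have "v \<in> {}" if "P3_free E V"
    using hub_in_indep_set[OF vM(2,3) _ indep_set_empty, of V] that assms(2) vM(1) by simp
  then show ?thesis using cluster_on_P3_free by blast
qed

lemma polar_on_1_butterfly_iff:
  assumes "induces_butterfly E D"
  shows "polar_on E 1 (enat i) D \<longleftrightarrow> 2 \<le> i"
proof -
  obtain v M where vM: "D = insert v M" "complete_to E {v} M" "induced_matching E 2 M"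
    using assms unfolding induces_butterfly_def by blast
  have "2 \<le> i" if polar: "polar_on E 1 (enat i) D"
  proof -
    obtain A where A: "A \<subseteq> D" "indep_set E A" "cluster_on E (enat i) (D - A)"
      using polar unfolding polar_on_1_iff by blast
    have "v \<in> A" using hub_in_indep_set[OF vM(2,3) _ A(2)] cluster_on_P3_free[OF A(3)] vM(1) by blast
    then have "M \<subseteq> D - A" using A(2) vM(1,2) unfolding complete_to_def indep_set_def by blast
    then show ?thesis using cluster_on_mono[OF A(3)] cluster_on_matching_iff[OF vM(3)] by blast
  qed
  moreover have "polar_on E 1 (enat i) D" if "2 \<le> i"
    using polar_on_1I[OF indep_set_singleton[of v], of "enat i" M D] cluster_on_matching_iff[OF vM(3)]
      that vM(1)
    by simp
  ultimately show ?thesis by blast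
qed

lemma P3_residual_pendant_edge:
  assumes "P4_free E H" "P3_residual E k H" "v \<in> H" "cluster_on E (enat k) (H - {v})"
    and W: "W \<subseteq> H - {v}" "induced_matching E k W"
    and P3: "induced_P3 E v q q'" "q \<in> H" "q' \<in> H"
  shows "\<exists>D. induces_P3 E D \<and> plus_matching E (k - 1) D H"
proof -
  have vq: "E v q" "E q q'" "\<not> E v q'" "v \<noteq> q'" "q \<noteq> v"
    using P3(1) adj_irrefl unfolding induced_P3_def by blast+
  have q: "q \<in> H - {v}" "q' \<in> H - {v}" using P3(2,3) vq by blast+
  note P3_free_Q = P3_freeD[OF cluster_on_P3_free[OF assms(4)]]
  obtain w where w: "w \<in> W" "E q w" using cluster_on_matching_adj[OF assms(4) W(2,1) q(1)] by blast
  obtain w' where R: "induced_matching E (k - 1) (W - {w, w'})" "anticomplete E {w, w'} (W - {w, w'})"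
    using induced_matching_remove_edge[OF W(2) w(1)] by (metis diff_Suc_1)
  have q_R: "\<not> E q z \<and> \<not> E q' z \<and> q \<noteq> z \<and> q' \<noteq> z" if z: "z \<in> W - {w, w'}" for z
  proof -
    have zw: "\<not> E w z" "\<not> E z w" "w \<noteq> z" using anticompleteD[OF R(2) _ z] by blast+
    have "\<not> E q z" using P3_free_Q[of w q z] zw(1,3) z w q(1) W(1) adj_sym by blast
    moreover have "q \<noteq> z" using zw(2) w(2) by blast
    moreover have "\<not> E q' z" using P3_free_Q[of q q' z] calculation z vq(2) q W(1) by blast
    ultimately show ?thesis using vq(2) by blast
  qed
  have "\<not> E v z" if z: "z \<in> W - {w, w'}" for z
  proof
    assume "E v z"
    then have "E q' q" "E q v" "E v z" "\<not> E q' v" "\<not> E q' z" "\<not> E q z"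
      using vq q_R[OF z] adj_sym by blast+
    then show False using assms(1,3) q z W(1) unfolding P4_free_def by blast
  qed
  then have "anticomplete E (W - {w, w'}) {v, q, q'}"
    using q_R W(1) by (intro anticomplete_sym[of "{v, q, q'}"]) (auto simp: anticomplete_def)
  then have plus: "plus_matching E (k - 1) {v, q, q'} ((W - {w, w'}) \<union> {v, q, q'})"
    using R(1) unfolding plus_matching_def by blast
  have "(W - {w, w'}) \<union> {v, q, q'} = H"
  proof (rule P3_residual_eq[OF assms(2)])
    show "\<not> polar_on E 1 (enat (k - 1)) ((W - {w, w'}) \<union> {v, q, q'})"
      using polar_on_1_plus_matching_iff[OF plus, of 0] polar_on_1_P3_iff[OF P3(1)] by simp
    show "\<not> cluster_on E (enat k) ((W - {w, w'}) \<union> {v, q, q'})"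
      using not_cluster_on_P3[OF P3(1)] by blast
  qed (use q W(1) assms(3) in auto)
  then show ?thesis using plus P3(1) unfolding induces_P3_def by auto
qed

lemma P3_residual_hub_not_adj:
  assumes "P3_residual E k H" "v \<in> H" and W: "W \<subseteq> H - {v}" "induced_matching E k W"
    and M: "complete_to E {v} M" "induced_matching E 2 M" "M \<subseteq> W" and e: "e \<in> W - M"
  shows "\<not> E v e"
proof
  assume ve: "E v e"
  have eW: "e \<in> W" using e by blast
  obtain f where f: "f \<in> W" "E e f" "induced_matching E (k - 1) (W - {e, f})"
    "anticomplete E {e, f} (W - {e, f})"
    using induced_matching_remove_edge[OF W(2) eW] by (metis diff_Suc_1)
  have "f \<notin> M"
  proof
    assume fM: "f \<in> M"
    then obtain g where "g \<in> M" "E f g" using M(2) unfolding induced_matching_def by blast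
    moreover from this have "g \<noteq> e" "g \<noteq> f" using e adj_irrefl by blast+
    ultimately show False using anticompleteD[OF f(4), of f g] M(3) by blast
  qed
  then have D: "insert v M \<subseteq> H - {f}" using assms(2) f(1) W(1) M(3) by blast
  have "f \<in> H" using f(1) W(1) by blast
  moreover have "\<not> cluster_on E (enat k) (H - {f})"
    using not_cluster_on_butterfly[OF _ D] M(1,2) unfolding induces_butterfly_def by blast
  ultimately have "polar_on E 1 (enat (k - 1)) (H - {f})"
    using assms(1) unfolding P3_residual_def by blast
  then obtain A where A: "indep_set E A" "cluster_on E (enat (k - 1)) (H - {f} - A)"
    unfolding polar_on_1_iff by blast
  have "v \<in> A" using hub_in_indep_set[OF M(1,2) D A(1) cluster_on_P3_free[OF A(2)]] .
  moreover have "e \<noteq> f" using f(2) adj_irrefl by blast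
  ultimately have eA: "e \<in> H - {f} - A" using A(1) ve eW W(1) unfolding indep_set_def by blast
  obtain S where S: "S \<subseteq> W - {e, f} - A" "indep_set E S" "card S = k - 1"
    using matching_indep_avoiding[OF f(3) A(1)] .
  have "indep_set E (insert e S)"
    using S(1,2) anticompleteD[OF f(4), of e] by (intro indep_set_insert) auto
  then have "card (insert e S) \<le> k - 1" using S(1) W(1) eA by (intro cluster_on_card_le[OF A(2)]) auto
  moreover have "finite S" "e \<notin> S"
    using S(1) finite_subset[OF S(1)] induced_matching_finite[OF W(2)] by auto
  ultimately show False using S(3) by simp
qed

lemma P3_residual_hub:
  assumes "P3_residual E k H" "v \<in> H" and W: "W \<subseteq> H - {v}" "induced_matching E k W"
    and no_pendant: "\<And>w w'. w \<in> W \<Longrightarrow> w' \<in> W \<Longrightarrow> E w w' \<Longrightarrow> E v w \<Longrightarrow> E v w'"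
    and a: "a \<in> W" "E v a" and c: "c \<in> W" "E v c" "a \<noteq> c" "\<not> E a c"
  shows "\<exists>D. induces_butterfly E D \<and> plus_matching E (k - 2) D H"
proof -
  obtain b m where b: "b \<in> W" "E a b" "k = Suc m" "induced_matching E m (W - {a, b})"
    "anticomplete E {a, b} (W - {a, b})"
    using induced_matching_remove_edge[OF W(2) a(1)] .
  have cW: "c \<in> W - {a, b}" using c b(2) by blast
  then obtain d n where d: "d \<in> W - {a, b}" "E c d" "m = Suc n"
    "induced_matching E n (W - {a, b} - {c, d})" "anticomplete E {c, d} (W - {a, b} - {c, d})"
    using induced_matching_remove_edge[OF b(4)] by metis
  define M where "M = {a, b, c, d}"
  have MW: "M \<subseteq> W" unfolding M_def using a(1) b(1) cW d(1) by blast
  have T_eq: "W - M = W - {a, b} - {c, d}" unfolding M_def by blast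
  have T: "induced_matching E (k - 2) (W - M)" unfolding T_eq using d(4) b(3) d(3) by simp
  have "anticomplete E {a, b} {c, d}"
    using anticomplete_subset[OF b(5) subset_refl] cW d(1) by simp
  then have M: "induced_matching E 2 M" unfolding M_def using induced_matching_2 b(2) d(2) by blast
  have hub: "complete_to E {v} M"
    using a c b(1,2) d(1,2) no_pendant[of a b] no_pendant[of c d] W(1)
    unfolding complete_to_def M_def by blast
  have butterfly: "induces_butterfly E (insert v M)"
    using hub M unfolding induces_butterfly_def by blast
  have "anticomplete E {a, b} (W - M)" "anticomplete E {c, d} (W - M)"
    unfolding T_eq using anticomplete_subset[OF b(5) subset_refl] d(5) by auto
  moreover have "\<not> E v e" if "e \<in> W - M" for e
    using P3_residual_hub_not_adj[OF assms(1,2) W hub M MW that] .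
  ultimately have "anticomplete E (W - M) (insert v M)"
    using W(1) by (intro anticomplete_sym[of "insert v M"]) (auto simp: anticomplete_def M_def)
  then have plus: "plus_matching E (k - 2) (insert v M) ((W - M) \<union> insert v M)"
    using T unfolding plus_matching_def by blast
  have "(W - M) \<union> insert v M = H"
  proof (rule P3_residual_eq[OF assms(1)])
    have "k - 1 = (k - 2) + 1" using b(3) d(3) by simp
    then show "\<not> polar_on E 1 (enat (k - 1)) ((W - M) \<union> insert v M)"
      using polar_on_1_plus_matching_iff[OF plus, of 1] polar_on_1_butterfly_iff[OF butterfly, of 1]
        finite_subset[OF MW induced_matching_finite[OF W(2)]] by simp
    show "\<not> cluster_on E (enat k) ((W - M) \<union> insert v M)"
      using not_cluster_on_butterfly[OF butterfly] by blast
    show "(W - M) \<union> insert v M \<subseteq> H" using assms(2) W(1) MW by blast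
  qed
  then show ?thesis using plus butterfly by metis
qed

lemma cluster_on_insert_adj:
  assumes "finite V" "P3_free E (insert v V)" "cluster_on E (enat k) V" "a \<in> V" "E v a"
  shows "cluster_on E (enat k) (insert v V)"
proof (rule cluster_onI[OF assms(2)])
  fix S assume S: "S \<subseteq> insert v V" "indep_set E S"
  show "card S \<le> k"
  proof (cases "v \<in> S")
    case False
    then show ?thesis using S by (intro cluster_on_card_le[OF assms(3)]) auto
  next
    case True
    have a: "\<not> E a s \<and> a \<noteq> s" if s: "s \<in> S - {v}" for s
    proof -
      have "\<not> E v s" using S(2) True s unfolding indep_set_def by blast
      then show ?thesis using P3_freeD[OF assms(2), of v a s] S(1) s assms(4,5) by blast
    qed
    have "card (insert a (S - {v})) \<le> k"
      using S a assms(4) indep_set_subset[OF S(2)]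
      by (intro cluster_on_card_le[OF assms(3)] indep_set_insert) auto
    moreover have "finite S" using S(1) assms(1) finite_subset by blast
    moreover have "a \<notin> S - {v}" using a by blast
    ultimately show ?thesis using True card.remove[of S v] by simp
  qed
qed

lemma polar_on_infty_matching:
  "induced_matching E n W \<Longrightarrow> polar_on E \<infinity> (enat i) W \<Longrightarrow> n \<le> Suc i"
proof (induction arbitrary: i rule: induced_matching_induct)
  case (edge n x y W)
  have "polar_on E 1 (enat i) ({x, y} \<union> W) \<or> cluster_on E (enat i) W
      \<or> 1 \<le> i \<and> polar_on E \<infinity> (enat (i - 1)) W"
    using edge.prems polar_on_infty_cluster_Un_iff[OF _ induced_matching_finite[OF edge.hyps(1)]
        edge.hyps(2) complete_multipartite_clique[OF clique_set_edge] cluster_on_edge_iff, of i]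
      edge.hyps(3) by simp
  moreover have "polar_on E 1 (enat i) ({x, y} \<union> W) \<longleftrightarrow> Suc n \<le> i"
    using polar_on_1_matching_iff[OF induced_matching_insert_edge[OF edge.hyps]] .
  moreover have "cluster_on E (enat i) W \<longleftrightarrow> n \<le> i" using cluster_on_matching_iff[OF edge.hyps(1)] .
  moreover have "n \<le> i" if "1 \<le> i" "polar_on E \<infinity> (enat (i - 1)) W"
    using edge.IH[OF that(2)] that(1) by simp
  ultimately show ?case by linarith
qed simp

lemma P3_residual_not_P3_free:
  assumes "2 \<le> k" "finite H" "P3_residual E k H" "v \<in> H" "cluster_on E (enat k) (H - {v})"
    and W: "W \<subseteq> H - {v}" "induced_matching E k W"
  shows "\<not> P3_free E H"
proof
  assume P3: "P3_free E H"
  have vH: "insert v (H - {v}) = H" using assms(4) by blast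
  have "\<not> cluster_on E (enat k) H" using assms(3) unfolding P3_residual_def by blast
  then have "\<not> E v w" if "w \<in> W" for w
    using cluster_on_insert_adj[of "H - {v}" v k w] assms(2,5) P3 that W(1) unfolding vH by blast
  then have anti: "anticomplete E {v} W" using W(1) unfolding anticomplete_def by blast
  have "cluster_on E (enat i) {v} \<longleftrightarrow> 1 \<le> i" for i
    using cluster_on_indep_iff[OF _ indep_set_singleton] by simp
  note Un_iff = polar_on_infty_cluster_Un_iff[OF _ induced_matching_finite[OF W(2)] anti
      complete_multipartite_clique[OF clique_set_singleton] this]
  have "polar_on E \<infinity> (enat (k - 1)) ({v} \<union> W)"
    using polar_on_mono[of E \<infinity> "enat (k - 1)" H "{v} \<union> W"] assms(3,4) W(1)
    unfolding P3_residual_def by blast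
  then consider "polar_on E 1 (enat (k - 1)) ({v} \<union> W)" | "cluster_on E (enat (k - 1)) W"
    | "polar_on E \<infinity> (enat (k - 1 - 1)) W"
    using Un_iff[of "k - 1"] by auto
  then show False
  proof cases
    case 1
    then have "polar_on E 1 (enat (k - 1)) W" using polar_on_mono[OF 1] by blast
    then show ?thesis using polar_on_1_matching_iff[OF W(2)] assms(1) by simp
  next
    case 2
    then show ?thesis using cluster_on_matching_iff[OF W(2)] assms(1) by simp
  next
    case 3
    then show ?thesis using polar_on_infty_matching[OF W(2)] assms(1) by fastforce
  qed
qed

theorem P3_residual_cluster_deletion:
  assumes k: "2 \<le> k" and fin: "finite H" and P4: "P4_free E H" and res: "P3_residual E k H"
    and v: "v \<in> H"
    and cl: "cluster_on E (enat k) (H - {v})" and npol: "\<not> polar_on E 1 (enat (k - 1)) (H - {v})"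
  shows "(\<exists>D. induces_P3 E D \<and> plus_matching E (k - 1) D H)
    \<or> (\<exists>D. induces_butterfly E D \<and> plus_matching E (k - 2) D H)"
proof -
  obtain W where W: "W \<subseteq> H - {v}" "induced_matching E k W"
    using cluster_contains_matching[OF _ cluster_on_P3_free[OF cl] npol] fin k by auto
  show ?thesis
  proof (cases "\<exists>q\<in>H. \<exists>q'\<in>H. induced_P3 E v q q'")
    case True
    then show ?thesis using P3_residual_pendant_edge[OF P4 res v cl W] by blast
  next
    case no_pendant: False
    have up: "E v y" if "x \<in> H" "y \<in> H - {v}" "E x y" "E v x" for x y
      using no_pendant that unfolding induced_P3_def by blast
    obtain x y z where xyz: "{x, y, z} \<subseteq> H" "induced_P3 E x y z"
      using P3_residual_not_P3_free[OF k fin res v cl W] unfolding P3_free_def by blast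
    have "induced_P3 E z y x" using xyz(2) adj_sym unfolding induced_P3_def by blast
    then have "x \<noteq> v" "z \<noteq> v" using no_pendant xyz by blast+
    then have "y = v" using cluster_on_P3_free[OF cl] xyz unfolding P3_free_def by blast
    then have P3: "x \<in> H - {v}" "z \<in> H - {v}" "E v x" "E v z" "\<not> E x z" "x \<noteq> z"
      using xyz adj_sym adj_irrefl unfolding induced_P3_def by blast+
    note P3_free_Q = P3_freeD[OF cluster_on_P3_free[OF cl]]
    obtain a where a: "a \<in> W" "E x a" using cluster_on_matching_adj[OF cl W(2,1) P3(1)] by blast
    obtain c where c: "c \<in> W" "E z c" using cluster_on_matching_adj[OF cl W(2,1) P3(2)] by blast
    have "\<not> E a z \<and> a \<noteq> z" using P3_free_Q[of x a z] P3 a W(1) by blast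
    then have "a \<noteq> c" "\<not> E a c" using P3_free_Q[of a c z] P3(2) a(1) c W(1) adj_sym by blast+
    then have "\<exists>D. induces_butterfly E D \<and> plus_matching E (k - 2) D H"
      using a c P3(1-4) W(1) by (intro P3_residual_hub[OF res v W, of a c]) (auto intro: up)
    then show ?thesis by blast
  qed
qed

lemma min_polar_obstruction_cluster_part:
  assumes "finite W" "finite D" "anticomplete E W D" "P3_free E W"
    and obs: "min_polar_obstruction_on E 1 (enat n) (W \<union> D)"
  obtains t where "induced_matching E t W"
proof -
  obtain i where "polar_on E 1 (enat i) W"
    using polar_on_1_finite[OF assms(1)] assms(4) polar_on_cluster cluster_on_infty by metis
  define t where "t = (LEAST t. polar_on E 1 (enat t) W)"
  have t: "polar_on E 1 (enat t) W" unfolding t_def using \<open>polar_on E 1 (enat i) W\<close> by (rule LeastI)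
  have "\<exists>M\<subseteq>W. induced_matching E t M"
  proof (cases t)
    case 0
    then show ?thesis using induced_matching_0_iff by blast
  next
    case (Suc s)
    then have "\<not> polar_on E 1 (enat s) W"
      using not_less_Least[of s "\<lambda>t. polar_on E 1 (enat t) W"] unfolding t_def by simp
    then show ?thesis using cluster_contains_matching[OF assms(1,4)] Suc by metis
  qed
  then obtain M where M: "M \<subseteq> W" "induced_matching E t M" by blast
  have "\<not> polar_on E 1 (enat n) (M \<union> D)"
  proof
    assume "polar_on E 1 (enat n) (M \<union> D)"
    then have "t \<le> n" "polar_on E 1 (enat (n - t)) D"
      using polar_on_1_Un_iff[OF _ assms(2) anticomplete_subset[OF assms(3) M(1) subset_refl]
          polar_on_1_matching_iff[OF M(2)]] finite_subset[OF M(1) assms(1)] by auto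
    then have "polar_on E 1 (enat n) (W \<union> D)" using polar_on_1_Un[OF assms(3) t, of "n - t"] by simp
    then show False using obs unfolding min_polar_obstruction_on_def by blast
  qed
  then have "M \<union> D = W \<union> D" using min_polar_obstruction_on_eq[OF obs] M(1) by blast
  then have "M = W" using M(1) assms(3) unfolding anticomplete_def by blast
  then show ?thesis using that M(2) by blast
qed

lemma min_polar_obstruction_remove_matching:
  assumes "induced_matching E t W" "anticomplete E W D" "finite D"
    and obs: "min_polar_obstruction_on E 1 (enat (t + j)) (W \<union> D)"
  shows "min_polar_obstruction_on E 1 (enat j) D"
proof -
  have "polar_on E 1 (enat j) (D - {v})" if "v \<in> D" for v
  proof -
    have "W \<union> D - {v} = W \<union> (D - {v})" using that assms(2) unfolding anticomplete_def by blast
    moreover have "polar_on E 1 (enat (t + j)) (W \<union> D - {v})"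
      using obs that unfolding min_polar_obstruction_on_iff by blast
    ultimately show ?thesis
      using polar_on_1_matching_Un_iff[OF assms(1)
          anticomplete_subset[OF assms(2) subset_refl Diff_subset] finite_Diff[OF assms(3)]] by simp
  qed
  then show ?thesis
    using obs polar_on_1_matching_Un_iff[OF assms(1-3)] unfolding min_polar_obstruction_on_iff by blast
qed

lemma P3_residual_2_monopolar:
  assumes "finite H" "P4_free E H" "P3_residual E 2 H"
  shows "polar_on E 1 \<infinity> H"
proof (rule ccontr)
  assume nm: "\<not> polar_on E 1 \<infinity> H"
  then have "polar_on E \<infinity> (enat 0) H"
    using assms(3) polar_on_1_imp_monopolar unfolding P3_residual_def by auto
  then have cm: "complete_multipartite E H"
    unfolding polar_on_infty_iff cluster_on_0_iff by (metis Diff_eq_empty_iff subset_antisym)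
  have "\<not> polar_on E 1 (enat 1) H" using nm polar_on_1_imp_monopolar by blast
  then obtain a b c d where abcd: "{a, b, c, d} \<subseteq> H" "induced_C4 E a b c d \<or> induced_2K2 E a b c d"
    using P4_free_split[OF assms(1,2)] by blast
  have "\<not> induced_2K2 E a b c d"
  proof
    assume K: "induced_2K2 E a b c d"
    then have "E a c \<or> E b c"
      using complete_multipartite_adj_edge[OF cm, of a b c] abcd(1) unfolding induced_2K2_def by blast
    then show False using K unfolding induced_2K2_def anticomplete_def by blast
  qed
  then have C4: "induced_C4 E a b c d" using abcd(2) by blast
  then have "induced_P3 E a b c"
    using adj_sym unfolding induced_C4_def complete_to_def induced_P3_def by blast
  then have "\<not> cluster_on E (enat 2) {a, b, c, d}" by (rule not_cluster_on_P3) blast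
  then have "{a, b, c, d} = H"
    using P3_residual_eq[OF assms(3) abcd(1)] not_polar_on_1_1_C4[OF C4] by simp
  then show False using monopolar_C4[OF C4] nm by simp
qed

lemma P3_residual_nonmonopolar:
  assumes "2 \<le> k" "finite H" "P4_free E H" "P3_residual E k H"
    and del: "\<And>v. v \<in> H \<Longrightarrow> polar_on E 1 (enat (k - 1)) (H - {v})" and "\<not> polar_on E 1 \<infinity> H"
  shows "3 \<le> k \<and> min_polar_obstruction_on E 1 \<infinity> H"
proof
  have "k \<noteq> 2" using P3_residual_2_monopolar assms(2-4,6) by blast
  then show "3 \<le> k" using assms(1) by simp
  show "min_polar_obstruction_on E 1 \<infinity> H"
    unfolding min_polar_obstruction_on_iff using del polar_on_1_imp_monopolar assms(6) by blast
qed

lemma min_polar_obstruction_Un_matching_less: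
  assumes "induced_matching E t W" "anticomplete E W D" "{a, b} \<subseteq> D" "E a b"
    and obs: "min_polar_obstruction_on E 1 (enat n) (W \<union> D)" and "\<not> cluster_on E (enat (Suc n)) (W \<union> D)"
  shows "t < n"
proof (rule ccontr)
  assume "\<not> t < n"
  have "anticomplete E {a, b} W"
    using anticomplete_subset[OF anticomplete_sym[OF assms(2)] assms(3)] by blast
  then have m: "induced_matching E (Suc t) ({a, b} \<union> W)"
    using induced_matching_insert_edge assms(1,4) by blast
  then have "{a, b} \<union> W = W \<union> D"
    using \<open>\<not> t < n\<close> assms(3) polar_on_1_matching_iff[OF m]
    by (intro min_polar_obstruction_on_eq[OF obs]) auto
  moreover have "t \<le> n"
  proof (rule ccontr)
    assume "\<not> t \<le> n"
    then have "W = W \<union> D"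
      using polar_on_1_matching_iff[OF assms(1)] by (intro min_polar_obstruction_on_eq[OF obs]) auto
    then show False using assms(2,3) unfolding anticomplete_def by blast
  qed
  ultimately show False using cluster_on_matching_iff[OF m] assms(6) by simp
qed

lemma P3_residual_monopolar:
  assumes "2 \<le> k" "finite H" "P3_residual E k H"
    and del: "\<And>v. v \<in> H \<Longrightarrow> polar_on E 1 (enat (k - 1)) (H - {v})" and mono: "polar_on E 1 \<infinity> H"
  shows "\<exists>j\<in>{1..k - 1}. \<exists>D. plus_matching E (k - j - 1) D H \<and> connected_on E D
    \<and> min_polar_obstruction_on E 1 (enat j) D \<and> \<not> min_polar_obstruction_on E 1 \<infinity> D"
proof -
  have npol: "\<not> polar_on E 1 (enat (k - 1)) H" and ncl: "\<not> cluster_on E (enat k) H"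
    using assms(3) unfolding P3_residual_def by blast+
  have obs: "min_polar_obstruction_on E 1 (enat (k - 1)) H"
    unfolding min_polar_obstruction_on_iff using npol del by blast
  obtain A where A: "A \<subseteq> H" "complete_multipartite E A" "cluster_on E (enat (k - 1)) (H - A)"
    using assms(3) unfolding P3_residual_def polar_on_infty_iff by blast
  have "\<not> indep_set E A" using A npol unfolding polar_on_1_iff by blast
  then obtain a b where ab: "a \<in> A" "b \<in> A" "E a b" unfolding indep_set_def by blast
  obtain D where D: "a \<in> D" "D \<subseteq> H" "connected_on E D" "anticomplete E D (H - D)"
    using connected_component_containing[OF assms(2)] ab(1) A(1) by blast
  have "A \<subseteq> D"
    using complete_multipartite_side[OF D(4) A(2) _ \<open>\<not> indep_set E A\<close>] A(1) ab(1) D(1) by blast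
  have fin: "finite (H - D)" "finite D" using assms(2) D(2) finite_subset by auto
  have H: "(H - D) \<union> D = H" using D(2) by blast
  have anti: "anticomplete E (H - D) D" using anticomplete_sym[OF D(4)] .
  have "P3_free E (H - D)" using P3_free_subset[OF cluster_on_P3_free[OF A(3)]] \<open>A \<subseteq> D\<close> by blast
  then obtain t where t: "induced_matching E t (H - D)"
    using min_polar_obstruction_cluster_part[OF fin anti] obs H by metis
  have "t < k - 1"
    using min_polar_obstruction_Un_matching_less[OF t anti _ ab(3), of "k - 1"]
      ab \<open>A \<subseteq> D\<close> obs ncl assms(1) H
    by auto
  then obtain j where j: "k - 1 = t + j" "1 \<le> j"
    using less_imp_add_positive by (metis Suc_leI One_nat_def)
  have "min_polar_obstruction_on E 1 (enat j) D"
    using min_polar_obstruction_remove_matching[OF t anti fin(2)] obs H j(1) by simp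
  moreover have "\<not> min_polar_obstruction_on E 1 \<infinity> D"
    using polar_on_mono[OF mono D(2)] unfolding min_polar_obstruction_on_def by blast
  moreover have "k - j - 1 = t" "j \<in> {1..k - 1}" using j by auto
  then have "plus_matching E (k - j - 1) D H" using t anti H unfolding plus_matching_def by metis
  ultimately show ?thesis using D(3) \<open>j \<in> {1..k - 1}\<close> by blast
qed

section \<open>Sufficiency of the first three alternatives\<close>

lemma polar_on_1_matching_delete:
  assumes "induced_matching E n W" "v \<in> W"
  shows "polar_on E 1 (enat (n - 1)) (W - {v})"
proof -
  obtain w m where w: "w \<in> W" "E v w" "n = Suc m" "induced_matching E m (W - {v, w})"
    "anticomplete E {v, w} (W - {v, w})"
    using induced_matching_remove_edge[OF assms] .
  have "anticomplete E {w} (W - {v, w})" using anticomplete_subset[OF w(5)] by blast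
  moreover have "polar_on E 1 (enat 0) {w}" using polar_on_1_0_iff indep_set_singleton by blast
  ultimately have "polar_on E 1 (enat (0 + m)) ({w} \<union> (W - {v, w}))"
    using polar_on_1_Un polar_on_1_matching_iff[OF w(4), of m] by blast
  moreover have "{w} \<union> (W - {v, w}) = W - {v}" using w(1,2) adj_irrefl by blast
  ultimately show ?thesis using w(3) by simp
qed

lemma P3_residual_plus_matching:
  assumes "1 \<le> m" "finite H" "P3_residual E m D" "polar_on E 1 (enat m) D"
    and plus: "plus_matching E t D H"
  shows "P3_residual E (t + m) H"
proof -
  obtain W where W: "anticomplete E W D" "induced_matching E t W" and H: "H = W \<union> D"
    using plus unfolding plus_matching_def by blast
  have fin: "finite W" "finite D" using assms(2) H by auto
  have D: "\<not> polar_on E 1 (enat (m - 1)) D" "\<not> cluster_on E (enat m) D" "polar_on E \<infinity> (enat (m - 1)) D"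
    and del_D: "\<And>v. v \<in> D \<Longrightarrow> polar_on E 1 (enat (m - 1)) (D - {v}) \<or> cluster_on E (enat m) (D - {v})"
    using assms(3) unfolding P3_residual_def by blast+
  have km: "t + m - 1 = t + (m - 1)" using assms(1) by simp
  have polar_W: "polar_on E 1 (enat t) W" and cluster_W: "cluster_on E (enat t) W"
    using polar_on_1_matching_iff[OF W(2)] cluster_on_matching_iff[OF W(2)] by auto
  have del: "polar_on E 1 (enat (t + m - 1)) (H - {v}) \<or> cluster_on E (enat (t + m)) (H - {v})"
    if v: "v \<in> H" for v
  proof (cases "v \<in> D")
    case True
    then have eq: "H - {v} = W \<union> (D - {v})" using H W(1) unfolding anticomplete_def by blast
    have "anticomplete E W (D - {v})" using anticomplete_subset[OF W(1)] by blast
    then show ?thesis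
      unfolding eq km using del_D[OF True] polar_on_1_Un polar_W cluster_on_Un cluster_W by blast
  next
    case False
    then have vW: "v \<in> W" and eq: "H - {v} = (W - {v}) \<union> D" using v H by blast+
    have "1 \<le> t" using vW W(2) by (cases t) (auto simp: induced_matching_0_iff)
    have "anticomplete E (W - {v}) D" using anticomplete_subset[OF W(1)] by blast
    from polar_on_1_Un[OF this polar_on_1_matching_delete[OF W(2) vW] assms(4)]
    show ?thesis unfolding eq using \<open>1 \<le> t\<close> by simp
  qed
  have "\<not> polar_on E 1 (enat (t + m - 1)) H" "polar_on E 1 (enat (t + m)) H"
    unfolding km polar_on_1_plus_matching_iff[OF plus fin(2)] using D(1) assms(4) by blast+
  moreover have "\<not> cluster_on E (enat (t + m)) H"
    unfolding H using cluster_on_Un_iff[OF fin W(1) cluster_on_matching_iff[OF W(2)]] D(2) by simp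
  moreover have "polar_on E \<infinity> (enat (t + m - 1)) H"
  proof -
    obtain A where A: "A \<subseteq> D" "complete_multipartite E A" "cluster_on E (enat (m - 1)) (D - A)"
      using D(3) unfolding polar_on_infty_iff by blast
    have "cluster_on E (enat (t + (m - 1))) (W \<union> (D - A))"
      using cluster_on_Un[OF _ cluster_W A(3)] anticomplete_subset[OF W(1)] by blast
    then show ?thesis unfolding km H by (rule polar_on_inftyI[OF A(2)]) blast
  qed
  ultimately show ?thesis unfolding P3_residual_def using del by blast
qed

lemma P3_residual_P3:
  assumes "induces_P3 E D" shows "P3_residual E 1 D" "polar_on E 1 (enat 1) D"
proof -
  obtain a b c where D: "D = {a, b, c}" and P3: "induced_P3 E a b c"
    using assms unfolding induces_P3_def by blast
  have abc: "E a b" "E b c" "\<not> E a c" "a \<noteq> c" "a \<noteq> b" "b \<noteq> c"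
    using P3 adj_irrefl unfolding induced_P3_def by blast+
  show polar: "polar_on E 1 (enat 1) D" using polar_on_1_P3_iff[OF P3] D by simp
  have "polar_on E 1 (enat 0) {a, c}" using abc(3) polar_on_1_0_iff indep_set_doubleton_iff by blast
  moreover have "cluster_on E (enat 1) {a, b}" "cluster_on E (enat 1) {b, c}"
    using clique_set_edge abc(1,2) cluster_on_1_iff by blast+
  moreover have "D - {a} = {b, c}" "D - {b} = {a, c}" "D - {c} = {a, b}" using D abc by auto
  ultimately have "polar_on E 1 (enat 0) (D - {v}) \<or> cluster_on E (enat 1) (D - {v})" if "v \<in> D" for v
    using that D by fastforce
  moreover have "polar_on E \<infinity> (enat 0) D"
    using polar_on_infty_complete_multipartite[OF complete_multipartite_P3[OF P3]] D by simp
  moreover have "\<not> polar_on E 1 (enat 0) D" "\<not> cluster_on E (enat 1) D"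
    unfolding D using polar_on_1_P3_iff[OF P3, of 0] not_cluster_on_P3[OF P3] by simp_all
  ultimately show "P3_residual E 1 D" unfolding P3_residual_def using polar by simp
qed

lemma complete_multipartite_join:
  assumes "complete_to E X Y" "complete_multipartite E X" "complete_multipartite E Y"
  shows "complete_multipartite E (X \<union> Y)"
  using simple_graph.P3_free_Un[OF simple_graph_complement] assms by (simp add: anticomplete_complement)

lemma P3_residual_butterfly:
  assumes "induces_butterfly E D" shows "P3_residual E 2 D" "polar_on E 1 (enat 2) D"
proof -
  obtain v M where vM: "D = insert v M" "complete_to E {v} M" "induced_matching E 2 M"
    using assms unfolding induces_butterfly_def by blast
  have v: "v \<notin> M" using vM(2) unfolding complete_to_def by blast
  show polar: "polar_on E 1 (enat 2) D" using polar_on_1_butterfly_iff[OF assms] by simp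
  have edge: "\<exists>y\<in>M. E x y \<and> clique_set E (insert v (M - {x, y}))" if x: "x \<in> M" for x
  proof -
    obtain y m where y: "y \<in> M" "E x y" "2 = Suc m" "induced_matching E m (M - {x, y})"
      using induced_matching_remove_edge[OF vM(3) x] by metis
    then have "cluster_on E (enat 1) (M - {x, y})" using cluster_on_matching_iff[of m _ 1] by simp
    then have "clique_set E (M - {x, y})" using cluster_on_1_iff by blast
    moreover have "complete_to E {v} (M - {x, y})" using complete_to_subset[OF vM(2)] by blast
    ultimately show ?thesis
      using y(1,2) clique_set_singleton clique_set_join_iff[of "{v}" "M - {x, y}"] by auto
  qed
  have "polar_on E 1 (enat 1) (D - {x}) \<or> cluster_on E (enat 2) (D - {x})" if x: "x \<in> D" for x
  proof (cases "x = v")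
    case True
    then show ?thesis using vM(1) v cluster_on_matching_iff[OF vM(3)] by simp
  next
    case False
    then obtain y where y: "clique_set E (insert v (M - {x, y}))" using edge x vM(1) by blast
    have "polar_on E 1 (enat 1) (D - {x})"
      using vM(1) by (intro polar_on_1_1I[OF indep_set_singleton y]) auto
    then show ?thesis by blast
  qed
  moreover have "polar_on E \<infinity> (enat 1) D"
  proof -
    obtain x where x: "x \<in> M" using vM(3) unfolding induced_matching_def by fastforce
    then obtain y where y: "y \<in> M" "E x y" "clique_set E (insert v (M - {x, y}))" using edge by blast
    have "cluster_on E (enat 1) {x, y}" using cluster_on_1_iff clique_set_edge[OF y(2)] by blast
    then show ?thesis
      using vM(1) by (intro polar_on_inftyI[OF complete_multipartite_clique[OF y(3)]]) auto
  qed
  ultimately show "P3_residual E 2 D"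
    unfolding P3_residual_def
    using polar polar_on_1_butterfly_iff[OF assms] not_cluster_on_butterfly[OF assms subset_refl]
    by simp
qed

lemma indep_set_avoids_matching:
  assumes "indep_set E S" "induced_matching E n W" "n < card S"
  obtains w where "w \<in> S" "w \<notin> W"
proof -
  have "\<not> S \<subseteq> W"
    using cluster_on_card_le[of E n W S] cluster_on_matching_iff[OF assms(2)] assms(1,3) by auto
  then show ?thesis using that by blast
qed

lemma not_clique_set_if_indep_set: "indep_set E S \<Longrightarrow> 2 \<le> card S \<Longrightarrow> S \<subseteq> V \<Longrightarrow> \<not> clique_set E V"
  using cluster_on_card_le[of E 1 V S] cluster_on_1_iff by fastforce

lemma join_obstruction_vertex_deletion:
  assumes XY: "complete_to E X Y" "X \<noteq> {}" and j: "1 \<le> j"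
    and obs: "min_polar_obstruction_on E 1 (enat j) (X \<union> Y)"
    and S: "S \<subseteq> Y" "indep_set E S" "finite S" "Suc j < card S" and w: "w \<in> S"
  shows "clique_set E X \<and> polar_on E 1 (enat 1) (Y - {w})
    \<or> indep_set E (Y - {w}) \<and> cluster_on E (enat j) X"
proof -
  have Sw: "indep_set E (S - {w})" "S - {w} \<subseteq> Y - {w}" "j < card (S - {w})"
    using indep_set_subset[OF S(2)] S(1,3,4) w by auto
  have "X \<union> Y - {w} = X \<union> (Y - {w})" using XY(1) S(1) w unfolding complete_to_def by blast
  moreover have "polar_on E 1 (enat j) (X \<union> Y - {w})"
    using obs S(1) w unfolding min_polar_obstruction_on_iff by blast
  ultimately have "polar_on E 1 (enat j) (X \<union> (Y - {w}))" by simp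
  moreover have join: "complete_to E X (Y - {w})" using complete_to_subset[OF XY(1)] by blast
  moreover have "Y - {w} \<noteq> {}" using Sw(2,3) by (metis card.empty not_less_zero subset_empty)
  ultimately have "polar_on E 1 (enat 1) (X \<union> (Y - {w}))
      \<or> indep_set E X \<and> cluster_on E (enat j) (Y - {w})
      \<or> indep_set E (Y - {w}) \<and> cluster_on E (enat j) X"
    using polar_on_1_join_iff[of X "Y - {w}" "enat j"] XY(2) j by simp
  moreover have "\<not> cluster_on E (enat j) (Y - {w})"
    using cluster_on_card_le[of E j "Y - {w}" "S - {w}"] Sw by auto
  moreover have "\<not> clique_set E (Y - {w})"
    using not_clique_set_if_indep_set[OF Sw(1) _ Sw(2)] Sw(3) j by simp
  ultimately show ?thesis using polar_on_1_1_join_iff[OF join] by blast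
qed

lemma join_obstruction_cluster_side:
  assumes XY: "complete_to E X Y" "X \<noteq> {}" and fin: "finite Y" and j: "1 \<le> j"
    and obs: "min_polar_obstruction_on E 1 (enat j) (X \<union> Y)" and "P3_free E Y"
  shows "cluster_on E (enat (Suc j)) Y"
proof (rule cluster_onI[OF assms(6)], rule ccontr)
  fix S assume S: "S \<subseteq> Y" "indep_set E S" "\<not> card S \<le> Suc j"
  have finS: "finite S" using finite_subset[OF S(1) fin] .
  have del: "clique_set E X \<and> polar_on E 1 (enat 1) (Y - {w})
      \<or> indep_set E (Y - {w}) \<and> cluster_on E (enat j) X"
    if "w \<in> S" for w
    using join_obstruction_vertex_deletion[OF XY j obs S(1,2) finS _ that] S(3) by simp
  have npol: "\<not> polar_on E 1 (enat j) (X \<union> Y)" using obs unfolding min_polar_obstruction_on_def by blast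
  show False
  proof (cases "clique_set E X")
    case True
    then have "\<not> polar_on E 1 (enat 1) Y"
      using npol polar_on_1_1_join_iff[OF XY(1)] polar_on_1_enat_mono[OF _ j] by blast
    then obtain W where W: "W \<subseteq> Y" "induced_matching E 2 W"
      using cluster_contains_matching[OF fin assms(6)] by (metis Suc_1)
    obtain w where w: "w \<in> S" "w \<notin> W" using indep_set_avoids_matching[OF S(2) W(2)] S(3) j by auto
    then have "polar_on E 1 (enat 1) (Y - {w})"
      using del[OF w(1)] polar_on_1_0_iff polar_on_1_enat_mono[of 0 _ 1] by auto
    then have "polar_on E 1 (enat 1) W" using W(1) w(2) by (elim polar_on_mono) auto
    then show ?thesis using polar_on_1_matching_iff[OF W(2)] by simp
  next
    case False
    have "S \<noteq> {}" using S(3) by auto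
    then have "cluster_on E (enat j) X" using del False by blast
    then have "\<not> indep_set E Y" using npol polar_on_1I[of Y "enat j" X "X \<union> Y"] by blast
    then obtain a b where ab: "a \<in> Y" "b \<in> Y" "E a b" unfolding indep_set_def by blast
    obtain w where w: "w \<in> S" "w \<notin> {a, b}"
      using indep_set_avoids_matching[OF S(2) induced_matching_1[OF ab(3)]] S(3) by auto
    then show ?thesis using del[OF w(1)] False ab unfolding indep_set_def by blast
  qed
qed

lemma polar_on_infty_join:
  assumes "complete_to E X Y" "indep_set E X" "finite Y" "Y \<noteq> {}" "cluster_on E (enat (Suc j)) Y"
  shows "polar_on E \<infinity> (enat j) (X \<union> Y)"
proof -
  obtain y where "y \<in> Y" using assms(4) by blast
  then obtain K where K: "y \<in> K" "K \<subseteq> Y" "clique_set E K" "anticomplete E K (Y - K)"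
    using P3_free_component[OF cluster_on_P3_free[OF assms(5)]] by blast
  have "complete_multipartite E (X \<union> K)"
    using assms(1,2) K(2,3) complete_multipartite_indep complete_multipartite_clique complete_to_subset
    by (intro complete_multipartite_join) blast+
  moreover have "cluster_on E (enat i) K \<longleftrightarrow> 1 \<le> i" for i
    using cluster_on_pos[OF _ K(1)] cluster_on_1_iff[of K] K(3)
      cluster_on_mono[of E "enat 1" K K "enat i"] by auto
  then have "cluster_on E (enat j) (Y - K)"
    using cluster_on_Un_iff[OF _ _ K(4), of 1 "Suc j"] assms(3,5) K(2) finite_subset[OF K(2)]
    by (auto simp: Un_absorb1)
  ultimately show ?thesis by (rule polar_on_inftyI) blast
qed

lemma connected_obstruction_polar:
  assumes "finite D" "P4_free E D" "connected_on E D" "1 \<le> j"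
    and obs: "min_polar_obstruction_on E 1 (enat j) D"
    and "\<not> min_polar_obstruction_on E 1 \<infinity> D"
  shows "polar_on E 1 (enat (Suc j)) D" "polar_on E \<infinity> (enat j) D"
proof -
  have "polar_on E 1 \<infinity> D"
    using assms(6) obs polar_on_1_imp_monopolar unfolding min_polar_obstruction_on_iff by blast
  have not_split: "\<not> polar_on E 1 (enat 1) D"
    using obs polar_on_1_enat_mono[OF _ assms(4)] unfolding min_polar_obstruction_on_def by blast
  then have "\<not> clique_set E D" using polar_on_1_1I[OF indep_set_empty] by blast
  then obtain X Y where XY: "X \<union> Y = D" "X \<noteq> {}" "Y \<noteq> {}" "complete_to E X Y"
    using connected_P4_free_join[OF assms(1-3)] by blast
  have conclusion: "polar_on E 1 (enat (Suc j)) D \<and> polar_on E \<infinity> (enat j) D"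
    if side: "X' \<union> Y' = D" "X' \<noteq> {}" "Y' \<noteq> {}" "complete_to E X' Y'" "indep_set E X'"
      "P3_free E Y'" for X' Y'
  proof -
    have fin: "finite Y'" using side(1) assms(1) by auto
    have "cluster_on E (enat (Suc j)) Y'"
      using join_obstruction_cluster_side[OF side(4,2) fin assms(4) _ side(6)] obs side(1) by simp
    then show ?thesis
      using polar_on_1I[OF side(5)] polar_on_infty_join[OF side(4,5) fin side(3)] side(1) by blast
  qed
  have "indep_set E X \<and> P3_free E Y \<or> indep_set E Y \<and> P3_free E X"
    using polar_on_1_join_iff[OF XY(4,2,3), of \<infinity>] not_split \<open>polar_on E 1 \<infinity> D\<close> XY(1)
    by (simp add: cluster_on_infty)
  then show "polar_on E 1 (enat (Suc j)) D" "polar_on E \<infinity> (enat j) D"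
    using conclusion[of X Y] conclusion[of Y X] XY complete_to_sym[OF XY(4)] by blast+
qed

lemma P3_residual_connected_obstruction:
  assumes "finite D" "P4_free E D" "connected_on E D" "1 \<le> j"
    and obs: "min_polar_obstruction_on E 1 (enat j) D"
    and "\<not> min_polar_obstruction_on E 1 \<infinity> D"
  shows "P3_residual E (Suc j) D"
proof -
  have "\<not> cluster_on E (enat (Suc j)) D"
  proof
    assume "cluster_on E (enat (Suc j)) D"
    then have "clique_set E D" using connected_P3_free_clique[OF assms(3)] cluster_on_P3_free by blast
    then have "polar_on E 1 (enat 1) D" using polar_on_1_1I[OF indep_set_empty] by blast
    then show False
      using obs polar_on_1_enat_mono[OF _ assms(4)] unfolding min_polar_obstruction_on_def by blast
  qed
  then show ?thesis
    using obs connected_obstruction_polar[OF assms]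
    unfolding P3_residual_def min_polar_obstruction_on_iff by simp
qed

section \<open>Non-monopolar cographs\<close>

definition monopolar_critical :: "'a set \<Rightarrow> bool" where
  "monopolar_critical S \<longleftrightarrow> \<not> polar_on E 1 \<infinity> S \<and> polar_on E \<infinity> (enat 1) S
    \<and> (\<forall>v\<in>S. polar_on E 1 (enat 2) (S - {v}))"

definition induced_K1_K2 :: "'a \<Rightarrow> 'a \<Rightarrow> 'a \<Rightarrow> bool" where
  "induced_K1_K2 x y z \<longleftrightarrow> E y z \<and> anticomplete E {x} {y, z}"

lemma monopolar_cone_iff:
  assumes "complete_to E {u} Y"
  shows "polar_on E 1 \<infinity> (insert u Y) \<longleftrightarrow> polar_on E 1 (enat 1) Y \<or> P3_free E Y"
proof
  assume mono: "polar_on E 1 \<infinity> (insert u Y)"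
  show "polar_on E 1 (enat 1) Y \<or> P3_free E Y"
  proof (cases "Y = {}")
    case True
    then show ?thesis unfolding P3_free_def by blast
  next
    case False
    have "polar_on E 1 (enat 1) Y" if "clique_set E Y"
      using polar_on_1_1I[OF indep_set_empty that] by blast
    moreover have "P3_free E Y" if "indep_set E Y" using that by (rule P3_free_indep)
    ultimately show ?thesis
      using mono polar_on_1_join_iff[OF assms _ False, of \<infinity>] polar_on_1_1_join_iff[OF assms]
      by (auto simp: cluster_on_infty)
  qed
next
  assume "polar_on E 1 (enat 1) Y \<or> P3_free E Y"
  then show "polar_on E 1 \<infinity> (insert u Y)"
  proof
    assume "polar_on E 1 (enat 1) Y"
    then have "polar_on E 1 (enat 1) ({u} \<union> Y)"
      using polar_on_1_1_join_iff[OF assms] clique_set_singleton by blast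
    then show ?thesis using polar_on_1_imp_monopolar by simp
  next
    assume "P3_free E Y"
    then show ?thesis
      using polar_on_1I[OF indep_set_singleton[of u], of \<infinity> Y] by (simp add: cluster_on_infty)
  qed
qed

lemma monopolar_critical_cone:
  assumes u: "complete_to E {u} Y" and "P3_residual E 2 Y" "polar_on E 1 (enat 2) Y" "\<not> P3_free E Y"
  shows "monopolar_critical (insert u Y)"
proof -
  have Y: "\<not> polar_on E 1 (enat 1) Y" "polar_on E \<infinity> (enat 1) Y"
    and del: "\<And>v. v \<in> Y \<Longrightarrow> polar_on E 1 (enat 1) (Y - {v}) \<or> cluster_on E (enat 2) (Y - {v})"
    using assms(2) unfolding P3_residual_def by auto
  have "polar_on E 1 (enat 2) (insert u Y - {v})" if v: "v \<in> insert u Y" for v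
  proof (cases "v = u")
    case True
    then have "insert u Y - {v} \<subseteq> Y" by blast
    then show ?thesis using polar_on_mono[OF assms(3)] by blast
  next
    case False
    then have eq: "insert u Y - {v} = insert u (Y - {v})" and vY: "v \<in> Y" using v by blast+
    have cone: "complete_to E {u} (Y - {v})" using complete_to_subset[OF u] by blast
    from del[OF vY] show ?thesis
    proof
      assume "polar_on E 1 (enat 1) (Y - {v})"
      then have "polar_on E 1 (enat 1) ({u} \<union> (Y - {v}))"
        using polar_on_1_1_join_iff[OF cone] clique_set_singleton by blast
      then show ?thesis unfolding eq using polar_on_1_enat_mono[of 1 _ 2] by simp
    next
      assume "cluster_on E (enat 2) (Y - {v})"
      then show ?thesis unfolding eq by (rule polar_on_1I[OF indep_set_singleton]) blast
    qed
  qed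
  moreover have "polar_on E \<infinity> (enat 1) (insert u Y)"
  proof -
    obtain A where A: "A \<subseteq> Y" "complete_multipartite E A" "cluster_on E (enat 1) (Y - A)"
      using Y(2) unfolding polar_on_infty_iff by blast
    have "complete_multipartite E ({u} \<union> A)"
      using complete_to_subset[OF u subset_refl A(1)]
        complete_multipartite_clique[OF clique_set_singleton] A(2)
      by (rule complete_multipartite_join)
    then show ?thesis using A(3) by (rule polar_on_inftyI) blast
  qed
  ultimately show ?thesis
    unfolding monopolar_critical_def using monopolar_cone_iff[OF u] Y(1) assms(4) by blast
qed

lemma P3_residual_C4:
  assumes "induced_C4 E a b c d"
  shows "P3_residual E 2 {a, b, c, d}" "polar_on E 1 (enat 2) {a, b, c, d}" "\<not> P3_free E {a, b, c, d}"
proof -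
  have ne: "a \<noteq> c" "b \<noteq> d" and join: "complete_to E {a, c} {b, d}"
    and ac: "indep_set E {a, c}" and bd: "indep_set E {b, d}"
    using assms unfolding induced_C4_def indep_set_doubleton_iff by blast+
  have adj: "E a b" "E a d" "E c b" "E c d" using join unfolding complete_to_def by auto
  show polar: "polar_on E 1 (enat 2) {a, b, c, d}"
    using cluster_on_indep_iff[OF _ bd, of 2] ne(2) by (intro polar_on_1I[OF ac, of _ "{b, d}"]) auto
  have P3: "induced_P3 E a b c"
    using adj ne(1) ac adj_sym unfolding induced_P3_def indep_set_doubleton_iff by blast
  then show "\<not> P3_free E {a, b, c, d}" unfolding P3_free_def by blast
  have "polar_on E 1 (enat 1) ({a, b, c, d} - {v})" if v: "v \<in> {a, b, c, d}" for v
  proof -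
    consider "v \<in> {a, c}" | "v \<in> {b, d}" using v by blast
    then show ?thesis
    proof cases
      case 1
      then have "clique_set E ({a, c} - {v})" unfolding clique_set_def by auto
      then show ?thesis by (rule polar_on_1_1I[OF bd]) auto
    next
      case 2
      then have "clique_set E ({b, d} - {v})" unfolding clique_set_def by auto
      then show ?thesis by (rule polar_on_1_1I[OF ac]) auto
    qed
  qed
  moreover have "polar_on E \<infinity> (enat 1) {a, b, c, d}"
  proof -
    have "complete_multipartite E ({a, c} \<union> {b, d})"
      using complete_multipartite_join[OF join] complete_multipartite_indep ac bd by blast
    moreover have "{a, c} \<union> {b, d} = {a, b, c, d}" by blast
    ultimately show ?thesis using polar_on_infty_complete_multipartite by metis
  qed
  ultimately show "P3_residual E 2 {a, b, c, d}"
    unfolding P3_residual_def using not_polar_on_1_1_C4[OF assms] not_cluster_on_P3[OF P3] polar by auto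
qed

lemma contains_P3_K2_or_butterfly:
  assumes "finite V" "P4_free E V" "induced_2K2 E a b c d" "{a, b, c, d} \<subseteq> V" "\<not> P3_free E V"
  shows "(\<exists>D Y. Y \<subseteq> V \<and> induces_P3 E D \<and> plus_matching E 1 D Y) \<or> (\<exists>Y\<subseteq>V. induces_butterfly E Y)"
proof -
  obtain p q r where P3: "induced_P3 E p q r" "{p, q, r} \<subseteq> V"
    using assms(5) unfolding P3_free_def by blast
  obtain D where D: "p \<in> D" "D \<subseteq> V" "connected_on E D" "anticomplete E D (V - D)"
    using connected_component_containing[OF assms(1)] P3(2) by blast
  have closed: "y \<in> D" if "x \<in> D" "E x y" "y \<in> V" for x y using anticompleteD[OF D(4)] that by blast
  have pqr: "{p, q, r} \<subseteq> D"
    using closed[of p q] closed[of q r] D(1) P3 unfolding induced_P3_def by blast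
  have K: "E a b" "E c d" and anti: "anticomplete E {a, b} {c, d}"
    using assms(3) unfolding induced_2K2_def by blast+
  show ?thesis
  proof (cases "\<exists>x\<in>V - D. \<exists>y\<in>V. E x y")
    case True
    then obtain x y where xy: "x \<in> V - D" "y \<in> V" "E x y" by blast
    then have y: "y \<in> V - D" using closed[of y x] adj_sym by blast
    have "anticomplete E {x, y} {p, q, r}"
      using anticomplete_subset[OF anticomplete_sym[OF D(4)], of "{x, y}"] xy(1) y pqr by blast
    then have "plus_matching E 1 {p, q, r} ({x, y} \<union> {p, q, r})"
      using induced_matching_1[OF xy(3)] unfolding plus_matching_def by blast
    moreover have "{x, y} \<union> {p, q, r} \<subseteq> V" using xy y P3(2) by blast
    ultimately show ?thesis using P3(1) unfolding induces_P3_def by blast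
  next
    case False
    then have abcd: "{a, b, c, d} \<subseteq> D" using K assms(4) adj_sym by blast
    have "\<not> clique_set E D" using pqr P3(1) unfolding clique_set_def induced_P3_def by blast
    then obtain X Y where XY: "X \<union> Y = D" "X \<noteq> {}" "Y \<noteq> {}" "complete_to E X Y"
      using connected_P4_free_join[OF finite_subset[OF D(2) assms(1)]
          P4_free_subset[OF assms(2) D(2)] D(3)] by blast
    have same: "x \<in> X \<longleftrightarrow> y \<in> X" if "\<not> E x y" "x \<in> D" "y \<in> D" for x y
      using complete_toD[OF XY(4)] that XY(1) by blast
    have "{a, b, c, d} \<subseteq> X \<or> {a, b, c, d} \<subseteq> Y"
      using same[of a c] same[of a d] same[of b c] anticompleteD[OF anti] abcd XY(1) by blast
    then obtain v where "v \<in> D" "complete_to E {v} {a, b, c, d}"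
      using XY complete_to_subset[OF XY(4)] complete_to_subset[OF complete_to_sym[OF XY(4)]]
      by (metis Un_iff bot.extremum ex_in_conv insert_subset)
    then show ?thesis
      using induced_matching_2K2[OF assms(3)] assms(4) D(2) unfolding induces_butterfly_def
      by (intro disjI2 exI[of _ "insert v {a, b, c, d}"]) auto
  qed
qed

lemma contains_P3_residual_2:
  assumes "finite V" "P4_free E V" "\<not> polar_on E 1 (enat 1) V" "\<not> P3_free E V"
  shows "\<exists>Y\<subseteq>V. P3_residual E 2 Y \<and> polar_on E 1 (enat 2) Y \<and> \<not> P3_free E Y"
proof -
  obtain a b c d where abcd: "{a, b, c, d} \<subseteq> V" "induced_C4 E a b c d \<or> induced_2K2 E a b c d"
    using P4_free_split[OF assms(1,2)] assms(3) by blast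
  from abcd(2) show ?thesis
  proof
    assume "induced_C4 E a b c d"
    from P3_residual_C4[OF this] show ?thesis using abcd(1) by blast
  next
    assume "induced_2K2 E a b c d"
    from contains_P3_K2_or_butterfly[OF assms(1,2) this abcd(1) assms(4)] show ?thesis
    proof (elim disjE exE conjE)
      fix D Y assume Y: "Y \<subseteq> V" "induces_P3 E D" "plus_matching E 1 D Y"
      have fin: "finite D" using Y(2) unfolding induces_P3_def by auto
      have "P3_residual E (1 + 1) Y"
        using P3_residual_plus_matching[OF _ finite_subset[OF Y(1) assms(1)]
            P3_residual_P3[OF Y(2)] Y(3)] by simp
      moreover have "polar_on E 1 (enat (1 + 1)) Y"
        using polar_on_1_plus_matching_iff[OF Y(3) fin] P3_residual_P3(2)[OF Y(2)] by blast
      moreover have "D \<subseteq> Y" using Y(3) unfolding plus_matching_def by blast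
      then have "\<not> P3_free E Y" using Y(2) unfolding induces_P3_def P3_free_def by blast
      ultimately show ?thesis using Y(1) unfolding one_add_one by blast
    next
      fix Y assume Y: "Y \<subseteq> V" "induces_butterfly E Y"
      have "\<not> P3_free E Y"
        using not_cluster_on_butterfly[OF Y(2) subset_refl, of \<infinity>] cluster_on_infty by blast
      then show ?thesis using P3_residual_butterfly[OF Y(2)] Y(1) by blast
    qed
  qed
qed

lemma universal_vertex_contains_critical:
  assumes "finite H" "P4_free E H" "\<not> polar_on E 1 \<infinity> H" "u \<in> H" "complete_to E {u} (H - {u})"
  shows "\<exists>S\<subseteq>H. monopolar_critical S"
proof -
  have "insert u (H - {u}) = H" using assms(4) by blast
  then have "\<not> polar_on E 1 (enat 1) (H - {u})" "\<not> P3_free E (H - {u})"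
    using monopolar_cone_iff[OF assms(5)] assms(3) by auto
  then obtain Y where Y: "Y \<subseteq> H - {u}" "P3_residual E 2 Y" "polar_on E 1 (enat 2) Y" "\<not> P3_free E Y"
    using contains_P3_residual_2[OF finite_Diff[OF assms(1)] P4_free_subset[OF assms(2) Diff_subset]]
    by blast
  have "monopolar_critical (insert u Y)"
    using monopolar_critical_cone[OF complete_to_subset[OF assms(5) subset_refl Y(1)] Y(2-4)] .
  then show ?thesis using Y(1) assms(4) by blast
qed

lemma join_P3_contains_critical:
  assumes "complete_to E X Y" "\<not> P3_free E X" "\<not> clique_set E Y"
  shows "\<exists>S\<subseteq>X \<union> Y. monopolar_critical S"
proof -
  obtain a b c where P3: "{a, b, c} \<subseteq> X" "induced_P3 E a b c"
    using assms(2) unfolding P3_free_def by blast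
  obtain p q where pq: "{p, q} \<subseteq> Y" "p \<noteq> q" "\<not> E p q" using assms(3) unfolding clique_set_def by blast
  have ac_pq: "complete_to E {a, c} {p, q}" and b_pq: "complete_to E {b} {p, q}"
    using P3(1) pq(1) by (auto intro: complete_to_subset[OF assms(1)])
  have C4: "induced_C4 E a p c q"
    using P3(2) pq(2,3) ac_pq unfolding induced_P3_def induced_C4_def by blast
  have "complete_to E {b} {a, p, c, q}"
    using P3(2) b_pq adj_sym adj_irrefl unfolding induced_P3_def complete_to_def by blast
  then have "monopolar_critical (insert b {a, p, c, q})"
    using P3_residual_C4[OF C4] by (rule monopolar_critical_cone)
  moreover have "insert b {a, p, c, q} \<subseteq> X \<union> Y" using P3(1) pq(1) by blast
  ultimately show ?thesis by blast
qed

lemma induced_K1_K2_polarity: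
  assumes "induced_K1_K2 x y z"
  shows "\<not> clique_set E {x, y, z}" "\<not> indep_set E {x, y, z}" "polar_on E 1 (enat 1) {x, y, z}"
    and "cluster_on E (enat 2) {x, y, z}"
    and "v \<in> {x, y, z} \<Longrightarrow> clique_set E ({x, y, z} - {v}) \<or> indep_set E ({x, y, z} - {v})"
proof -
  have yz: "E y z" "E z y" "y \<noteq> z" and anti: "anticomplete E {x} {y, z}"
    using assms adj_sym adj_irrefl unfolding induced_K1_K2_def by blast+
  then have x: "\<not> E x y" "\<not> E x z" "x \<noteq> y" "x \<noteq> z" unfolding anticomplete_def by auto
  show "\<not> clique_set E {x, y, z}" "\<not> indep_set E {x, y, z}"
    using x yz(1) unfolding clique_set_def indep_set_def by auto
  have xy: "indep_set E {x, y}" and xz: "indep_set E {x, z}" using x indep_set_doubleton_iff by blast+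
  show "polar_on E 1 (enat 1) {x, y, z}" by (rule polar_on_1_1I[OF xy clique_set_singleton[of z]]) blast
  have "cluster_on E (enat (1 + 1)) ({x} \<union> {y, z})"
    using cluster_on_Un[OF anti, of 1 1] cluster_on_1_iff clique_set_singleton clique_set_edge[OF yz(1)]
    by blast
  then show "cluster_on E (enat 2) {x, y, z}" unfolding one_add_one by (simp add: insert_commute)
  have "{x, y, z} - {x} = {y, z}" "{x, y, z} - {y} = {x, z}" "{x, y, z} - {z} = {x, y}"
    using x yz(3) by auto
  then have "clique_set E ({x, y, z} - {x})" "indep_set E ({x, y, z} - {y})"
    "indep_set E ({x, y, z} - {z})"
    using clique_set_edge[OF yz(1)] xy xz by simp_all
  then show "clique_set E ({x, y, z} - {v}) \<or> indep_set E ({x, y, z} - {v})" if "v \<in> {x, y, z}"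
    using that by blast
qed

lemma K1_K2_join_deletion:
  assumes K: "induced_K1_K2 x y z" and K': "induced_K1_K2 x' y' z'"
    and join: "complete_to E {x, y, z} {x', y', z'}" and v: "v \<in> {x, y, z}"
  shows "polar_on E 1 (enat 2) ({x, y, z} \<union> {x', y', z'} - {v})"
proof -
  have eq: "{x, y, z} \<union> {x', y', z'} - {v} = ({x, y, z} - {v}) \<union> {x', y', z'}"
    using join v unfolding complete_to_def by blast
  have sub: "complete_to E ({x, y, z} - {v}) {x', y', z'}"
    using complete_to_subset[OF join Diff_subset subset_refl] .
  from induced_K1_K2_polarity(5)[OF K v] show ?thesis
  proof
    assume "clique_set E ({x, y, z} - {v})"
    then have "polar_on E 1 (enat 1) (({x, y, z} - {v}) \<union> {x', y', z'})"
      using polar_on_1_1_join_iff[OF sub] induced_K1_K2_polarity(3)[OF K'] by blast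
    then show ?thesis unfolding eq by (rule polar_on_1_enat_mono) simp
  next
    assume "indep_set E ({x, y, z} - {v})"
    then show ?thesis unfolding eq using induced_K1_K2_polarity(4)[OF K'] by (rule polar_on_1I) blast
  qed
qed

lemma monopolar_critical_K1_K2_join:
  assumes K: "induced_K1_K2 x y z" and K': "induced_K1_K2 x' y' z'"
    and join: "complete_to E {x, y, z} {x', y', z'}"
  shows "monopolar_critical ({x, y, z} \<union> {x', y', z'})"
proof -
  have "\<not> polar_on E 1 \<infinity> ({x, y, z} \<union> {x', y', z'})"
    using polar_on_1_join_iff[OF join, of \<infinity>] polar_on_1_1_join_iff[OF join]
      induced_K1_K2_polarity(1,2)[OF K] induced_K1_K2_polarity(1,2)[OF K'] by simp
  moreover have "polar_on E \<infinity> (enat 1) ({x, y, z} \<union> {x', y', z'})"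
  proof -
    have yz: "E y z" "E y' z'" using K K' unfolding induced_K1_K2_def by blast+
    have "complete_to E {x'} {y, z}" by (rule complete_to_subset[OF complete_to_sym[OF join]]) auto
    moreover have "complete_to E {x} {y', z'}" by (rule complete_to_subset[OF join]) auto
    ultimately have "clique_set E ({x'} \<union> {y, z})" "clique_set E ({x} \<union> {y', z'})"
      using clique_set_join_iff[of "{x'}" "{y, z}"] clique_set_join_iff[of "{x}" "{y', z'}"]
        clique_set_singleton clique_set_edge yz by blast+
    then have "complete_multipartite E ({x'} \<union> {y, z})" "cluster_on E (enat 1) ({x} \<union> {y', z'})"
      using complete_multipartite_clique cluster_on_1_iff by blast+
    then show ?thesis by (rule polar_on_inftyI) auto
  qed
  moreover have "polar_on E 1 (enat 2) ({x, y, z} \<union> {x', y', z'} - {v})"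
    if "v \<in> {x, y, z} \<union> {x', y', z'}" for v
    using that K1_K2_join_deletion[OF K K' join] K1_K2_join_deletion[OF K' K complete_to_sym[OF join]]
    unfolding Un_commute[of "{x', y', z'}"] by blast
  ultimately show ?thesis unfolding monopolar_critical_def by blast
qed

lemma P3_free_contains_K1_K2:
  assumes "P3_free E V" "\<not> clique_set E V" "\<not> indep_set E V"
  obtains x y z where "{x, y, z} \<subseteq> V" "induced_K1_K2 x y z"
proof -
  obtain y z where yz: "y \<in> V" "z \<in> V" "E y z" using assms(3) unfolding indep_set_def by blast
  obtain K where K: "y \<in> K" "K \<subseteq> V" "clique_set E K" "anticomplete E K (V - K)"
    using P3_free_component[OF assms(1) yz(1)] .
  have "z \<in> K" using anticompleteD[OF K(4,1)] yz by blast
  moreover have "K \<noteq> V" using K(3) assms(2) by blast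
  then obtain x where "x \<in> V - K" using K(2) by blast
  ultimately have "anticomplete E {x} {y, z}"
    using K(1) by (intro anticomplete_subset[OF anticomplete_sym[OF K(4)]]) auto
  then show ?thesis using that yz \<open>x \<in> V - K\<close> unfolding induced_K1_K2_def by blast
qed

lemma join_contains_critical:
  assumes "finite H" "P4_free E H" "\<not> polar_on E 1 \<infinity> H"
    and XY: "X \<union> Y = H" "X \<noteq> {}" "complete_to E X Y" and "\<not> clique_set E Y \<or> clique_set E X"
  shows "\<exists>S\<subseteq>H. monopolar_critical S"
proof (cases "clique_set E X")
  case True
  obtain u where u: "u \<in> X" using XY(2) by blast
  have "E u y" if "y \<in> H - {u}" for y
    using that u True complete_toD[OF XY(3) u, of y] XY(1) by (auto simp: clique_set_def)
  then have "complete_to E {u} (H - {u})" unfolding complete_to_def by blast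
  then show ?thesis using universal_vertex_contains_critical[OF assms(1-3)] u XY(1) by blast
next
  case False
  then have cliques: "\<not> clique_set E X" "\<not> clique_set E Y" using assms(7) by blast+
  show ?thesis
  proof (cases "P3_free E X \<and> P3_free E Y")
    case True
    then have "\<not> indep_set E X" "\<not> indep_set E Y"
      using assms(3) XY(1) polar_on_1I[of X \<infinity> Y H] polar_on_1I[of Y \<infinity> X H]
      by (auto simp: cluster_on_infty)
    then obtain x y z x' y' z' where K: "{x, y, z} \<subseteq> X" "induced_K1_K2 x y z"
      and K': "{x', y', z'} \<subseteq> Y" "induced_K1_K2 x' y' z'"
      using P3_free_contains_K1_K2[of X] P3_free_contains_K1_K2[of Y] True cliques by metis
    have "monopolar_critical ({x, y, z} \<union> {x', y', z'})"
      using monopolar_critical_K1_K2_join[OF K(2) K'(2) complete_to_subset[OF XY(3) K(1) K'(1)]] .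
    moreover have "{x, y, z} \<union> {x', y', z'} \<subseteq> H" using K(1) K'(1) XY(1) by blast
    ultimately show ?thesis by blast
  next
    case False
    then show ?thesis
      using join_P3_contains_critical[OF XY(3)] join_P3_contains_critical[OF complete_to_sym[OF XY(3)]]
        cliques
      unfolding XY(1) Un_commute[of Y] by blast
  qed
qed

lemma monopolar_Un:
  assumes "anticomplete E X Y" "polar_on E 1 \<infinity> X" "polar_on E 1 \<infinity> Y"
  shows "polar_on E 1 \<infinity> (X \<union> Y)"
proof -
  obtain A where A: "A \<subseteq> X" "indep_set E A" "P3_free E (X - A)"
    using assms(2) unfolding polar_on_1_iff cluster_on_infty by blast
  obtain B where B: "B \<subseteq> Y" "indep_set E B" "P3_free E (Y - B)"
    using assms(3) unfolding polar_on_1_iff cluster_on_infty by blast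
  have "P3_free E ((X - A) \<union> (Y - B))"
    using P3_free_Un[OF anticomplete_subset[OF assms(1) Diff_subset Diff_subset] A(3) B(3)] .
  then show ?thesis
    using indep_set_Un[OF assms(1) A(2) B(2) A(1) B(1)]
    by (intro polar_on_1I[of "A \<union> B" _ "(X - A) \<union> (Y - B)"]) (auto simp: cluster_on_infty)
qed

text \<open>The sets found here induce \<open>K\<^sub>1 \<oplus> C\<^sub>4\<close>, \<open>K\<^sub>1 \<oplus> (P\<^sub>3 + K\<^sub>2)\<close>, \<open>K\<^sub>2 \<oplus> 2K\<^sub>2\<close> or
  \<open>(K\<^sub>1 + K\<^sub>2) \<oplus> (K\<^sub>1 + K\<^sub>2)\<close>.\<close>
theorem nonmonopolar_contains_critical:
  assumes "finite H" "P4_free E H" "\<not> polar_on E 1 \<infinity> H"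
  shows "\<exists>S\<subseteq>H. monopolar_critical S"
  using assms
proof (induction H rule: finite_psubset_induct)
  case (psubset H)
  have "\<not> clique_set E H"
    using psubset.prems(2) polar_on_1_1I[OF indep_set_empty] polar_on_1_imp_monopolar by blast
  then obtain x y where "x \<in> H" "y \<in> H" "x \<noteq> y" unfolding clique_set_def by blast
  then have "decomposable E H" using P4_free_decomposable psubset.hyps psubset.prems(1) by blast
  then obtain X Y where XY: "X \<union> Y = H" "X \<noteq> {}" "Y \<noteq> {}" "anticomplete E X Y \<or> complete_to E X Y"
    unfolding decomposable_def by blast
  from XY(4) show ?case
  proof
    assume anti: "anticomplete E X Y"
    then have sub: "X \<subset> H" "Y \<subset> H" using XY unfolding anticomplete_def by blast+
    have "\<not> polar_on E 1 \<infinity> X \<or> \<not> polar_on E 1 \<infinity> Y"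
      using monopolar_Un[OF anti] psubset.prems(2) XY(1) by blast
    then show ?thesis
      using psubset.IH sub P4_free_subset[OF psubset.prems(1)] by (meson order.trans psubset_imp_subset)
  next
    assume "complete_to E X Y"
    then show ?thesis
      using join_contains_critical[OF psubset.hyps psubset.prems, of X Y]
        join_contains_critical[OF psubset.hyps psubset.prems, of Y X] XY(1-3) complete_to_sym by blast
  qed
qed

lemma P3_residual_monopolar_obstruction:
  assumes "3 \<le> k" "finite H" "P4_free E H" and obs: "min_polar_obstruction_on E 1 \<infinity> H"
  shows "P3_residual E k H"
proof -
  obtain S where S: "S \<subseteq> H" "monopolar_critical S"
    using nonmonopolar_contains_critical[OF assms(2,3)] obs
    unfolding min_polar_obstruction_on_def by blast
  then have "S = H" using min_polar_obstruction_on_eq[OF obs] unfolding monopolar_critical_def by blast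
  then have H: "\<not> polar_on E 1 \<infinity> H" "polar_on E \<infinity> (enat 1) H"
    "\<And>v. v \<in> H \<Longrightarrow> polar_on E 1 (enat 2) (H - {v})"
    using S(2) unfolding monopolar_critical_def by blast+
  have "\<not> polar_on E 1 (enat i) H" for i using H(1) polar_on_1_imp_monopolar by blast
  moreover from this have "\<not> cluster_on E (enat k) H" using polar_on_cluster by blast
  moreover have "polar_on E 1 (enat (k - 1)) (H - {v})" if "v \<in> H" for v
    using polar_on_1_enat_mono[OF H(3)[OF that]] assms(1) by simp
  moreover have "polar_on E \<infinity> (enat i) H" if "1 \<le> i" for i
    using polar_on_mono[OF H(2) subset_refl order_refl] that by simp
  then have "polar_on E \<infinity> (enat (k - 1)) H" "polar_on E \<infinity> (enat (k - 2)) H" using assms(1) by simp_all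
  ultimately show ?thesis unfolding P3_residual_def by blast
qed

theorem P3_residual_iff:
  assumes k: "2 \<le> k" and "finite H" "P4_free E H"
  shows "P3_residual E k H \<longleftrightarrow>
    (\<exists>D. induces_P3 E D \<and> plus_matching E (k - 1) D H)
    \<or> (\<exists>D. induces_butterfly E D \<and> plus_matching E (k - 2) D H)
    \<or> (\<exists>j\<in>{1..k - 1}. \<exists>D. plus_matching E (k - j - 1) D H \<and> connected_on E D
        \<and> min_polar_obstruction_on E 1 (enat j) D \<and> \<not> min_polar_obstruction_on E 1 \<infinity> D)
    \<or> 3 \<le> k \<and> min_polar_obstruction_on E 1 \<infinity> H"
  (is "_ \<longleftrightarrow> ?alternatives")
proof
  assume res: "P3_residual E k H"
  show ?alternatives
  proof (cases "\<forall>v\<in>H. polar_on E 1 (enat (k - 1)) (H - {v})")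
    case True
    then show ?thesis
      using P3_residual_nonmonopolar[OF assms res] P3_residual_monopolar[OF assms(1,2) res] by blast
  next
    case False
    then obtain v where "v \<in> H" "\<not> polar_on E 1 (enat (k - 1)) (H - {v})"
      "cluster_on E (enat k) (H - {v})"
      using res unfolding P3_residual_def by blast
    then show ?thesis using P3_residual_cluster_deletion[OF assms res] by blast
  qed
next
  note plus = P3_residual_plus_matching[OF _ assms(2)]
  assume ?alternatives
  then show "P3_residual E k H"
  proof (elim disjE exE bexE conjE)
    fix D assume "induces_P3 E D" "plus_matching E (k - 1) D H"
    then show ?thesis using plus[of 1 D "k - 1"] P3_residual_P3[of D] k by simp
  next
    fix D assume "induces_butterfly E D" "plus_matching E (k - 2) D H"
    then show ?thesis
      using plus[of 2 D "k - 2", unfolded le_add_diff_inverse2[OF k]] P3_residual_butterfly[of D] by simp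
  next
    fix j D assume j: "j \<in> {1..k - 1}" and D: "plus_matching E (k - j - 1) D H" "connected_on E D"
      "min_polar_obstruction_on E 1 (enat j) D" "\<not> min_polar_obstruction_on E 1 \<infinity> D"
    have "D \<subseteq> H" using D(1) unfolding plus_matching_def by blast
    then have "finite D" "P4_free E D" using finite_subset assms(2,3) P4_free_subset by blast+
    then show ?thesis
      using P3_residual_connected_obstruction[of D j] connected_obstruction_polar(1)[of D j] D j
        plus[of "Suc j" D "k - j - 1"] by auto
  next
    assume "3 \<le> k" "min_polar_obstruction_on E 1 \<infinity> H"
    then show ?thesis using P3_residual_monopolar_obstruction assms(2,3) by blast
  qed
qed

end

section \<open>Isomorphism invariance\<close>

definition graph_embedding :: "('a \<Rightarrow> 'a \<Rightarrow> bool) \<Rightarrow> 'a set \<Rightarrow> ('b \<Rightarrow> 'b \<Rightarrow> bool) \<Rightarrow> ('a \<Rightarrow> 'b) \<Rightarrow> bool" where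
  "graph_embedding E V E' f \<longleftrightarrow> inj_on f V \<and> (\<forall>x\<in>V. \<forall>y\<in>V. E' (f x) (f y) \<longleftrightarrow> E x y)"

definition isomorphic_on :: "('a \<Rightarrow> 'a \<Rightarrow> bool) \<Rightarrow> 'a set \<Rightarrow> ('b \<Rightarrow> 'b \<Rightarrow> bool) \<Rightarrow> 'b set \<Rightarrow> bool" where
  "isomorphic_on E V E' V' \<longleftrightarrow> (\<exists>f. graph_embedding E V E' f \<and> f ` V = V')"

lemma graph_embedding_adj: "graph_embedding E V E' f \<Longrightarrow> x \<in> V \<Longrightarrow> y \<in> V \<Longrightarrow> E' (f x) (f y) \<longleftrightarrow> E x y"
  unfolding graph_embedding_def by blast

lemma graph_embedding_eq_iff: "graph_embedding E V E' f \<Longrightarrow> x \<in> V \<Longrightarrow> y \<in> V \<Longrightarrow> f x = f y \<longleftrightarrow> x = y"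
  unfolding graph_embedding_def by (auto dest: inj_onD)

lemma graph_embedding_subset: "graph_embedding E V E' f \<Longrightarrow> W \<subseteq> V \<Longrightarrow> graph_embedding E W E' f"
  unfolding graph_embedding_def using inj_on_subset by blast

lemma graph_embedding_complement:
  "graph_embedding E V E' f \<Longrightarrow> graph_embedding (complement E) V (complement E') f"
  unfolding graph_embedding_def complement_def by (auto dest: inj_onD)

lemma graph_embedding_inv:
  assumes "graph_embedding E V E' f" shows "graph_embedding E' (f ` V) E (inv_into V f)"
  using assms inj_on_inv_into[of "f ` V" f V] unfolding graph_embedding_def by auto

lemma graph_embedding_inv_image: "graph_embedding E V E' f \<Longrightarrow> inv_into V f ` f ` V = V"
  unfolding graph_embedding_def by simp

lemma graph_embedding_comp:
  "graph_embedding E V E' f \<Longrightarrow> graph_embedding E' (f ` V) E'' g \<Longrightarrow> graph_embedding E V E'' (g \<circ> f)"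
  unfolding graph_embedding_def by (simp add: comp_inj_on)

lemma graph_embedding_Diff: "graph_embedding E V E' f \<Longrightarrow> A \<subseteq> V \<Longrightarrow> f ` V - f ` A = f ` (V - A)"
  unfolding graph_embedding_def by (metis Diff_subset inj_on_image_set_diff)

lemma graph_embedding_indep_set:
  "graph_embedding E V E' f \<Longrightarrow> indep_set E' (f ` V) \<longleftrightarrow> indep_set E V"
  unfolding indep_set_def by (simp add: graph_embedding_adj)

lemma graph_embedding_P3_free:
  "graph_embedding E V E' f \<Longrightarrow> P3_free E' (f ` V) \<longleftrightarrow> P3_free E V"
  unfolding P3_free_def induced_P3_def by (simp add: graph_embedding_adj graph_embedding_eq_iff)

lemma graph_embedding_P4_free:
  "graph_embedding E V E' f \<Longrightarrow> P4_free E' (f ` V) \<longleftrightarrow> P4_free E V"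
  unfolding P4_free_def by (simp add: graph_embedding_adj)

lemma graph_embedding_cluster_on_image:
  assumes f: "graph_embedding E V E' f" and cl: "cluster_on E k V"
  shows "cluster_on E' k (f ` V)"
proof -
  have "enat (card S) \<le> k" if S: "S \<subseteq> f ` V" "indep_set E' S" for S
  proof -
    obtain T where T: "T \<subseteq> V" "S = f ` T" using S(1) by (auto simp: subset_image_iff)
    have g: "graph_embedding E T E' f" using graph_embedding_subset[OF f T(1)] .
    have "card S = card T" using g unfolding T(2) graph_embedding_def by (simp add: card_image)
    moreover have "indep_set E T" using graph_embedding_indep_set[OF g] S(2) T(2) by blast
    ultimately show ?thesis using cl T(1) unfolding cluster_on_def by simp
  qed
  then show ?thesis using cl graph_embedding_P3_free[OF f] unfolding cluster_on_def by blast
qed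

lemma graph_embedding_cluster_on:
  "graph_embedding E V E' f \<Longrightarrow> cluster_on E' k (f ` V) \<longleftrightarrow> cluster_on E k V"
  using graph_embedding_cluster_on_image graph_embedding_inv graph_embedding_inv_image by metis

lemma graph_embedding_polar_on_image:
  assumes f: "graph_embedding E V E' f" and "polar_on E s k V"
  shows "polar_on E' s k (f ` V)"
proof -
  obtain A where A: "A \<subseteq> V" "cluster_on (complement E) s A" "cluster_on E k (V - A)"
    using assms(2) unfolding polar_on_def by blast
  have "cluster_on (complement E') s (f ` A)"
    using graph_embedding_cluster_on_image[OF
        graph_embedding_complement[OF graph_embedding_subset[OF f A(1)]] A(2)] .
  moreover have "cluster_on E' k (f ` V - f ` A)"
    unfolding graph_embedding_Diff[OF f A(1)]
    using graph_embedding_cluster_on_image[OF graph_embedding_subset[OF f Diff_subset] A(3)] .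
  ultimately show ?thesis using A(1) unfolding polar_on_def by (intro exI[of _ "f ` A"]) auto
qed

lemma graph_embedding_polar_on:
  "graph_embedding E V E' f \<Longrightarrow> polar_on E' s k (f ` V) \<longleftrightarrow> polar_on E s k V"
  using graph_embedding_polar_on_image graph_embedding_inv graph_embedding_inv_image by metis

lemma graph_embedding_delete:
  assumes f: "graph_embedding E V E' f" and "v \<in> V"
  shows "polar_on E' s k (f ` V - {f v}) \<longleftrightarrow> polar_on E s k (V - {v})"
    and "cluster_on E' k (f ` V - {f v}) \<longleftrightarrow> cluster_on E k (V - {v})"
proof -
  have eq: "f ` V - {f v} = f ` (V - {v})" using graph_embedding_Diff[OF f, of "{v}"] assms(2) by simp
  note g = graph_embedding_subset[OF f Diff_subset]
  show "polar_on E' s k (f ` V - {f v}) \<longleftrightarrow> polar_on E s k (V - {v})"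
    "cluster_on E' k (f ` V - {f v}) \<longleftrightarrow> cluster_on E k (V - {v})"
    unfolding eq by (rule graph_embedding_polar_on[OF g], rule graph_embedding_cluster_on[OF g])
qed

lemma graph_embedding_min_polar_obstruction_on:
  "graph_embedding E V E' f \<Longrightarrow>
    min_polar_obstruction_on E' s k (f ` V) \<longleftrightarrow> min_polar_obstruction_on E s k V"
  unfolding min_polar_obstruction_on_iff
  by (simp add: graph_embedding_polar_on graph_embedding_delete(1))

lemma graph_embedding_P3_residual:
  "graph_embedding E V E' f \<Longrightarrow> P3_residual E' k (f ` V) \<longleftrightarrow> P3_residual E k V"
  unfolding P3_residual_def
  by (simp add: graph_embedding_polar_on graph_embedding_cluster_on graph_embedding_delete)

lemma graph_embedding_connected_on_image:
  assumes f: "graph_embedding E V E' f" and conn: "connected_on E V"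
  shows "connected_on E' (f ` V)"
  unfolding connected_on_def
proof (intro conjI allI impI)
  show "f ` V \<noteq> {}" using conn unfolding connected_on_def by simp
  fix X' Y' assume XY: "X' \<union> Y' = f ` V" "anticomplete E' X' Y'"
  define X Y where "X = {x \<in> V. f x \<in> X'}" and "Y = {y \<in> V. f y \<in> Y'}"
  have cover: "X \<union> Y = V" using XY(1) unfolding X_def Y_def by blast
  have "X \<inter> Y = {}" using XY(2) unfolding anticomplete_def X_def Y_def by blast
  moreover have "\<not> E x y" if "x \<in> X" "y \<in> Y" for x y
  proof -
    have "x \<in> V" "f x \<in> X'" "y \<in> V" "f y \<in> Y'" using that unfolding X_def Y_def by auto
    then show ?thesis using XY(2) graph_embedding_adj[OF f, of x y] unfolding anticomplete_def by simp
  qed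
  ultimately have "anticomplete E X Y" unfolding anticomplete_def by blast
  then have "X = {} \<or> Y = {}" using conn cover unfolding connected_on_def by blast
  moreover have "X' \<subseteq> f ` V" "Y' \<subseteq> f ` V" using XY(1) by blast+
  then have "X' \<subseteq> f ` X" "Y' \<subseteq> f ` Y" unfolding X_def Y_def by blast+
  ultimately show "X' = {} \<or> Y' = {}" by blast
qed

lemma isomorphic_onE:
  assumes "isomorphic_on E V E' V'"
  obtains f where "graph_embedding E V E' f" "f ` V = V'"
  using assms unfolding isomorphic_on_def by blast

lemma isomorphic_on_sym: "isomorphic_on E V E' V' \<Longrightarrow> isomorphic_on E' V' E V"
  unfolding isomorphic_on_def using graph_embedding_inv graph_embedding_inv_image by metis

lemma isomorphic_on_trans:
  "isomorphic_on E V E' V' \<Longrightarrow> isomorphic_on E' V' E'' V'' \<Longrightarrow> isomorphic_on E V E'' V''"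
  unfolding isomorphic_on_def using graph_embedding_comp by (metis image_comp)

lemma isomorphic_on_P4_free: "isomorphic_on E V E' V' \<Longrightarrow> P4_free E' V' \<longleftrightarrow> P4_free E V"
  by (elim isomorphic_onE) (metis graph_embedding_P4_free)

lemma isomorphic_on_P3_residual: "isomorphic_on E V E' V' \<Longrightarrow> P3_residual E' k V' \<longleftrightarrow> P3_residual E k V"
  by (elim isomorphic_onE) (metis graph_embedding_P3_residual)

lemma isomorphic_on_min_polar_obstruction_on:
  "isomorphic_on E V E' V' \<Longrightarrow> min_polar_obstruction_on E' s k V' \<longleftrightarrow> min_polar_obstruction_on E s k V"
  by (elim isomorphic_onE) (metis graph_embedding_min_polar_obstruction_on)

lemma isomorphic_on_connected_on: "isomorphic_on E V E' V' \<Longrightarrow> connected_on E' V' \<longleftrightarrow> connected_on E V"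
  using graph_embedding_connected_on_image isomorphic_onE isomorphic_on_sym by metis

lemma isomorphic_on_lessThan_iff:
  "isomorphic_on F {..<n} E X \<longleftrightarrow>
    (\<exists>xs. length xs = n \<and> distinct xs \<and> set xs = X \<and> (\<forall>i<n. \<forall>j<n. E (xs ! i) (xs ! j) \<longleftrightarrow> F i j))"
proof
  assume "isomorphic_on F {..<n} E X"
  then obtain f where f: "graph_embedding F {..<n} E f" "f ` {..<n} = X" by (rule isomorphic_onE)
  have "distinct (map f [0..<n])" "set (map f [0..<n]) = X"
    using f unfolding graph_embedding_def by (auto simp: distinct_map lessThan_atLeast0)
  then show "\<exists>xs. length xs = n \<and> distinct xs \<and> set xs = X \<and> (\<forall>i<n. \<forall>j<n. E (xs ! i) (xs ! j) \<longleftrightarrow> F i j)"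
    using graph_embedding_adj[OF f(1)] by (intro exI[of _ "map f [0..<n]"]) simp
next
  assume "\<exists>xs. length xs = n \<and> distinct xs \<and> set xs = X \<and> (\<forall>i<n. \<forall>j<n. E (xs ! i) (xs ! j) \<longleftrightarrow> F i j)"
  then obtain xs where xs: "length xs = n" "distinct xs" "set xs = X"
    "\<forall>i<n. \<forall>j<n. E (xs ! i) (xs ! j) \<longleftrightarrow> F i j" by blast
  then have "graph_embedding F {..<n} E ((!) xs)"
    unfolding graph_embedding_def by (simp add: inj_on_nth)
  moreover have "(!) xs ` {..<n} = X" using xs(1,3) by (auto simp: set_conv_nth)
  ultimately show "isomorphic_on F {..<n} E X" unfolding isomorphic_on_def by blast
qed

context simple_graph begin

lemma graph_embedding_case_sum:
  assumes f: "graph_embedding (\<lambda>a a'. S (Inl a) (Inl a')) A E f"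
    and g: "graph_embedding (\<lambda>b b'. S (Inr b) (Inr b')) B E g"
    and fg: "\<And>a b. a \<in> A \<Longrightarrow> b \<in> B \<Longrightarrow> f a \<noteq> g b"
      "\<And>a b. a \<in> A \<Longrightarrow> b \<in> B \<Longrightarrow> E (f a) (g b) \<longleftrightarrow> S (Inl a) (Inr b)"
      "\<And>a b. a \<in> A \<Longrightarrow> b \<in> B \<Longrightarrow> E (g b) (f a) \<longleftrightarrow> S (Inr b) (Inl a)"
  shows "graph_embedding S (A <+> B) E (case_sum f g)"
  unfolding graph_embedding_def
proof (intro conjI inj_onI ballI)
  fix p q assume pq: "p \<in> A <+> B" "q \<in> A <+> B"
  show "p = q" if "case_sum f g p = case_sum f g q"
    using pq that fg(1) fg(1)[symmetric] graph_embedding_eq_iff[OF f] graph_embedding_eq_iff[OF g]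
    by (elim PlusE) simp_all
  show "E (case_sum f g p) (case_sum f g q) \<longleftrightarrow> S p q"
    using pq fg(2,3) graph_embedding_adj[OF f] graph_embedding_adj[OF g] by (elim PlusE) simp_all
qed

lemma isomorphic_on_Plus_iff:
  assumes cross: "\<And>a b. a \<in> A \<Longrightarrow> b \<in> B \<Longrightarrow> (S (Inl a) (Inr b) \<longleftrightarrow> c) \<and> (S (Inr b) (Inl a) \<longleftrightarrow> c)"
  shows "isomorphic_on S (A <+> B) E V \<longleftrightarrow>
    (\<exists>X Y. X \<union> Y = V \<and> X \<inter> Y = {} \<and> (\<forall>x\<in>X. \<forall>y\<in>Y. E x y \<longleftrightarrow> c)
      \<and> isomorphic_on (\<lambda>a a'. S (Inl a) (Inl a')) A E X
      \<and> isomorphic_on (\<lambda>b b'. S (Inr b) (Inr b')) B E Y)"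
  (is "_ \<longleftrightarrow> ?split")
proof
  assume "isomorphic_on S (A <+> B) E V"
  then obtain f where f: "graph_embedding S (A <+> B) E f" "f ` (A <+> B) = V" by (rule isomorphic_onE)
  have "graph_embedding (\<lambda>a a'. S (Inl a) (Inl a')) A E (f \<circ> Inl)"
    "graph_embedding (\<lambda>b b'. S (Inr b) (Inr b')) B E (f \<circ> Inr)"
    using f(1) unfolding graph_embedding_def by (auto simp: inj_on_def)
  then have "isomorphic_on (\<lambda>a a'. S (Inl a) (Inl a')) A E ((f \<circ> Inl) ` A)"
    "isomorphic_on (\<lambda>b b'. S (Inr b) (Inr b')) B E ((f \<circ> Inr) ` B)"
    unfolding isomorphic_on_def by blast+
  moreover have "(f \<circ> Inl) ` A \<union> (f \<circ> Inr) ` B = V"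
    using f(2) unfolding Plus_def by (simp add: image_Un image_comp)
  moreover have "(f \<circ> Inl) ` A \<inter> (f \<circ> Inr) ` B = {}" using graph_embedding_eq_iff[OF f(1)] by auto
  moreover have "\<forall>x\<in>(f \<circ> Inl) ` A. \<forall>y\<in>(f \<circ> Inr) ` B. E x y \<longleftrightarrow> c"
    using graph_embedding_adj[OF f(1)] cross by auto
  ultimately show ?split by blast
next
  assume ?split
  then obtain X Y where XY: "X \<union> Y = V" "X \<inter> Y = {}" "\<And>x y. x \<in> X \<Longrightarrow> y \<in> Y \<Longrightarrow> E x y \<longleftrightarrow> c"
    and iso: "isomorphic_on (\<lambda>a a'. S (Inl a) (Inl a')) A E X"
      "isomorphic_on (\<lambda>b b'. S (Inr b) (Inr b')) B E Y"
    by blast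
  obtain f where f: "graph_embedding (\<lambda>a a'. S (Inl a) (Inl a')) A E f" "f ` A = X"
    using iso(1) by (rule isomorphic_onE)
  obtain g where g: "graph_embedding (\<lambda>b b'. S (Inr b) (Inr b')) B E g" "g ` B = Y"
    using iso(2) by (rule isomorphic_onE)
  have "f a \<noteq> g b" "E (f a) (g b) \<longleftrightarrow> c" "E (g b) (f a) \<longleftrightarrow> c" if "a \<in> A" "b \<in> B" for a b
    using XY(2) XY(3)[of "f a" "g b"] adj_sym[of "f a" "g b"] adj_sym[of "g b" "f a"] f(2) g(2) that
    by blast+
  then have "graph_embedding S (A <+> B) E (case_sum f g)"
    using cross by (intro graph_embedding_case_sum[OF f(1) g(1)]) simp_all
  moreover have "case_sum f g ` (A <+> B) = V"
    using XY(1) f(2) g(2) unfolding Plus_def by (simp add: image_Un image_comp comp_def)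
  ultimately show "isomorphic_on S (A <+> B) E V" unfolding isomorphic_on_def by blast
qed

end

section \<open>Translation from digraphs\<close>

definition pair_adj :: "'a pair_pre_digraph \<Rightarrow> 'a \<Rightarrow> 'a \<Rightarrow> bool" where
  "pair_adj G u v \<longleftrightarrow> (u, v) \<in> parcs G"

definition pair_restrict :: "'a pair_pre_digraph \<Rightarrow> 'a set \<Rightarrow> 'a pair_pre_digraph" where
  "pair_restrict G A = \<lparr> pverts = A, parcs = {(u, v) \<in> parcs G. u \<in> A \<and> v \<in> A} \<rparr>"

definition closed_adjacency :: "('a \<Rightarrow> 'a \<Rightarrow> bool) \<Rightarrow> 'a set \<Rightarrow> 'a rel" where
  "closed_adjacency E V = {(u, v). u \<in> V \<and> v \<in> V \<and> (u = v \<or> E u v)}"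

abbreviation induces_copy :: "'b pair_pre_digraph \<Rightarrow> ('a \<Rightarrow> 'a \<Rightarrow> bool) \<Rightarrow> 'a set \<Rightarrow> bool" where
  "induces_copy K \<equiv> isomorphic_on (pair_adj K) (pverts K)"

lemma with_proj_restrict: "with_proj G \<restriction> A = with_proj (pair_restrict G A)"
  unfolding induce_subgraph_def with_proj_def pair_restrict_def by auto

lemma pverts_pair_restrict [simp]: "pverts (pair_restrict G A) = A"
  by (simp add: pair_restrict_def)

lemma pair_restrict_restrict: "A \<subseteq> W \<Longrightarrow> pair_restrict (pair_restrict G W) A = pair_restrict G A"
  unfolding pair_restrict_def by auto

lemma graph_embedding_restrict: "graph_embedding (pair_adj G) A (pair_adj (pair_restrict G A)) id"
  unfolding graph_embedding_def pair_adj_def pair_restrict_def by auto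

lemma pair_graph_iff:
  "pair_graph G \<longleftrightarrow> finite (pverts G) \<and> simple_graph (pair_adj G) \<and> pair_wf_digraph G"
proof
  assume "pair_graph G"
  then interpret pair_graph G .
  have "simple_graph (pair_adj G)"
    using no_loops' graph_symmetric unfolding pair_adj_def by unfold_locales auto
  then show "finite (pverts G) \<and> simple_graph (pair_adj G) \<and> pair_wf_digraph G"
    using pair_finite_verts pair_wf_digraph_axioms by blast
next
  assume G: "finite (pverts G) \<and> simple_graph (pair_adj G) \<and> pair_wf_digraph G"
  then interpret pair_wf_digraph G by blast
  have "parcs G \<subseteq> pverts G \<times> pverts G" using in_arcsD1 in_arcsD2 by auto
  then have "finite (parcs G)" using G by (meson finite_SigmaI finite_subset)
  moreover have "symmetric (with_proj G)"
    using G unfolding simple_graph_def pair_adj_def symmetric_def by (auto intro: symI)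
  ultimately show "pair_graph G" using G unfolding simple_graph_def pair_adj_def by unfold_locales auto
qed

lemma pair_wf_digraph_restrict: "pair_wf_digraph (pair_restrict G A)"
  by unfold_locales (auto simp: pair_restrict_def)

lemma pair_graph_restrict: "pair_graph G \<Longrightarrow> A \<subseteq> pverts G \<Longrightarrow> pair_graph (pair_restrict G A)"
  unfolding pair_graph_iff using pair_wf_digraph_restrict
  by (auto simp: simple_graph_def pair_adj_def pair_restrict_def intro: finite_subset)

lemma pair_restrict_pverts:
  assumes "pair_graph G" shows "pair_restrict G (pverts G) = G"
proof -
  interpret pair_graph G using assms .
  show ?thesis unfolding pair_restrict_def
    by (intro pair_pre_digraph.equality) (auto dest: in_arcsD1 in_arcsD2)
qed

lemma graph_with_proj:
  assumes "pair_graph G" shows "graph (with_proj G)"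
proof -
  interpret pair_graph G using assms .
  show ?thesis by unfold_locales
qed

lemma induced_subgraph_iff:
  assumes "pair_graph G"
  shows "induced_subgraph H (with_proj G) \<longleftrightarrow> (\<exists>W\<subseteq>pverts G. H = with_proj (pair_restrict G W))"
proof
  interpret pair_graph G using assms .
  show "\<exists>W\<subseteq>pverts G. H = with_proj (pair_restrict G W)" if "induced_subgraph H (with_proj G)"
    using induce_eq_iff_induced[OF that] subgraph_imp_subverts[OF induced_imp_subgraph[OF that]]
      with_proj_restrict[of G] by (metis with_proj_simps(1))
  show "induced_subgraph H (with_proj G)" if "\<exists>W\<subseteq>pverts G. H = with_proj (pair_restrict G W)"
    using that induced_induce with_proj_restrict by metis
qed

subsection \<open>Clusters and complete multipartite graphs\<close>

lemma ex_transversal: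
  assumes "equiv V r"
  obtains S where "S \<subseteq> V" "card S = card (V // r)" "\<And>x y. x \<in> S \<Longrightarrow> y \<in> S \<Longrightarrow> (x, y) \<in> r \<Longrightarrow> x = y"
proof
  define rep where "rep X = (SOME u. u \<in> X)" for X :: "'a set"
  have rep: "rep X \<in> X" if "X \<in> V // r" for X
    using in_quotient_imp_non_empty[OF assms that] unfolding rep_def by (simp add: some_in_eq)
  show sub: "rep ` (V // r) \<subseteq> V" using rep in_quotient_imp_subset[OF assms] by blast
  have class_eq: "X = Y" if "X \<in> V // r" "Y \<in> V // r" "(rep X, rep Y) \<in> r" for X Y
    using quotient_eqI[OF assms] rep that by blast
  have "inj_on rep (V // r)"
    using class_eq sub assms by (intro inj_onI) (metis equivE image_eqI refl_onD subsetD)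
  then show "card (rep ` (V // r)) = card (V // r)" by (rule card_image)
  show "x = y" if "x \<in> rep ` (V // r)" "y \<in> rep ` (V // r)" "(x, y) \<in> r" for x y
    using class_eq that by blast
qed

lemma card_inequivalent_le:
  assumes "finite V" "equiv V r" "S \<subseteq> V" "\<And>x y. x \<in> S \<Longrightarrow> y \<in> S \<Longrightarrow> (x, y) \<in> r \<Longrightarrow> x = y"
  shows "card S \<le> card (V // r)"
proof (rule card_inj_on_le)
  show "inj_on (\<lambda>x. r `` {x}) S" using assms(2-4) by (intro inj_onI) (meson eq_equiv_class subsetD)
  show "(\<lambda>x. r `` {x}) ` S \<subseteq> V // r" using assms(3) by (auto intro: quotientI)
  show "finite (V // r)" using assms(1,2) by (intro finite_quotient) (auto elim: equivE)
qed

context simple_graph begin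

lemma equiv_closed_adjacency_iff: "equiv V (closed_adjacency E V) \<longleftrightarrow> P3_free E V"
proof
  assume "equiv V (closed_adjacency E V)"
  then have "trans (closed_adjacency E V)" by (rule equivE)
  then show "P3_free E V"
    unfolding P3_free_def induced_P3_def closed_adjacency_def trans_def by blast
next
  assume P3: "P3_free E V"
  have "trans (closed_adjacency E V)"
    using P3_freeD[OF P3] unfolding trans_def closed_adjacency_def by blast
  then show "equiv V (closed_adjacency E V)"
    unfolding closed_adjacency_def using adj_sym by (auto intro!: equivI refl_onI symI)
qed

lemma cluster_on_iff_closed_adjacency:
  assumes "finite V"
  shows "cluster_on E k V \<longleftrightarrow>
    equiv V (closed_adjacency E V) \<and> enat (card (V // closed_adjacency E V)) \<le> k"
proof (cases "P3_free E V")
  case True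
  then have eq: "equiv V (closed_adjacency E V)" using equiv_closed_adjacency_iff by blast
  have indep: "indep_set E S \<longleftrightarrow> (\<forall>x\<in>S. \<forall>y\<in>S. (x, y) \<in> closed_adjacency E V \<longrightarrow> x = y)" if "S \<subseteq> V" for S
    using that adj_irrefl unfolding indep_set_def closed_adjacency_def by blast
  obtain S where "S \<subseteq> V" "card S = card (V // closed_adjacency E V)" "indep_set E S"
    using ex_transversal[OF eq] indep by metis
  moreover have "enat (card T) \<le> enat (card (V // closed_adjacency E V))"
    if "T \<subseteq> V" "indep_set E T" for T
    using card_inequivalent_le[OF assms eq that(1)] indep[OF that(1)] that(2) by simp
  ultimately show ?thesis using True eq unfolding cluster_on_def by (metis order.trans)
next
  case False
  then show ?thesis using equiv_closed_adjacency_iff cluster_on_P3_free by blast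
qed

end

lemma complete_multipartite_at_most_iff:
  assumes "pair_graph K"
  shows "complete_multipartite_at_most s (with_proj K) \<longleftrightarrow>
    cluster_on (complement (pair_adj K)) s (pverts K)"
proof -
  have fin: "finite (pverts K)" and sg: "simple_graph (pair_adj K)" using assms pair_graph_iff by blast+
  interpret simple_graph "pair_adj K" by (rule sg)
  interpret co: simple_graph "complement (pair_adj K)" by (rule simple_graph_complement)
  define r where "r = closed_adjacency (complement (pair_adj K)) (pverts K)"
  have r: "(u, v) \<in> r \<longleftrightarrow> u \<in> pverts K \<and> v \<in> pverts K \<and> \<not> pair_adj K u v" for u v
    using adj_irrefl unfolding r_def closed_adjacency_def complement_def by auto
  have same_part: "{(u, v). \<exists>X\<in>P. u \<in> X \<and> v \<in> X} = r"
    if "partition_on (pverts K) P"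
      "\<forall>u\<in>pverts K. \<forall>v\<in>pverts K. pair_adj K u v \<longleftrightarrow> \<not> (\<exists>X\<in>P. u \<in> X \<and> v \<in> X)" for P
    using that partition_onD1[OF that(1)] by (auto simp: r)
  have "(\<exists>P. partition_on (pverts K) P \<and> enat (card P) \<le> s \<and>
      (\<forall>u\<in>pverts K. \<forall>v\<in>pverts K. pair_adj K u v \<longleftrightarrow> \<not> (\<exists>X\<in>P. u \<in> X \<and> v \<in> X)))
    \<longleftrightarrow> equiv (pverts K) r \<and> enat (card (pverts K // r)) \<le> s"
  proof (intro iffI; elim exE conjE)
    fix P assume P: "partition_on (pverts K) P" "enat (card P) \<le> s"
      "\<forall>u\<in>pverts K. \<forall>v\<in>pverts K. pair_adj K u v \<longleftrightarrow> \<not> (\<exists>X\<in>P. u \<in> X \<and> v \<in> X)"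
    show "equiv (pverts K) r \<and> enat (card (pverts K // r)) \<le> s"
      using equiv_partition_on[OF P(1)] partition_on_eq_quotient[OF P(1)] P(2)
      unfolding same_part[OF P(1,3)] by simp
  next
    assume eq: "equiv (pverts K) r" and card: "enat (card (pverts K // r)) \<le> s"
    have "(\<exists>X\<in>pverts K // r. u \<in> X \<and> v \<in> X) \<longleftrightarrow> (u, v) \<in> r" for u v
    proof
      show "(u, v) \<in> r" if "\<exists>X\<in>pverts K // r. u \<in> X \<and> v \<in> X"
        using that in_quotient_imp_in_rel[OF eq] by blast
      show "\<exists>X\<in>pverts K // r. u \<in> X \<and> v \<in> X" if "(u, v) \<in> r"
        using that equiv_class_self[OF eq, of u]
        by (intro bexI[of _ "r `` {u}"] quotientI) (auto simp: r)
    qed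
    then show "\<exists>P. partition_on (pverts K) P \<and> enat (card P) \<le> s \<and>
      (\<forall>u\<in>pverts K. \<forall>v\<in>pverts K. pair_adj K u v \<longleftrightarrow> \<not> (\<exists>X\<in>P. u \<in> X \<and> v \<in> X))"
      using partition_on_quotient[OF eq] card r by (intro exI[of _ "pverts K // r"]) auto
  qed
  then show ?thesis
    unfolding complete_multipartite_at_most_def co.cluster_on_iff_closed_adjacency[OF fin]
      r_def[symmetric]
    using graph_with_proj[OF assms] by (simp add: pair_adj_def)
qed

lemma complete_digraph_restrict_iff:
  assumes "pair_graph K" "A \<subseteq> pverts K"
  shows "(\<exists>n. complete_digraph n (with_proj (pair_restrict K A))) \<longleftrightarrow> clique_set (pair_adj K) A"
proof -
  interpret simple_graph "pair_adj K" using assms(1) pair_graph_iff by blast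
  have "parcs (pair_restrict K A) = {(u, v). (u, v) \<in> A \<times> A \<and> u \<noteq> v} \<longleftrightarrow> clique_set (pair_adj K) A"
    using adj_irrefl unfolding pair_restrict_def clique_set_def pair_adj_def by auto
  then show ?thesis
    unfolding complete_digraph_def using graph_with_proj[OF pair_graph_restrict[OF assms]] by simp
qed

lemma cluster_iff_cliques:
  assumes "pair_graph K"
  shows "cluster (with_proj K) \<longleftrightarrow>
    (\<forall>u\<in>pverts K. clique_set (pair_adj K) (pre_digraph.scc_of (with_proj K) u))"
proof -
  interpret pair_graph K using assms .
  have "scc_of u \<subseteq> pverts K" for u unfolding scc_of_def using reachable_in_verts by blast
  then show ?thesis
    unfolding cluster_def sccs_conv_sccs_verts sccs_verts_conv_scc_of with_proj_restrict
    using complete_digraph_restrict_iff[OF assms] graph_with_proj[OF assms] by simp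
qed

lemma scc_of_P3_free:
  assumes "pair_graph K" "P3_free (pair_adj K) (pverts K)" "u \<in> pverts K"
  shows "pre_digraph.scc_of (with_proj K) u = closed_adjacency (pair_adj K) (pverts K) `` {u}"
proof -
  interpret pair_graph K using assms(1) .
  interpret simple_graph "pair_adj K" using assms(1) pair_graph_iff by blast
  have adj: "v \<rightarrow>\<^sup>*\<^bsub>with_proj K\<^esub> w" if "pair_adj K v w" for v w
    using that unfolding pair_adj_def by (auto intro: reachable_adjI)
  have "v \<in> pverts K \<and> (u = v \<or> pair_adj K u v)" if "u \<rightarrow>\<^sup>*\<^bsub>with_proj K\<^esub> v" for v
    using that
  proof (induction rule: reachable_induct)
    case base
    then show ?case using assms(3) by simp
  next
    case (step x y)
    then have "pair_adj K x y" "y \<in> pverts K" by (auto simp: pair_adj_def intro: in_arcsD2)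
    then show ?case using step.IH P3_freeD[OF assms(2), of u x y] assms(3) by blast
  qed
  moreover have "u \<rightarrow>\<^sup>*\<^bsub>with_proj K\<^esub> u" using assms(3) by simp
  ultimately show ?thesis
    unfolding scc_of_def closed_adjacency_def using adj adj_sym assms(3) by blast
qed

lemma cluster_iff_P3_free:
  assumes "pair_graph K"
  shows "cluster (with_proj K) \<longleftrightarrow> P3_free (pair_adj K) (pverts K)"
  unfolding cluster_iff_cliques[OF assms]
proof
  interpret pair_graph K using assms .
  assume cliques: "\<forall>u\<in>pverts K. clique_set (pair_adj K) (scc_of u)"
  have "pair_adj K x z" if "x \<in> pverts K" "pair_adj K x y" "pair_adj K y z" "x \<noteq> z" for x y z
  proof -
    have "x \<rightarrow>\<^sup>*\<^bsub>with_proj K\<^esub> y" "y \<rightarrow>\<^sup>*\<^bsub>with_proj K\<^esub> z"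
      using that(2,3) unfolding pair_adj_def by (auto intro: reachable_adjI)
    then have "z \<in> scc_of x" by (intro scc_ofI_reachable') (rule reachable_trans)
    then show ?thesis using cliques in_scc_of_self that(1,4) unfolding clique_set_def by blast
  qed
  then show "P3_free (pair_adj K) (pverts K)" unfolding P3_free_def induced_P3_def by blast
next
  interpret simple_graph "pair_adj K" using assms pair_graph_iff by blast
  assume P3: "P3_free (pair_adj K) (pverts K)"
  show "\<forall>u\<in>pverts K. clique_set (pair_adj K) (pre_digraph.scc_of (with_proj K) u)"
  proof
    fix u assume u: "u \<in> pverts K"
    show "clique_set (pair_adj K) (pre_digraph.scc_of (with_proj K) u)"
      unfolding scc_of_P3_free[OF assms P3 u] clique_set_def closed_adjacency_def
      using P3_freeD[OF P3, of _ u] adj_sym u by blast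
  qed
qed

lemma cluster_iff:
  assumes "pair_graph K"
  shows "cluster (with_proj K) \<and> enat (card (pre_digraph.sccs (with_proj K))) \<le> k
    \<longleftrightarrow> cluster_on (pair_adj K) k (pverts K)"
proof -
  interpret pair_graph K using assms .
  interpret simple_graph "pair_adj K" using assms pair_graph_iff by blast
  have "sccs_verts = pverts K // closed_adjacency (pair_adj K) (pverts K)"
    if P3: "P3_free (pair_adj K) (pverts K)"
    unfolding sccs_verts_conv_scc_of quotient_def using scc_of_P3_free[OF assms P3] by auto
  then have "card sccs = card (pverts K // closed_adjacency (pair_adj K) (pverts K))"
    if "P3_free (pair_adj K) (pverts K)"
    using card_sccs_verts that by simp
  then show ?thesis
    unfolding cluster_on_iff_closed_adjacency[OF pair_finite_verts] equiv_closed_adjacency_iff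
      cluster_iff_P3_free[OF assms] by auto
qed

subsection \<open>Obstructions\<close>

lemma polar_restrict_iff:
  assumes "pair_graph G" "W \<subseteq> pverts G"
  shows "polar s k (with_proj (pair_restrict G W)) \<longleftrightarrow> polar_on (pair_adj G) s k W"
proof -
  have sub: "pair_graph (pair_restrict G A)" if "A \<subseteq> W" for A
    using pair_graph_restrict[OF assms(1)] assms(2) that by blast
  have restrict: "cluster_on (pair_adj (pair_restrict G A)) i A \<longleftrightarrow> cluster_on (pair_adj G) i A"
    "cluster_on (complement (pair_adj (pair_restrict G A))) i A \<longleftrightarrow>
      cluster_on (complement (pair_adj G)) i A" for A i
    using graph_embedding_cluster_on[OF graph_embedding_restrict]
      graph_embedding_cluster_on[OF graph_embedding_complement[OF graph_embedding_restrict]] by simp_all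
  have "polar_partition s k (with_proj (pair_restrict G W)) A B \<longleftrightarrow> A \<subseteq> W \<and> B = W - A \<and>
      cluster_on (complement (pair_adj G)) s A \<and> cluster_on (pair_adj G) k B" for A B
  proof (cases "A \<subseteq> W \<and> B = W - A")
    case True
    then have "B \<subseteq> W" by blast
    with True show ?thesis
      unfolding polar_partition_def with_proj_restrict
      by (auto simp: pair_restrict_restrict complete_multipartite_at_most_iff sub cluster_iff restrict)
  next
    case False
    then show ?thesis unfolding polar_partition_def by auto
  qed
  then show ?thesis unfolding polar_def polar_on_def by metis
qed

lemma digraph_iso_imp_isomorphic_on:
  assumes "pair_wf_digraph G" "digraph_iso (with_proj G) (with_proj H)"
  shows "isomorphic_on (pair_adj G) (pverts G) (pair_adj H) (pverts H)"
proof -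
  interpret pair_wf_digraph G using assms(1) .
  obtain f where f: "digraph_isomorphism f" "with_proj H = app_iso f (with_proj G)"
    using assms(2) unfolding digraph_iso_def by blast
  have "verts (with_proj H) = iso_verts f ` pverts G" "arcs (with_proj H) = iso_arcs f ` parcs G"
    "tail (with_proj H) = iso_tail f" "head (with_proj H) = iso_head f" unfolding f(2) by simp_all
  then have H: "pverts H = iso_verts f ` pverts G" "parcs H = iso_arcs f ` parcs G"
    "iso_tail f = fst" "iso_head f = snd" by simp_all
  have inj: "inj_on (iso_verts f) (pverts G)" using f(1) unfolding digraph_isomorphism_def by simp
  have "iso_arcs f e = map_prod (iso_verts f) (iso_verts f) e" if "e \<in> parcs G" for e
    using f(1) H(3,4) that unfolding digraph_isomorphism_def by (auto simp: prod_eq_iff)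
  then have arcs: "parcs H = map_prod (iso_verts f) (iso_verts f) ` parcs G"
    unfolding H(2) by (rule image_cong[OF refl])
  have "pair_adj H (iso_verts f x) (iso_verts f y) \<longleftrightarrow> pair_adj G x y"
    if xy: "x \<in> pverts G" "y \<in> pverts G" for x y
  proof
    assume "pair_adj H (iso_verts f x) (iso_verts f y)"
    then obtain a b where ab: "(a, b) \<in> parcs G" "iso_verts f a = iso_verts f x"
      "iso_verts f b = iso_verts f y"
      unfolding pair_adj_def arcs by auto
    then have "a = x" "b = y" using inj_onD[OF inj] in_arcsD1 in_arcsD2 xy by blast+
    then show "pair_adj G x y" using ab(1) unfolding pair_adj_def by simp
  next
    show "pair_adj H (iso_verts f x) (iso_verts f y)" if "pair_adj G x y"
      using that unfolding pair_adj_def arcs by (metis image_eqI map_prod_simp)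
  qed
  then have "graph_embedding (pair_adj G) (pverts G) (pair_adj H) (iso_verts f)"
    using inj unfolding graph_embedding_def by blast
  then show ?thesis unfolding isomorphic_on_def using H(1) by metis
qed

lemma isomorphic_on_imp_digraph_iso:
  assumes "pair_wf_digraph G" "pair_wf_digraph H"
    "isomorphic_on (pair_adj G) (pverts G) (pair_adj H) (pverts H)"
  shows "digraph_iso (with_proj G) (with_proj H)"
proof -
  interpret G: pair_wf_digraph G using assms(1) .
  interpret H: pair_wf_digraph H using assms(2) .
  obtain f where f: "graph_embedding (pair_adj G) (pverts G) (pair_adj H) f" "f ` pverts G = pverts H"
    using assms(3) by (rule isomorphic_onE)
  have inj: "inj_on f (pverts G)" using f(1) unfolding graph_embedding_def by blast
  have adj: "(f x, f y) \<in> parcs H \<longleftrightarrow> (x, y) \<in> parcs G" if "x \<in> pverts G" "y \<in> pverts G" for x y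
    using graph_embedding_adj[OF f(1) that] unfolding pair_adj_def .
  define h where "h = \<lparr> iso_verts = f, iso_arcs = map_prod f f, iso_head = snd, iso_tail = fst \<rparr>"
  have "inj_on (map_prod f f) (parcs G)"
    using map_prod_inj_on[OF inj inj] by (rule inj_on_subset) (auto dest: G.in_arcsD1 G.in_arcsD2)
  then have "G.digraph_isomorphism h"
    unfolding G.digraph_isomorphism_def h_def using inj G.wf_digraph_axioms by simp
  moreover have "parcs H = map_prod f f ` parcs G"
  proof (intro set_eqI iffI)
    fix e assume e: "e \<in> parcs H"
    then have "fst e \<in> f ` pverts G" "snd e \<in> f ` pverts G"
      unfolding f(2) using H.arc_fst_in_verts H.arc_snd_in_verts by blast+
    then obtain x y where "e = (f x, f y)" "x \<in> pverts G" "y \<in> pverts G" by (auto simp: prod_eq_iff)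
    then show "e \<in> map_prod f f ` parcs G" using adj e by force
  qed (use adj G.in_arcsD1 G.in_arcsD2 in auto)
  then have "with_proj H = app_iso h (with_proj G)"
    unfolding app_iso_def h_def with_proj_def using f(2) by simp
  ultimately show ?thesis unfolding digraph_iso_def by blast
qed

lemma digraph_iso_iff:
  assumes "pair_wf_digraph G" "pair_wf_digraph K"
  shows "digraph_iso (with_proj G) (with_proj K) \<longleftrightarrow> induces_copy K (pair_adj G) (pverts G)"
  using digraph_iso_imp_isomorphic_on[OF assms(1)] isomorphic_on_imp_digraph_iso[OF assms]
  by (metis isomorphic_on_sym)

lemma digraph_iso_restrict_iff:
  assumes "pair_wf_digraph K"
  shows "digraph_iso (with_proj (pair_restrict G A)) (with_proj K) \<longleftrightarrow> induces_copy K (pair_adj G) A"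
proof -
  have "isomorphic_on (pair_adj G) A (pair_adj (pair_restrict G A)) A"
    using graph_embedding_restrict unfolding isomorphic_on_def by (intro exI[of _ id]) simp
  then show ?thesis
    unfolding digraph_iso_iff[OF pair_wf_digraph_restrict assms] pverts_pair_restrict
    using isomorphic_on_trans isomorphic_on_sym by metis
qed

lemma path_graph_simps [simp]:
  "pverts (path_graph n) = {..<n}"
  "pair_adj (path_graph n) i j \<longleftrightarrow> i < n \<and> j < n \<and> (j = Suc i \<or> i = Suc j)"
  by (auto simp: path_graph_def pair_adj_def)

lemma complete_graph_simps [simp]:
  "pverts (complete_graph n) = {..<n}"
  "pair_adj (complete_graph n) i j \<longleftrightarrow> i < n \<and> j < n \<and> i \<noteq> j"
  by (auto simp: complete_graph_def pair_adj_def)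

lemma disjoint_union_simps [simp]:
  "pverts (disjoint_union G H) = pverts G <+> pverts H"
  "pair_adj (disjoint_union G H) (Inl u) (Inl u') \<longleftrightarrow> pair_adj G u u'"
  "pair_adj (disjoint_union G H) (Inr v) (Inr v') \<longleftrightarrow> pair_adj H v v'"
  "\<not> pair_adj (disjoint_union G H) (Inl u) (Inr v)"
  "\<not> pair_adj (disjoint_union G H) (Inr v) (Inl u)"
  by (auto simp: disjoint_union_def pair_adj_def)

lemma graph_join_simps [simp]:
  "pverts (graph_join G H) = pverts G <+> pverts H"
  "pair_adj (graph_join G H) (Inl u) (Inl u') \<longleftrightarrow> pair_adj G u u'"
  "pair_adj (graph_join G H) (Inr v) (Inr v') \<longleftrightarrow> pair_adj H v v'"
  "pair_adj (graph_join G H) (Inl u) (Inr v) \<longleftrightarrow> u \<in> pverts G \<and> v \<in> pverts H"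
  "pair_adj (graph_join G H) (Inr v) (Inl u) \<longleftrightarrow> u \<in> pverts G \<and> v \<in> pverts H"
  by (auto simp: graph_join_def disjoint_union_def pair_adj_def)

lemma copies_simps [simp]:
  "pverts (copies n G) = {..<n} \<times> pverts G"
  "pair_adj (copies n G) (i, u) (j, v) \<longleftrightarrow> i = j \<and> i < n \<and> pair_adj G u v"
  by (auto simp: copies_def pair_adj_def)

lemma pair_wf_digraph_path_graph: "pair_wf_digraph (path_graph n)"
  by unfold_locales (auto simp: path_graph_def)

lemma pair_wf_digraph_complete_graph: "pair_wf_digraph (complete_graph n)"
  by unfold_locales (auto simp: complete_graph_def)

lemma pair_wf_digraph_copies: "pair_wf_digraph G \<Longrightarrow> pair_wf_digraph (copies n G)"
  unfolding pair_wf_digraph_def copies_def by auto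

lemma pair_wf_digraph_disjoint_union:
  "pair_wf_digraph G \<Longrightarrow> pair_wf_digraph H \<Longrightarrow> pair_wf_digraph (disjoint_union G H)"
  unfolding pair_wf_digraph_def disjoint_union_def by auto

lemma pair_wf_digraph_graph_join:
  "pair_wf_digraph G \<Longrightarrow> pair_wf_digraph H \<Longrightarrow> pair_wf_digraph (graph_join G H)"
  unfolding pair_wf_digraph_def graph_join_def disjoint_union_def by auto

lemmas pair_wf_digraph_intros = pair_wf_digraph_path_graph pair_wf_digraph_complete_graph
  pair_wf_digraph_copies pair_wf_digraph_disjoint_union pair_wf_digraph_graph_join

context simple_graph begin

lemma induces_copy_disjoint_union_iff:
  "induces_copy (disjoint_union G H) E V \<longleftrightarrow>
    (\<exists>X Y. X \<union> Y = V \<and> anticomplete E X Y \<and> induces_copy G E X \<and> induces_copy H E Y)"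
  unfolding disjoint_union_simps(1) anticomplete_def
  by (subst isomorphic_on_Plus_iff[where c = False]) (auto cong: conj_cong)

lemma induces_copy_graph_join_iff:
  "induces_copy (graph_join G H) E V \<longleftrightarrow>
    (\<exists>X Y. X \<union> Y = V \<and> complete_to E X Y \<and> induces_copy G E X \<and> induces_copy H E Y)"
  unfolding graph_join_simps(1) complete_to_def
  by (subst isomorphic_on_Plus_iff[where c = True]) (auto cong: conj_cong)

lemma induces_copy_P3_iff: "induces_copy (path_graph 3) E X \<longleftrightarrow> induces_P3 E X"
proof
  assume "induces_copy (path_graph 3) E X"
  then obtain xs where xs: "length xs = 3" "distinct xs" "set xs = X"
    "\<forall>i<3. \<forall>j<3. E (xs ! i) (xs ! j) \<longleftrightarrow> j = Suc i \<or> i = Suc j"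
    unfolding path_graph_simps(1) isomorphic_on_lessThan_iff by auto
  then obtain a b c where "xs = [a, b, c]" by (auto simp: eval_nat_numeral length_Suc_conv)
  then have "X = {a, b, c}" "induced_P3 E a b c"
    using xs unfolding induced_P3_def by (auto simp: eval_nat_numeral All_less_Suc)
  then show "induces_P3 E X" unfolding induces_P3_def by blast
next
  assume "induces_P3 E X"
  then obtain a b c where P3: "X = {a, b, c}" "E a b" "E b c" "\<not> E a c" "a \<noteq> c"
    unfolding induces_P3_def induced_P3_def by blast
  then have rev: "E b a" "E c b" "\<not> E c a" using adj_sym by blast+
  then have "distinct [a, b, c]" using P3 adj_irrefl by auto
  then show "induces_copy (path_graph 3) E X"
    unfolding path_graph_simps(1) isomorphic_on_lessThan_iff
    using P3 rev by (intro exI[of _ "[a, b, c]"]) (auto simp: eval_nat_numeral All_less_Suc adj_irrefl)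
qed

lemma induces_copy_P4_iff:
  "induces_copy (path_graph 4) E X \<longleftrightarrow>
    (\<exists>a b c d. X = {a, b, c, d} \<and> E a b \<and> E b c \<and> E c d \<and> \<not> E a c \<and> \<not> E a d \<and> \<not> E b d)"
proof
  assume "induces_copy (path_graph 4) E X"
  then obtain xs where xs: "length xs = 4" "set xs = X"
    "\<forall>i<4. \<forall>j<4. E (xs ! i) (xs ! j) \<longleftrightarrow> j = Suc i \<or> i = Suc j"
    unfolding path_graph_simps(1) isomorphic_on_lessThan_iff by auto
  then obtain a b c d where "xs = [a, b, c, d]" by (auto simp: eval_nat_numeral length_Suc_conv)
  then have "X = {a, b, c, d}" "E a b" "E b c" "E c d" "\<not> E a c" "\<not> E a d" "\<not> E b d"
    using xs by (auto simp: eval_nat_numeral All_less_Suc)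
  then show "\<exists>a b c d. X = {a, b, c, d} \<and> E a b \<and> E b c \<and> E c d \<and> \<not> E a c \<and> \<not> E a d \<and> \<not> E b d" by blast
next
  assume "\<exists>a b c d. X = {a, b, c, d} \<and> E a b \<and> E b c \<and> E c d \<and> \<not> E a c \<and> \<not> E a d \<and> \<not> E b d"
  then obtain a b c d where P4: "X = {a, b, c, d}" "E a b" "E b c" "E c d" "\<not> E a c" "\<not> E a d" "\<not> E b d"
    by blast
  then have rev: "E b a" "E c b" "E d c" "\<not> E c a" "\<not> E d a" "\<not> E d b" using adj_sym by blast+
  then have "distinct [a, b, c, d]" using P4 adj_irrefl by auto
  then show "induces_copy (path_graph 4) E X"
    unfolding path_graph_simps(1) isomorphic_on_lessThan_iff
    using P4 rev by (intro exI[of _ "[a, b, c, d]"]) (auto simp: eval_nat_numeral All_less_Suc adj_irrefl)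
qed

lemma P4_free_iff_no_copy: "P4_free E V \<longleftrightarrow> \<not> (\<exists>W\<subseteq>V. induces_copy (path_graph 4) E W)"
proof
  assume "P4_free E V"
  then show "\<not> (\<exists>W\<subseteq>V. induces_copy (path_graph 4) E W)"
    unfolding induces_copy_P4_iff P4_free_def by blast
next
  assume no_copy: "\<not> (\<exists>W\<subseteq>V. induces_copy (path_graph 4) E W)"
  show "P4_free E V"
    unfolding P4_free_def
  proof (intro ballI notI)
    fix a b c d assume V: "a \<in> V" "b \<in> V" "c \<in> V" "d \<in> V"
      and "E a b \<and> E b c \<and> E c d \<and> \<not> E a c \<and> \<not> E a d \<and> \<not> E b d"
    then have "induces_copy (path_graph 4) E {a, b, c, d}" unfolding induces_copy_P4_iff by blast
    moreover have "{a, b, c, d} \<subseteq> V" using V by simp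
    ultimately show False using no_copy by blast
  qed
qed

lemma induces_copy_K1_iff: "induces_copy (complete_graph 1) E X \<longleftrightarrow> (\<exists>v. X = {v})"
  unfolding complete_graph_simps(1) isomorphic_on_lessThan_iff
  by (auto simp: length_Suc_conv adj_irrefl)

lemma induces_copy_K2_iff: "induces_copy (complete_graph 2) E X \<longleftrightarrow> (\<exists>x y. X = {x, y} \<and> E x y)"
proof
  assume "induces_copy (complete_graph 2) E X"
  then obtain xs where xs: "length xs = 2" "set xs = X" "\<forall>i<2. \<forall>j<2. E (xs ! i) (xs ! j) \<longleftrightarrow> i \<noteq> j"
    unfolding complete_graph_simps(1) isomorphic_on_lessThan_iff by auto
  then obtain x y where "xs = [x, y]" by (auto simp: eval_nat_numeral length_Suc_conv)
  then have "X = {x, y}" "E x y" using xs by (auto simp: eval_nat_numeral All_less_Suc)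
  then show "\<exists>x y. X = {x, y} \<and> E x y" by blast
next
  assume "\<exists>x y. X = {x, y} \<and> E x y"
  then obtain x y where "X = {x, y}" "E x y" "E y x" "x \<noteq> y" using adj_sym adj_irrefl by metis
  then show "induces_copy (complete_graph 2) E X"
    unfolding complete_graph_simps(1) isomorphic_on_lessThan_iff
    by (intro exI[of _ "[x, y]"]) (auto simp: eval_nat_numeral All_less_Suc adj_irrefl)
qed

end

lemma isomorphic_on_copies_Suc:
  "isomorphic_on (pair_adj (disjoint_union G (copies n G))) (pverts (disjoint_union G (copies n G)))
    (pair_adj (copies (Suc n) G)) (pverts (copies (Suc n) G))"
  unfolding isomorphic_on_def
proof (intro exI conjI)
  show "case_sum (Pair n) id ` pverts (disjoint_union G (copies n G)) = pverts (copies (Suc n) G)"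
    unfolding disjoint_union_simps(1) Plus_def image_Un image_comp comp_def
    by (auto simp: less_Suc_eq image_iff)
  show "graph_embedding (pair_adj (disjoint_union G (copies n G))) (pverts (disjoint_union G (copies n G)))
      (pair_adj (copies (Suc n) G)) (case_sum (Pair n) id)"
    unfolding graph_embedding_def disjoint_union_simps(1)
    by (auto intro!: inj_onI elim!: PlusE)
qed

context simple_graph begin

lemma induces_copy_copies_K2_iff:
  "induces_copy (copies n (complete_graph 2)) E W \<longleftrightarrow> induced_matching E n W"
proof (induction n arbitrary: W)
  case 0
  show ?case
    unfolding isomorphic_on_def graph_embedding_def induced_matching_0_iff by auto
next
  case (Suc n)
  have "induces_copy (copies (Suc n) (complete_graph 2)) E W \<longleftrightarrow>
      induces_copy (disjoint_union (complete_graph 2) (copies n (complete_graph 2))) E W"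
    using isomorphic_on_trans[OF isomorphic_on_copies_Suc]
      isomorphic_on_trans[OF isomorphic_on_sym[OF isomorphic_on_copies_Suc]]
    by blast
  also have "\<dots> \<longleftrightarrow> (\<exists>x y Y. {x, y} \<union> Y = W \<and> anticomplete E {x, y} Y \<and> E x y \<and> induced_matching E n Y)"
    unfolding induces_copy_disjoint_union_iff induces_copy_K2_iff Suc.IH by blast
  also have "\<dots> \<longleftrightarrow> induced_matching E (Suc n) W"
  proof
    assume m: "induced_matching E (Suc n) W"
    then obtain x where x: "x \<in> W" unfolding induced_matching_def by fastforce
    obtain y where y: "y \<in> W" "E x y" "induced_matching E n (W - {x, y})"
      "anticomplete E {x, y} (W - {x, y})"
      using induced_matching_remove_edge[OF m x] by (metis Suc_inject)
    moreover have "{x, y} \<union> (W - {x, y}) = W" using x y(1) by blast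
    ultimately show "\<exists>x y Y. {x, y} \<union> Y = W \<and> anticomplete E {x, y} Y \<and> E x y \<and> induced_matching E n Y"
      by blast
  qed (use induced_matching_insert_edge in blast)
  finally show ?case .
qed

lemma ex_nat_copy:
  assumes "finite X"
  obtains H :: "nat pair_pre_digraph" where "pair_graph H" "induces_copy H E X"
proof -
  obtain g where g: "bij_betw g {0..<card X} X" using ex_bij_betw_nat_finite[OF assms] by blast
  define H where "H =
    \<lparr> pverts = {0..<card X}, parcs = {(i, j). i < card X \<and> j < card X \<and> E (g i) (g j)} \<rparr>"
  have "pair_wf_digraph H" by unfold_locales (auto simp: H_def)
  then have "pair_graph H"
    unfolding pair_graph_iff H_def simple_graph_def pair_adj_def using adj_sym adj_irrefl by auto
  moreover have "graph_embedding (pair_adj H) (pverts H) E g" "g ` pverts H = X"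
    using g unfolding graph_embedding_def bij_betw_def H_def pair_adj_def by auto
  ultimately show ?thesis using that unfolding isomorphic_on_def by blast
qed

lemma induces_copy_plus_matching_iff:
  "induces_copy (disjoint_union (copies n (complete_graph 2)) K) E X \<longleftrightarrow>
    (\<exists>D. plus_matching E n D X \<and> induces_copy K E D)"
  unfolding induces_copy_disjoint_union_iff induces_copy_copies_K2_iff plus_matching_def by blast

lemma induces_copy_butterfly_iff:
  "induces_copy (graph_join (complete_graph 1) (copies 2 (complete_graph 2))) E D \<longleftrightarrow>
    induces_butterfly E D"
  unfolding induces_copy_graph_join_iff induces_copy_copies_K2_iff induces_copy_K1_iff
    induces_butterfly_def
  by (metis insert_is_Un)

lemma P4_free_plus_matching: "plus_matching E n D X \<Longrightarrow> P4_free E D \<Longrightarrow> P4_free E X"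
  unfolding plus_matching_def using P4_free_Un P4_free_matching by blast

lemma P4_free_P3: "induces_P3 E D \<Longrightarrow> P4_free E D"
  unfolding induces_P3_def induced_P3_def P4_free_def using adj_sym adj_irrefl by blast

lemma P4_free_butterfly:
  assumes "induces_butterfly E D" shows "P4_free E D"
proof -
  obtain v M where vM: "D = {v} \<union> M" "complete_to E {v} M" "induced_matching E 2 M"
    using assms unfolding induces_butterfly_def by auto
  have "P4_free E {v}" unfolding P4_free_def using adj_irrefl by simp
  then show "P4_free E D"
    unfolding vM(1) using P4_free_join[OF vM(2)] P4_free_matching[OF vM(3)] by blast
qed

end

lemma cograph_iff:
  assumes "pair_graph G"
  shows "cograph (with_proj G) \<longleftrightarrow> P4_free (pair_adj G) (pverts G)"
proof -
  interpret simple_graph "pair_adj G" using assms pair_graph_iff by blast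
  have "(\<exists>H. induced_subgraph H (with_proj G) \<and> digraph_iso H (with_proj (path_graph 4))) \<longleftrightarrow>
      (\<exists>W\<subseteq>pverts G. induces_copy (path_graph 4) (pair_adj G) W)"
    unfolding induced_subgraph_iff[OF assms]
    using digraph_iso_restrict_iff[OF pair_wf_digraph_path_graph] by metis
  then show ?thesis unfolding cograph_def P4_free_iff_no_copy using graph_with_proj[OF assms] by blast
qed

lemma cograph_min_polar_obstruction_iff:
  assumes "pair_graph G"
  shows "cograph_min_polar_obstruction s k (with_proj G) \<longleftrightarrow>
    P4_free (pair_adj G) (pverts G) \<and> min_polar_obstruction_on (pair_adj G) s k (pverts G)"
proof -
  have "with_proj (pair_restrict G W) \<noteq> with_proj G \<longleftrightarrow> W \<noteq> pverts G" for W
    using pair_restrict_pverts[OF assms] with_proj_simps(1) pverts_pair_restrict by metis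
  then have "(\<forall>H. induced_subgraph H (with_proj G) \<and> H \<noteq> with_proj G \<longrightarrow> polar s k H) \<longleftrightarrow>
      (\<forall>W\<subset>pverts G. polar_on (pair_adj G) s k W)"
    unfolding induced_subgraph_iff[OF assms] psubset_eq
    using polar_restrict_iff[OF assms] by blast
  moreover have "polar s k (with_proj G) \<longleftrightarrow> polar_on (pair_adj G) s k (pverts G)"
    using polar_restrict_iff[OF assms subset_refl] pair_restrict_pverts[OF assms] by simp
  ultimately show ?thesis
    unfolding cograph_min_polar_obstruction_def min_polar_obstruction_on_def cograph_iff[OF assms]
    by blast
qed

lemma reachable_in_anticomplete_part:
  assumes "pair_graph G" "u \<rightarrow>\<^sup>*\<^bsub>with_proj G\<^esub> v" "u \<in> X" "X \<union> Y = pverts G"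
    "anticomplete (pair_adj G) X Y"
  shows "v \<in> X"
proof -
  interpret pair_graph G using assms(1) .
  show ?thesis using assms(2,3)
  proof (induction rule: reachable_induct)
    case (step x y)
    then have "pair_adj G x y" "y \<in> X \<union> Y" unfolding pair_adj_def assms(4) by (auto intro: in_arcsD2)
    then show ?case using step assms(5) unfolding anticomplete_def by blast
  qed
qed

lemma connected_on_reachable:
  assumes "pair_graph G" "connected_on (pair_adj G) (pverts G)" "u \<in> pverts G" "v \<in> pverts G"
  shows "u \<rightarrow>\<^sup>*\<^bsub>with_proj G\<^esub> v"
proof -
  interpret pair_graph G using assms(1) .
  define X where "X = {w \<in> pverts G. u \<rightarrow>\<^sup>*\<^bsub>with_proj G\<^esub> w}"
  have "y \<in> X" if "x \<in> X" "y \<in> pverts G" "pair_adj G x y" for x y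
    using that reachable_adj_trans[of u x y] unfolding X_def pair_adj_def by simp
  then have "anticomplete (pair_adj G) X (pverts G - X)" unfolding anticomplete_def by blast
  moreover have "X \<union> (pverts G - X) = pverts G" "u \<in> X" using assms(3) unfolding X_def by auto
  ultimately have "pverts G - X = {}" using assms(2) unfolding connected_on_def by blast
  then show ?thesis using assms(4) unfolding X_def by blast
qed

lemma connected_iff:
  assumes "pair_graph G"
  shows "Digraph_Component.connected (with_proj G) \<longleftrightarrow> connected_on (pair_adj G) (pverts G)"
proof -
  interpret pair_graph G using assms .
  have "mk_symmetric (with_proj G) = G"
    unfolding mk_symmetric_def using graph_symmetric by (intro pair_pre_digraph.equality) auto
  then have "Digraph_Component.connected (with_proj G) \<longleftrightarrow>
      pverts G \<noteq> {} \<and> (\<forall>u\<in>pverts G. \<forall>v\<in>pverts G. u \<rightarrow>\<^sup>*\<^bsub>with_proj G\<^esub> v)"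
    unfolding Digraph_Component.connected_def strongly_connected_def by simp
  also have "\<dots> \<longleftrightarrow> connected_on (pair_adj G) (pverts G)"
  proof
    assume reach: "pverts G \<noteq> {} \<and> (\<forall>u\<in>pverts G. \<forall>v\<in>pverts G. u \<rightarrow>\<^sup>*\<^bsub>with_proj G\<^esub> v)"
    have "X = {} \<or> Y = {}" if XY: "X \<union> Y = pverts G" "anticomplete (pair_adj G) X Y" for X Y
    proof (rule ccontr)
      assume "\<not> (X = {} \<or> Y = {})"
      then obtain x y where "x \<in> X" "y \<in> Y" by blast
      moreover from this have "y \<in> X"
        using reach reachable_in_anticomplete_part[OF assms _ _ XY] XY(1) by blast
      ultimately show False using XY(2) unfolding anticomplete_def by blast
    qed
    then show "connected_on (pair_adj G) (pverts G)" using reach unfolding connected_on_def by blast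
  next
    assume "connected_on (pair_adj G) (pverts G)"
    then show "pverts G \<noteq> {} \<and> (\<forall>u\<in>pverts G. \<forall>v\<in>pverts G. u \<rightarrow>\<^sup>*\<^bsub>with_proj G\<^esub> v)"
      using connected_on_reachable[OF assms] unfolding connected_on_def by blast
  qed
  finally show ?thesis .
qed

subsection \<open>The characterization\<close>

theorem cograph_min_polar_obstruction_P3_union_iff:
  assumes "2 \<le> k" and G: "pair_graph G" and H: "pair_graph H"
    and iso: "digraph_iso (with_proj G) (with_proj (disjoint_union (path_graph 3) H))"
  shows "cograph_min_polar_obstruction \<infinity> (enat k) (with_proj G) \<longleftrightarrow>
    P4_free (pair_adj H) (pverts H) \<and> P3_residual (pair_adj H) k (pverts H)"
proof -
  interpret simple_graph "pair_adj G" using G pair_graph_iff by blast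
  have wf: "pair_wf_digraph G" "pair_wf_digraph (disjoint_union (path_graph 3) H)"
    using G H pair_graph_iff by (auto intro: pair_wf_digraph_intros)
  obtain P X where X: "P \<union> X = pverts G" "anticomplete (pair_adj G) P X" "induces_P3 (pair_adj G) P"
    and copy: "induces_copy H (pair_adj G) X"
    using iso unfolding digraph_iso_iff[OF wf] induces_copy_disjoint_union_iff induces_copy_P3_iff
    by blast
  obtain a b c where P: "P = {a, b, c}" "induced_P3 (pair_adj G) a b c"
    using X(3) unfolding induces_P3_def by blast
  have "finite X" using X(1) G pair_graph_iff by (metis finite_Un)
  then have "min_polar_obstruction_on (pair_adj G) \<infinity> (enat k) (pverts G) \<longleftrightarrow> P3_residual (pair_adj G) k X"
    using min_polar_obstruction_on_P3_Un_iff[OF assms(1) P(2) _ X(2)[unfolded P(1)]] X(1) P(1) by simp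
  moreover have "P4_free (pair_adj G) (pverts G) \<longleftrightarrow> P4_free (pair_adj G) X"
    using P4_free_Un[OF X(2) P4_free_P3[OF X(3)]] P4_free_subset X(1) by (metis Un_upper2)
  ultimately show ?thesis
    unfolding cograph_min_polar_obstruction_iff[OF G]
    using isomorphic_on_P4_free[OF copy] isomorphic_on_P3_residual[OF copy] by blast
qed

lemma connected_obstruction_plus_matching_iff:
  assumes H: "pair_graph H"
  shows "(\<exists>H\<^sub>j :: nat pair_pre_digraph. pair_graph H\<^sub>j \<and>
      Digraph_Component.connected (with_proj H\<^sub>j) \<and>
      cograph_min_polar_obstruction 1 (enat j) (with_proj H\<^sub>j) \<and>
      \<not> cograph_min_polar_obstruction 1 \<infinity> (with_proj H\<^sub>j) \<and>
      digraph_iso (with_proj H) (with_proj (disjoint_union (copies n (complete_graph 2)) H\<^sub>j))) \<longleftrightarrow>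
    P4_free (pair_adj H) (pverts H) \<and>
    (\<exists>D. plus_matching (pair_adj H) n D (pverts H) \<and> connected_on (pair_adj H) D \<and>
      min_polar_obstruction_on (pair_adj H) 1 (enat j) D \<and> \<not> min_polar_obstruction_on (pair_adj H) 1 \<infinity> D)"
  (is "?L \<longleftrightarrow> ?R")
proof -
  interpret simple_graph "pair_adj H" using H pair_graph_iff by blast
  have translate: "Digraph_Component.connected (with_proj K) \<and>
      cograph_min_polar_obstruction 1 (enat j) (with_proj K) \<and>
      \<not> cograph_min_polar_obstruction 1 \<infinity> (with_proj K) \<longleftrightarrow>
      P4_free (pair_adj H) D \<and> connected_on (pair_adj H) D \<and>
      min_polar_obstruction_on (pair_adj H) 1 (enat j) D \<and> \<not> min_polar_obstruction_on (pair_adj H) 1 \<infinity> D"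
    if "pair_graph K" "induces_copy K (pair_adj H) D" for K :: "nat pair_pre_digraph" and D
    unfolding connected_iff[OF that(1)] cograph_min_polar_obstruction_iff[OF that(1)]
      isomorphic_on_P4_free[OF that(2)] isomorphic_on_connected_on[OF that(2)]
      isomorphic_on_min_polar_obstruction_on[OF that(2)] by blast
  have iso: "digraph_iso (with_proj H) (with_proj (disjoint_union (copies n (complete_graph 2)) K)) \<longleftrightarrow>
      (\<exists>D. plus_matching (pair_adj H) n D (pverts H) \<and> induces_copy K (pair_adj H) D)"
    if "pair_graph K" for K :: "nat pair_pre_digraph"
    using H that digraph_iso_iff[of H "disjoint_union (copies n (complete_graph 2)) K"]
    unfolding pair_graph_iff induces_copy_plus_matching_iff by (simp add: pair_wf_digraph_intros)
  show ?thesis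
  proof
    assume ?L
    then show ?R using translate iso P4_free_plus_matching by blast
  next
    assume ?R
    then obtain D where D: "plus_matching (pair_adj H) n D (pverts H)" "P4_free (pair_adj H) D"
      "connected_on (pair_adj H) D \<and> min_polar_obstruction_on (pair_adj H) 1 (enat j) D \<and>
        \<not> min_polar_obstruction_on (pair_adj H) 1 \<infinity> D"
      using P4_free_subset unfolding plus_matching_def by blast
    have "finite D" using D(1) H unfolding plus_matching_def pair_graph_iff by auto
    then obtain K :: "nat pair_pre_digraph" where "pair_graph K" "induces_copy K (pair_adj H) D"
      using ex_nat_copy by blast
    then show ?L using translate iso D by blast
  qed
qed

theorem P3_residual_iff_digraph_iso:
  fixes H :: "nat pair_pre_digraph"
  assumes k: "2 \<le> k" and H: "pair_graph H"
  shows "P4_free (pair_adj H) (pverts H) \<and> P3_residual (pair_adj H) k (pverts H) \<longleftrightarrow>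
    digraph_iso (with_proj H)
        (with_proj (disjoint_union (path_graph 3) (copies (k - 1) (complete_graph 2))))
    \<or> digraph_iso (with_proj H)
        (with_proj (disjoint_union (copies (k - 2) (complete_graph 2))
          (graph_join (complete_graph 1) (copies 2 (complete_graph 2)))))
    \<or> (\<exists>j\<in>{1..k - 1}. \<exists>H\<^sub>j :: nat pair_pre_digraph. pair_graph H\<^sub>j \<and>
          Digraph_Component.connected (with_proj H\<^sub>j) \<and>
          cograph_min_polar_obstruction 1 (enat j) (with_proj H\<^sub>j) \<and>
          \<not> cograph_min_polar_obstruction 1 \<infinity> (with_proj H\<^sub>j) \<and>
          digraph_iso (with_proj H)
            (with_proj (disjoint_union (copies (k - j - 1) (complete_graph 2)) H\<^sub>j)))
    \<or> (3 \<le> k \<and> cograph_min_polar_obstruction 1 \<infinity> (with_proj H))"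
proof -
  interpret simple_graph "pair_adj H" using H pair_graph_iff by blast
  have wf: "pair_wf_digraph H" and fin: "finite (pverts H)" using H pair_graph_iff by blast+
  have P3: "digraph_iso (with_proj H)
        (with_proj (disjoint_union (path_graph 3) (copies (k - 1) (complete_graph 2))))
      \<longleftrightarrow> (\<exists>D. induces_P3 (pair_adj H) D \<and> plus_matching (pair_adj H) (k - 1) D (pverts H))"
    unfolding digraph_iso_iff[OF wf pair_wf_digraph_disjoint_union[OF pair_wf_digraph_path_graph
        pair_wf_digraph_copies[OF pair_wf_digraph_complete_graph]]]
      induces_copy_disjoint_union_iff induces_copy_P3_iff induces_copy_copies_K2_iff plus_matching_def
    using anticomplete_sym by (metis Un_commute)
  have butterfly: "digraph_iso (with_proj H)
        (with_proj (disjoint_union (copies (k - 2) (complete_graph 2))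
          (graph_join (complete_graph 1) (copies 2 (complete_graph 2)))))
      \<longleftrightarrow> (\<exists>D. induces_butterfly (pair_adj H) D \<and> plus_matching (pair_adj H) (k - 2) D (pverts H))"
    by (subst digraph_iso_iff[OF wf], intro pair_wf_digraph_intros,
        unfold induces_copy_plus_matching_iff induces_copy_butterfly_iff, blast)
  have "P4_free (pair_adj H) (pverts H)"
    if "induces_P3 (pair_adj H) D \<or> induces_butterfly (pair_adj H) D"
      "plus_matching (pair_adj H) n D (pverts H)" for n D
    using that P4_free_plus_matching P4_free_P3 P4_free_butterfly by blast
  then show ?thesis
    unfolding P3 butterfly connected_obstruction_plus_matching_iff[OF H]
      cograph_min_polar_obstruction_iff[OF H]
    using P3_residual_iff[OF k fin] by blast
qed

lemma ex_P3_component_complement: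
  assumes G: "pair_graph G"
    and C: "C \<in> pre_digraph.sccs (with_proj G)" "digraph_iso C (with_proj (path_graph 3))"
  obtains H :: "nat pair_pre_digraph"
    where "pair_graph H" "digraph_iso (with_proj G) (with_proj (disjoint_union (path_graph 3) H))"
proof -
  interpret pair_graph G using G .
  interpret simple_graph "pair_adj G" using G pair_graph_iff by blast
  obtain P where P: "P \<subseteq> pverts G" "C = with_proj (pair_restrict G P)"
    using in_sccs_imp_induced[OF C(1)] induced_subgraph_iff[OF G] by blast
  have P3: "induces_copy (path_graph 3) (pair_adj G) P"
    using C(2) unfolding P(2) digraph_iso_restrict_iff[OF pair_wf_digraph_path_graph] .
  have "P \<in> sccs_verts" using C(1) unfolding sccs_verts_conv P(2) by (auto intro: rev_image_eqI)
  then have "v \<in> P" if "u \<in> P" "v \<in> pverts G" "pair_adj G u v" for u v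
    using that adj_sym[OF that(3)]
    unfolding in_sccs_verts_conv_reachable pair_adj_def by (meson reachable_adjI)
  then have anti: "anticomplete (pair_adj G) P (pverts G - P)" unfolding anticomplete_def by blast
  obtain H :: "nat pair_pre_digraph" where H: "pair_graph H"
    "induces_copy H (pair_adj G) (pverts G - P)"
    using ex_nat_copy finite_Diff[OF pair_finite_verts] by blast
  have wf: "pair_wf_digraph G" "pair_wf_digraph (disjoint_union (path_graph 3) H)"
    using G H(1) pair_graph_iff by (auto intro: pair_wf_digraph_intros)
  have "P \<union> (pverts G - P) = pverts G" using P(1) by blast
  then have "digraph_iso (with_proj G) (with_proj (disjoint_union (path_graph 3) H))"
    unfolding digraph_iso_iff[OF wf] induces_copy_disjoint_union_iff using anti P3 H(2) by blast
  then show ?thesis using that H(1) by blast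
qed

theorem theorem6:
  fixes G :: "'a pair_pre_digraph" and k :: nat
  assumes "k \<ge> 2"
    and "pair_graph G"
    and "\<exists>C\<in>pre_digraph.sccs (with_proj G). digraph_iso C (with_proj (path_graph 3))"
  shows "cograph_min_polar_obstruction \<infinity> (enat k) (with_proj G) \<longleftrightarrow>
    (\<exists>H :: nat pair_pre_digraph. pair_graph H \<and>
      digraph_iso (with_proj G) (with_proj (disjoint_union (path_graph 3) H)) \<and>
      (digraph_iso (with_proj H)
          (with_proj (disjoint_union (path_graph 3) (copies (k - 1) (complete_graph 2))))
       \<or> digraph_iso (with_proj H)
          (with_proj (disjoint_union (copies (k - 2) (complete_graph 2))
            (graph_join (complete_graph 1) (copies 2 (complete_graph 2)))))
       \<or> (\<exists>j\<in>{1..k - 1}. \<exists>H\<^sub>j :: nat pair_pre_digraph. pair_graph H\<^sub>j \<and>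
            Digraph_Component.connected (with_proj H\<^sub>j) \<and>
            cograph_min_polar_obstruction 1 (enat j) (with_proj H\<^sub>j) \<and>
            \<not> cograph_min_polar_obstruction 1 \<infinity> (with_proj H\<^sub>j) \<and>
            digraph_iso (with_proj H)
              (with_proj (disjoint_union (copies (k - j - 1) (complete_graph 2)) H\<^sub>j)))
       \<or> (k \<ge> 3 \<and> cograph_min_polar_obstruction 1 \<infinity> (with_proj H))))"
  (is "?obstruction \<longleftrightarrow> (\<exists>H. pair_graph H \<and> ?P3_union H \<and> ?alternatives H)")
proof -
  have "?obstruction \<longleftrightarrow> ?alternatives H" if "pair_graph H" "?P3_union H" for H :: "nat pair_pre_digraph"
    using cograph_min_polar_obstruction_P3_union_iff[OF assms(1,2) that]
      P3_residual_iff_digraph_iso[OF assms(1) that(1)]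
    by simp
  moreover obtain H :: "nat pair_pre_digraph" where "pair_graph H" "?P3_union H"
    using assms(3) ex_P3_component_complement[OF assms(2)] by blast
  ultimately show ?thesis by blast
qed

end
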